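(* Let $\mathbf V$ be a variety of algebras, $A$ an algebra in $\mathbf V$, and $M$ an $A$-module totally in $\mathbf V$. Let $U$, $Z=({}_aZ_b)_{a,b\in A}$, the elements $(u)_b$, the action of $Z$ on $M$ and the multiplication in $Z$ be as defined in the context. Then, for all $a,b\in A$: (1) $(x)_bm=m$ for $m\in{}_bM$; (2) if $z\in{}_aZ_b$, then $z(x)_b=z$ and $(x)_az=z$; (3) the action $\langle z,m\rangle\mapsto zm$ is bilinear; (4) the multiplication $\langle z,z'\rangle\mapsto zz'$ is bilinear; (5) if $u\in U$ and $m\in{}_bM$, then $(u)_bm=u^M_{\langle b\rangle}(m)$; (6) if $u,v\in U$, then $(v)_{u(b)}(u)_b=(vu)_b$; (7) the action of $Z$ on $M$ is associative, i.e. $(z'z)m=z'(zm)$ whenever defined; (8) multiplication in $Z$ is associative; (9) $Z$ is a ringoid with set of objects $|A|$, with identity elements $1^Z_b=(x)_b$ and zero elements ${}_a0^Z_b=(a)_b$; (10) the $|A|$-tuple of abelian groups $M$, with the defined action by $Z$, forms a left $Z$-module. Now let $M'$ be another $A$-module totally in $\mathbf V$ and $\phi:M\to M'$ a homomorphism of $A$-modules. Then (11) if $z\in{}_aZ_b$ and $m\in{}_bM$, then $z({}_b\phi(m))={}_a\phi(zm)$.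
   Context: A type $\Omega$ is a family of sets $\Omega_n$ ($n\in\mathbb{N}$, $0\in\mathbb N$) of $n$-ary operation symbols; algebras may be empty. Let $A$ be an algebra of type $\Omega$. Modules and pointed overalgebras. An $A$-module $M$ is an $|A|$-tuple of abelian groups $({}_aM)_{a\in A}$ with, for each $n$-ary $\omega$ and $\mathbf{a}\in A^n$, a group homomorphism $\omega^M_{\mathbf a}:{}_{\mathbf a}M\to{}_{\omega(\mathbf a)}M$, where ${}_{\mathbf a}M={}_{a_1}M\times\cdots\times{}_{a_n}M$. A pointed $A$-overalgebra $P$ is the same with pointed sets ${}_aP$ (basepoint ${}_a*$) and pointed maps instead. A homomorphism is an $A$-tuple of group homomorphisms (resp. pointed maps) ${}_a\phi:{}_aM\to{}_aM'$ with ${}_{\omega(\mathbf a)}\phi(\omega^M_{\mathbf a}(\mathbf m))=\omega^{M'}_{\mathbf a}({}_{a_1}\phi(m_1),\ldots,{}_{a_n}\phi(m_n))$. The forgetful functor $\mathcal{U}$ takes an $A$-module to the pointed $A$-overalgebra with the same maps and basepoints ${}_a0$. The total algebra $A\ltimes M$ is $\{\langle a,m\rangle: m\in{}_aM\}$ with $\omega(\langle a_1,m_1\rangle,\ldots)=\langle\omega(\mathbf a),\omega^M_{\mathbf a}(\mathbf m)\rangle$; $M$ is totally in $\mathbf V$ if $A\ltimes M\in\mathbf V$. $\mathrm{Ab}[A,\mathbf V]$ and $\mathrm{Pnt}[A,\mathbf V]$ denote the categories of $A$-modules and pointed $A$-overalgebras totally in $\mathbf V$. Modulization. Given a pointed $A$-overalgebra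 $P$, let $\hat{\mathcal M}P$ be the $A$-module with ${}_a(\hat{\mathcal M}P)$ the free abelian group on the set ${}_aP$ and $\omega^{\hat{\mathcal M}P}_{\mathbf a}(\mathbf m)=\sum_{i}\omega^{\hat{\mathcal M}P}_{\mathbf a,i}(m_i)$, where $\omega^{\hat{\mathcal M}P}_{\mathbf a,i}$ is the group homomorphism with $\omega^{\hat{\mathcal M}P}_{\mathbf a,i}(p)=\omega^P_{\mathbf a}({}_{a_1}*,\ldots,{}_{a_{i-1}}*,p,{}_{a_{i+1}}*,\ldots,{}_{a_n}* )$ for $p\in{}_{a_i}P$. Let $\mathcal KP$ be the smallest submodule (family of subgroups closed under all $\omega_{\mathbf a}$) containing every ${}_a*$ and every $\omega^P_{\mathbf a}(\mathbf p)-\sum_i\omega^{\hat{\mathcal M}P}_{\mathbf a,i}(p_i)$. Then $\mathcal MP=\hat{\mathcal M}P/\mathcal KP$, and ${}_a(\eta P):{}_aP\to{}_a(\mathcal MP)$ sends $p$ to its class; $\langle\mathcal MP,\eta P\rangle$ is a universal arrow from $P$ to $\mathcal U$, and $\mathcal MP$ is totally in $\mathbf V$ if $P$ is. Unary polynomials. $U=\mathrm{Pol}_1(A,\mathbf V)$ is the coproduct in $\mathbf V$ of $A$ and the free algebra $\mathcal F_{\mathbf V}\{x\}$, with insertion $\iota_A:A\to U$; one writes $a$ for $\iota_A(a)$. For $u\in U$, $b\in A$, $u(b)\in A$ is the image of $u$ under the homomorphism $\pi_b:U\to A$ with $a\mapsto a$, $x\mapsto b$. For $u,v\in U$, the composite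 $vu$ is the image of $v$ under the endomorphism of $U$ with $a\mapsto a$ and $x\mapsto u$. For $b\in A$, $U_b$ is the pointed $A$-overalgebra (totally in $\mathbf V$) with ${}_aU_b=\pi_b^{-1}(a)$, basepoint $\iota_A(a)$, and $\omega^{U_b}_{\mathbf a}(\mathbf u)=\omega^U(\mathbf u)$. It is free in $\mathrm{Pnt}[A,\mathbf V]$ on the one generator $x\in{}_bU_b$: for $P\in\mathrm{Pnt}[A,\mathbf V]$ and $p\in{}_bP$ there is a unique homomorphism $\psi^P_{b,p}:U_b\to P$ sending $x$ to $p$; $u^P_{\langle b\rangle}(p)$ denotes ${}_{u(b)}(\psi^P_{b,p})(u)$. For $M\in\mathrm{Ab}[A,\mathbf V]$, $u^M_{\langle b\rangle}=u^{\mathcal UM}_{\langle b\rangle}$. The family $Z$. Put ${}_aZ_b={}_a(\mathcal MU_b)$ and $(u)_b={}_{u(b)}(\eta U_b)(u)\in{}_{u(b)}Z_b$. Since $\mathcal MU_b$ is free in $\mathrm{Ab}[A,\mathbf V]$ on $(x)_b$, for $M\in\mathrm{Ab}[A,\mathbf V]$ and $m\in{}_bM$ there is a unique homomorphism $\theta_{b,m}:\mathcal MU_b\to M$ sending $(x)_b$ to $m$. For $z\in{}_aZ_b$ and $m\in{}_bM$ put $zm={}_a(\theta_{b,m})(z)\in{}_aM$. For $z\in{}_aZ_b$, $z'\in{}_bZ_c$, the product $zz'\in{}_aZ_c$ is the result of the action of $z$ on $z'\in{}_b(\mathcal MU_c)$. A ringoid is a small category whose hom-sets are abelian groups with bilinear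 composition; ${}_{a'}X_a$ denotes the hom-set from $a$ to $a'$, and composition is written as multiplication. A left $X$-module is an additive functor from $X$ to abelian groups, i.e. a family of abelian groups ${}_aM$ with a unital, bilinear, associative action ${}_{a'}X_a\times{}_aM\to{}_{a'}M$. *)

theory Defs
  imports "HOL-Algebra.Free_Abelian_Groups" "HOL-Algebra.Weak_Morphisms"
begin

section \<open>Algebras and varieties\<close>

text \<open>A type of algebras is a family \<open>Om :: nat \<Rightarrow> 'f set\<close>, where \<open>Om n\<close> is the set of
  \<open>n\<close>-ary operation symbols. An operation takes the list of its arguments, so the arity at which
  a symbol is used is the length of that list. Carriers may be empty.\<close>

record ('f, 'a) alg = "'a partial_object" +
  opr :: "'f \<Rightarrow> 'a list \<Rightarrow> 'a"

definition is_algebra :: "(nat \<Rightarrow> 'f set) \<Rightarrow> ('f, 'a) alg \<Rightarrow> bool" where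
  "is_algebra Om A \<longleftrightarrow>
     (\<forall>f as. f \<in> Om (length as) \<longrightarrow> set as \<subseteq> carrier A \<longrightarrow> opr A f as \<in> carrier A)"

definition alg_hom :: "(nat \<Rightarrow> 'f set) \<Rightarrow> ('f, 'a) alg \<Rightarrow> ('f, 'b) alg \<Rightarrow> ('a \<Rightarrow> 'b) set" where
  "alg_hom Om A B = {h \<in> carrier A \<rightarrow> carrier B.
     \<forall>f as. f \<in> Om (length as) \<longrightarrow> set as \<subseteq> carrier A \<longrightarrow>
       h (opr A f as) = opr B f (map h as)}"

datatype ('f, 'v) trm = Var 'v | App 'f "('f, 'v) trm list"

inductive_set trms :: "(nat \<Rightarrow> 'f set) \<Rightarrow> 'v set \<Rightarrow> ('f, 'v) trm set"
  for Om :: "nat \<Rightarrow> 'f set" and X :: "'v set" where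
  Var: "v \<in> X \<Longrightarrow> Var v \<in> trms Om X"
| App: "f \<in> Om (length ts) \<Longrightarrow> \<forall>t\<in>set ts. t \<in> trms Om X \<Longrightarrow> App f ts \<in> trms Om X"

definition trm_alg :: "(nat \<Rightarrow> 'f set) \<Rightarrow> 'v set \<Rightarrow> ('f, ('f, 'v) trm) alg" where
  "trm_alg Om X = \<lparr>carrier = trms Om X, opr = App\<rparr>"

primrec trm_val :: "('f, 'a) alg \<Rightarrow> ('v \<Rightarrow> 'a) \<Rightarrow> ('f, 'v) trm \<Rightarrow> 'a" where
  "trm_val A \<sigma> (Var v) = \<sigma> v"
| "trm_val A \<sigma> (App f ts) = opr A f (map (trm_val A \<sigma>) ts)"

text \<open>A variety is given by a set \<open>E\<close> of identities in countably many variables.\<close>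

definition is_identities :: "(nat \<Rightarrow> 'f set) \<Rightarrow> (('f, nat) trm \<times> ('f, nat) trm) set \<Rightarrow> bool" where
  "is_identities Om E \<longleftrightarrow> E \<subseteq> trms Om UNIV \<times> trms Om UNIV"

definition in_variety ::
  "(nat \<Rightarrow> 'f set) \<Rightarrow> (('f, nat) trm \<times> ('f, nat) trm) set \<Rightarrow> ('f, 'a) alg \<Rightarrow> bool" where
  "in_variety Om E A \<longleftrightarrow> is_algebra Om A \<and>
     (\<forall>(l, r)\<in>E. \<forall>\<sigma>. range \<sigma> \<subseteq> carrier A \<longrightarrow> trm_val A \<sigma> l = trm_val A \<sigma> r)"


section \<open>Free algebras and coproducts in a variety\<close>

text \<open>The algebra presented in the variety by generators \<open>X\<close> and relations \<open>R\<close> is the quotient of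
  the term algebra by the least congruence containing \<open>R\<close> and all instances of the identities.\<close>

inductive_set pcong ::
  "(nat \<Rightarrow> 'f set) \<Rightarrow> (('f, nat) trm \<times> ('f, nat) trm) set \<Rightarrow> 'v set \<Rightarrow>
   (('f, 'v) trm \<times> ('f, 'v) trm) set \<Rightarrow> (('f, 'v) trm \<times> ('f, 'v) trm) set"
  for Om :: "nat \<Rightarrow> 'f set" and E :: "(('f, nat) trm \<times> ('f, nat) trm) set" and X :: "'v set"
    and R :: "(('f, 'v) trm \<times> ('f, 'v) trm) set" where
  rel: "(s, t) \<in> R \<Longrightarrow> (s, t) \<in> pcong Om E X R"
| ident: "(l, r) \<in> E \<Longrightarrow> range \<sigma> \<subseteq> trms Om X \<Longrightarrow>
    (trm_val (trm_alg Om X) \<sigma> l, trm_val (trm_alg Om X) \<sigma> r) \<in> pcong Om E X R"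
| refl: "t \<in> trms Om X \<Longrightarrow> (t, t) \<in> pcong Om E X R"
| sym: "(s, t) \<in> pcong Om E X R \<Longrightarrow> (t, s) \<in> pcong Om E X R"
| trans: "(s, t) \<in> pcong Om E X R \<Longrightarrow> (t, u) \<in> pcong Om E X R \<Longrightarrow> (s, u) \<in> pcong Om E X R"
| opr: "f \<in> Om (length ss) \<Longrightarrow> list_all2 (\<lambda>s t. (s, t) \<in> pcong Om E X R) ss ts \<Longrightarrow>
    (App f ss, App f ts) \<in> pcong Om E X R"

definition presented ::
  "(nat \<Rightarrow> 'f set) \<Rightarrow> (('f, nat) trm \<times> ('f, nat) trm) set \<Rightarrow> 'v set \<Rightarrow>
   (('f, 'v) trm \<times> ('f, 'v) trm) set \<Rightarrow> ('f, ('f, 'v) trm set) alg" where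
  "presented Om E X R =
     \<lparr>carrier = trms Om X // pcong Om E X R,
      opr = (\<lambda>f Ts. pcong Om E X R `` (App f ` listset Ts))\<rparr>"

definition free_alg ::
  "(nat \<Rightarrow> 'f set) \<Rightarrow> (('f, nat) trm \<times> ('f, nat) trm) set \<Rightarrow> 'v set \<Rightarrow>
   ('f, ('f, 'v) trm set) alg" where
  "free_alg Om E X = presented Om E X {}"

definition free_gen ::
  "(nat \<Rightarrow> 'f set) \<Rightarrow> (('f, nat) trm \<times> ('f, nat) trm) set \<Rightarrow> 'v set \<Rightarrow> 'v \<Rightarrow>
   ('f, 'v) trm set" where
  "free_gen Om E X v = pcong Om E X {} `` {Var v}"

definition op_table ::
  "(nat \<Rightarrow> 'f set) \<Rightarrow> ('f, 'a) alg \<Rightarrow> ('a \<Rightarrow> 'v) \<Rightarrow> (('f, 'v) trm \<times> ('f, 'v) trm) set" where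
  "op_table Om A j = {(App f (map (Var \<circ> j) as), Var (j (opr A f as))) | f as.
     f \<in> Om (length as) \<and> set as \<subseteq> carrier A}"

definition coprod_rels ::
  "(nat \<Rightarrow> 'f set) \<Rightarrow> ('f, 'a) alg \<Rightarrow> ('f, 'b) alg \<Rightarrow>
   (('f, 'a + 'b) trm \<times> ('f, 'a + 'b) trm) set" where
  "coprod_rels Om A B = op_table Om A Inl \<union> op_table Om B Inr"

definition coprod ::
  "(nat \<Rightarrow> 'f set) \<Rightarrow> (('f, nat) trm \<times> ('f, nat) trm) set \<Rightarrow> ('f, 'a) alg \<Rightarrow> ('f, 'b) alg \<Rightarrow>
   ('f, ('f, 'a + 'b) trm set) alg" where
  "coprod Om E A B = presented Om E (Sum_Type.Plus (carrier A) (carrier B)) (coprod_rels Om A B)"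

definition coprod_inl ::
  "(nat \<Rightarrow> 'f set) \<Rightarrow> (('f, nat) trm \<times> ('f, nat) trm) set \<Rightarrow> ('f, 'a) alg \<Rightarrow> ('f, 'b) alg \<Rightarrow>
   'a \<Rightarrow> ('f, 'a + 'b) trm set" where
  "coprod_inl Om E A B a =
     pcong Om E (Sum_Type.Plus (carrier A) (carrier B)) (coprod_rels Om A B) `` {Var (Inl a)}"

definition coprod_inr ::
  "(nat \<Rightarrow> 'f set) \<Rightarrow> (('f, nat) trm \<times> ('f, nat) trm) set \<Rightarrow> ('f, 'a) alg \<Rightarrow> ('f, 'b) alg \<Rightarrow>
   'b \<Rightarrow> ('f, 'a + 'b) trm set" where
  "coprod_inr Om E A B b =
     pcong Om E (Sum_Type.Plus (carrier A) (carrier B)) (coprod_rels Om A B) `` {Var (Inr b)}"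

text \<open>These constructions lie in the variety and have the expected universal properties, with
  respect to algebras of the variety over an arbitrary HOL type.\<close>

lemma in_listset: "xs \<in> listset As \<longleftrightarrow> list_all2 (\<in>) xs As"
proof (induction As arbitrary: xs)
  case (Cons A As)
  then show ?case by (cases xs) (simp_all add: set_Cons_def)
qed simp

lemma trm_val_closed:
  assumes "is_algebra Om A" "\<forall>v\<in>X. \<sigma> v \<in> carrier A" "t \<in> trms Om X"
  shows "trm_val A \<sigma> t \<in> carrier A"
  using assms(3)
proof induction
  case (Var v)
  then show ?case using assms(2) by simp
next
  case (App f ts)
  then have "set (map (trm_val A \<sigma>) ts) \<subseteq> carrier A" by auto
  then show ?case using App(1) assms(1) by (simp add: is_algebra_def)
qed

lemma trm_alg_algebra: "is_algebra Om (trm_alg Om X)"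
  by (auto simp: is_algebra_def trm_alg_def intro!: trms.App)

lemma pcong_trms:
  assumes "is_identities Om E" "R \<subseteq> trms Om X \<times> trms Om X" "(s, t) \<in> pcong Om E X R"
  shows "s \<in> trms Om X \<and> t \<in> trms Om X"
  using assms(3)
proof induction
  case (ident l r \<sigma>)
  have "trm_val (trm_alg Om X) \<sigma> w \<in> carrier (trm_alg Om X)" if "w \<in> trms Om UNIV" for w
    using trm_val_closed[OF trm_alg_algebra _ that] ident(2) by (fastforce simp: trm_alg_def)
  then show ?case using ident(1) assms(1) by (auto simp: is_identities_def trm_alg_def)
next
  case (opr f ss ts)
  then show ?case
    by (auto simp: list_all2_conv_all_nth in_set_conv_nth intro!: trms.App)
qed (use assms(2) in auto)

lemma pcong_equiv:
  assumes "is_identities Om E" "R \<subseteq> trms Om X \<times> trms Om X"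
  shows "equiv (trms Om X) (pcong Om E X R)"
proof (rule equivI)
  show "pcong Om E X R \<subseteq> trms Om X \<times> trms Om X" using pcong_trms[OF assms] by auto
  show "refl_on (trms Om X) (pcong Om E X R)" by (auto simp: refl_on_def intro: pcong.refl)
  show "Relation.sym (pcong Om E X R)" by (auto simp: sym_def intro: pcong.sym)
  show "Relation.trans (pcong Om E X R)" by (auto simp: trans_def intro: pcong.trans)
qed

lemma presented_opr:
  assumes "is_identities Om E" "R \<subseteq> trms Om X \<times> trms Om X"
    and "f \<in> Om (length ts)" "set ts \<subseteq> trms Om X"
  shows "opr (presented Om E X R) f (map (\<lambda>t. pcong Om E X R `` {t}) ts)
    = pcong Om E X R `` {App f ts}"
proof -
  let ?C = "pcong Om E X R" let ?L = "listset (map (\<lambda>t. ?C `` {t}) ts)"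
  have ts: "ts \<in> ?L" using assms(4)
    by (auto simp: in_listset list_all2_conv_all_nth intro!: pcong.refl)
  have "(App f ts, App f us) \<in> ?C" if "us \<in> ?L" for us
    using that assms(3) by (intro pcong.opr) (auto simp: in_listset list_all2_conv_all_nth)
  then have "?C `` (App f ` ?L) = ?C `` {App f ts}"
    using ts by (auto intro: pcong.trans pcong.sym)
  then show ?thesis by (simp add: presented_def)
qed

lemma presented_reps:
  assumes "set us \<subseteq> carrier (presented Om E X R)"
  obtains ts where "set ts \<subseteq> trms Om X" "us = map (\<lambda>t. pcong Om E X R `` {t}) ts"
proof -
  have "\<forall>u\<in>set us. \<exists>t. t \<in> trms Om X \<and> u = pcong Om E X R `` {t}"
    using assms by (auto simp: presented_def quotient_def)
  then obtain r where r: "\<forall>u\<in>set us. r u \<in> trms Om X \<and> u = pcong Om E X R `` {r u}" by metis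
  show ?thesis
  proof (rule that)
    show "set (map r us) \<subseteq> trms Om X" using r by auto
    have "map (\<lambda>t. pcong Om E X R `` {t}) (map r us) = map (\<lambda>u. u) us"
      unfolding map_map by (rule map_cong[OF HOL.refl]) (use r in auto)
    then show "us = map (\<lambda>t. pcong Om E X R `` {t}) (map r us)" by simp
  qed
qed

lemma presented_in_variety:
  assumes "is_identities Om E" "R \<subseteq> trms Om X \<times> trms Om X"
  shows "in_variety Om E (presented Om E X R)"
proof -
  let ?P = "presented Om E X R" let ?c = "\<lambda>t. pcong Om E X R `` {t}"
  have alg: "is_algebra Om ?P" unfolding is_algebra_def
  proof (intro allI impI)
    fix f us assume f: "f \<in> Om (length us)" and "set us \<subseteq> carrier ?P"
    then obtain ts where ts: "set ts \<subseteq> trms Om X" "us = map ?c ts"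
      using presented_reps by blast
    then have "App f ts \<in> trms Om X" using f by (auto intro!: trms.App)
    moreover have "opr ?P f us = ?c (App f ts)" using presented_opr[OF assms] f ts by simp
    ultimately show "opr ?P f us \<in> carrier ?P" by (auto simp: presented_def intro: quotientI)
  qed
  have "trm_val ?P \<sigma> l = trm_val ?P \<sigma> r"
    if lr: "(l, r) \<in> E" and \<sigma>: "range \<sigma> \<subseteq> carrier ?P" for l r and \<sigma> :: "nat \<Rightarrow> _"
  proof -
    have "\<sigma> n \<in> trms Om X // pcong Om E X R" for n using \<sigma> by (auto simp: presented_def)
    then have "\<forall>n. \<exists>t. t \<in> trms Om X \<and> \<sigma> n = ?c t" by (meson quotientE)
    then obtain \<tau> where \<tau>: "\<And>n. \<tau> n \<in> trms Om X" "\<And>n. \<sigma> n = ?c (\<tau> n)" by metis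
    have val: "trm_val ?P \<sigma> w = ?c (trm_val (trm_alg Om X) \<tau> w)
        \<and> trm_val (trm_alg Om X) \<tau> w \<in> trms Om X" if "w \<in> trms Om UNIV" for w
      using that
    proof induction
      case (Var v)
      then show ?case using \<tau> by simp
    next
      case (App f ts)
      let ?ts = "map (trm_val (trm_alg Om X) \<tau>) ts"
      have 1: "set ?ts \<subseteq> trms Om X" using App by auto
      have 2: "map (trm_val ?P \<sigma>) ts = map ?c ?ts"
        unfolding map_map by (rule map_cong[OF HOL.refl]) (use App in simp)
      have "opr ?P f (map (trm_val ?P \<sigma>) ts) = ?c (App f ?ts)"
        unfolding 2 using presented_opr[OF assms, of f ?ts] App(1) 1 by simp
      moreover have "App f ?ts \<in> trms Om X" using App(1) 1 by (auto intro!: trms.App)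
      ultimately show ?case by (simp add: trm_alg_def)
    qed
    have "(trm_val (trm_alg Om X) \<tau> l, trm_val (trm_alg Om X) \<tau> r) \<in> pcong Om E X R"
      using \<tau>(1) by (intro pcong.ident[OF lr]) auto
    then have "?c (trm_val (trm_alg Om X) \<tau> l) = ?c (trm_val (trm_alg Om X) \<tau> r)"
      by (rule equiv_class_eq[OF pcong_equiv[OF assms]])
    moreover have "l \<in> trms Om UNIV" "r \<in> trms Om UNIV"
      using lr assms(1) by (auto simp: is_identities_def)
    ultimately show ?thesis by (simp only: val[THEN conjunct1])
  qed
  with alg show ?thesis by (auto simp: in_variety_def)
qed

lemma pcong_sound:
  assumes "is_identities Om E" "in_variety Om E C" "\<forall>x\<in>X. \<rho> x \<in> carrier C"
    and "\<forall>(s, t)\<in>R. trm_val C \<rho> s = trm_val C \<rho> t" "(s, t) \<in> pcong Om E X R"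
  shows "trm_val C \<rho> s = trm_val C \<rho> t"
  using assms(5)
proof induction
  case (rel s t)
  then show ?case using assms(4) by auto
next
  case (ident l r \<sigma>)
  have subst: "trm_val C \<rho> (trm_val (trm_alg Om X) \<sigma> w) = trm_val C (\<lambda>n. trm_val C \<rho> (\<sigma> n)) w" for w
    by (induction w) (auto simp: trm_alg_def comp_def cong: map_cong)
  have "is_algebra Om C" using assms(2) by (simp add: in_variety_def)
  then have "range (\<lambda>n. trm_val C \<rho> (\<sigma> n)) \<subseteq> carrier C"
    using trm_val_closed[OF _ assms(3)] ident(2) by blast
  then show ?case unfolding subst using assms(2) ident(1) by (fastforce simp: in_variety_def)
next
  case (opr f ss ts)
  then have "map (trm_val C \<rho>) ss = map (trm_val C \<rho>) ts"
    by (auto simp: list_all2_conv_all_nth intro: nth_equalityI)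
  then show ?case by (simp only: trm_val.simps)
qed auto

lemma presented_universal:
  assumes I: "is_identities Om E" and R: "R \<subseteq> trms Om X \<times> trms Om X"
    and C: "in_variety Om E C" and \<rho>: "\<forall>x\<in>X. \<rho> x \<in> carrier C"
    and rel: "\<forall>(s, t)\<in>R. trm_val C \<rho> s = trm_val C \<rho> t"
  shows "\<exists>!k. k \<in> alg_hom Om (presented Om E X R) C \<and>
    k \<in> extensional (carrier (presented Om E X R)) \<and>
    (\<forall>x\<in>X. k (pcong Om E X R `` {Var x}) = \<rho> x)"
proof -
  let ?P = "presented Om E X R" let ?c = "\<lambda>t. pcong Om E X R `` {t}"
  have alg: "is_algebra Om C" using C by (simp add: in_variety_def)
  have c_car: "?c t \<in> carrier ?P" if "t \<in> trms Om X" for t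
    using that by (simp add: presented_def quotientI)
  define k where "k = (\<lambda>u\<in>carrier ?P. trm_val C \<rho> (SOME t. t \<in> u))"
  have k: "k (?c t) = trm_val C \<rho> t" if t: "t \<in> trms Om X" for t
  proof -
    have "t \<in> ?c t" using t by (auto intro: pcong.refl)
    then have "(SOME t'. t' \<in> ?c t) \<in> ?c t" by (rule someI)
    then have "(t, SOME t'. t' \<in> ?c t) \<in> pcong Om E X R" by simp
    then show ?thesis using pcong_sound[OF I C \<rho> rel] c_car[OF t] by (simp add: k_def)
  qed
  have ext: "k \<in> extensional (carrier ?P)" by (simp add: k_def)
  have hom: "k \<in> alg_hom Om ?P C" unfolding alg_hom_def
  proof (intro CollectI conjI allI impI)
    show "k \<in> carrier ?P \<rightarrow> carrier C"
      using k trm_val_closed[OF alg \<rho>] by (auto simp: presented_def quotient_def)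
    fix f us assume f: "f \<in> Om (length us)" and "set us \<subseteq> carrier ?P"
    then obtain ts where ts: "set ts \<subseteq> trms Om X" "us = map ?c ts"
      using presented_reps by blast
    have "App f ts \<in> trms Om X" using f ts by (auto intro!: trms.App)
    then have 1: "k (opr ?P f us) = trm_val C \<rho> (App f ts)"
      using presented_opr[OF I R, of f ts] f ts k by simp
    have "map (trm_val C \<rho>) ts = map k us"
      using ts(1) unfolding ts(2) by (auto simp: k subset_iff)
    then have "trm_val C \<rho> (App f ts) = opr C f (map k us)" by simp
    with 1 show "k (opr ?P f us) = opr C f (map k us)" by simp
  qed
  have det: "h (?c t) = trm_val C \<rho> t"
    if h: "h \<in> alg_hom Om ?P C" "\<forall>x\<in>X. h (?c (Var x)) = \<rho> x" and "t \<in> trms Om X" for h t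
    using that(3)
  proof induction
    case (Var v)
    then show ?case using h(2) by simp
  next
    case (App f ts)
    then have ts: "set ts \<subseteq> trms Om X" by auto
    have "h (?c (App f ts)) = h (opr ?P f (map ?c ts))"
      using presented_opr[OF I R, of f ts] App(1) ts by simp
    also have "\<dots> = opr C f (map h (map ?c ts))"
    proof -
      have "set (map ?c ts) \<subseteq> carrier ?P" using ts c_car by auto
      moreover have "f \<in> Om (length (map ?c ts))" using App(1) by simp
      ultimately show ?thesis using h(1) unfolding alg_hom_def by blast
    qed
    finally have 3: "h (?c (App f ts)) = opr C f (map h (map ?c ts))" .
    have "map h (map ?c ts) = map (trm_val C \<rho>) ts" using App by auto
    then have 2: "opr C f (map h (map ?c ts)) = trm_val C \<rho> (App f ts)"
      by (simp del: map_map)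
    with 3 show ?case by simp
  qed
  show ?thesis
  proof (rule ex1I[of _ k])
    show "k \<in> alg_hom Om ?P C \<and> k \<in> extensional (carrier ?P) \<and> (\<forall>x\<in>X. k (?c (Var x)) = \<rho> x)"
      using hom ext by (auto simp: k trms.Var)
    fix h assume h: "h \<in> alg_hom Om ?P C \<and> h \<in> extensional (carrier ?P) \<and>
      (\<forall>x\<in>X. h (?c (Var x)) = \<rho> x)"
    show "h = k"
    proof (rule extensionalityI[of _ "carrier ?P"])
      show "h \<in> extensional (carrier ?P)" "k \<in> extensional (carrier ?P)" using h ext by blast+
      fix u assume "u \<in> carrier ?P"
      then obtain t where t: "t \<in> trms Om X" "u = ?c t" by (auto simp: presented_def quotient_def)
      then show "h u = k u" using det h k by auto
    qed
  qed
qed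

lemma free_alg_in_variety: "is_identities Om E \<Longrightarrow> in_variety Om E (free_alg Om E X)"
  unfolding free_alg_def by (rule presented_in_variety) auto

lemma free_alg_universal:
  assumes "is_identities Om E" "in_variety Om E C" "\<forall>x\<in>X. \<rho> x \<in> carrier C"
  shows "\<exists>!k. k \<in> alg_hom Om (free_alg Om E X) C \<and> k \<in> extensional (carrier (free_alg Om E X)) \<and>
    (\<forall>x\<in>X. k (free_gen Om E X x) = \<rho> x)"
  unfolding free_alg_def free_gen_def
  by (rule presented_universal) (use assms in auto)

lemma free_gen_closed: "x \<in> X \<Longrightarrow> free_gen Om E X x \<in> carrier (free_alg Om E X)"
  by (simp add: free_gen_def free_alg_def presented_def quotientI trms.Var)

lemma coprod_rels_trms:
  assumes "is_algebra Om A" "is_algebra Om B"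
  shows "coprod_rels Om A B \<subseteq> trms Om (Sum_Type.Plus (carrier A) (carrier B)) \<times> trms Om (Sum_Type.Plus (carrier A) (carrier B))"
  using assms
  by (fastforce simp: coprod_rels_def op_table_def is_algebra_def intro!: trms.App trms.Var)

lemma coprod_in_variety:
  assumes "is_identities Om E" "is_algebra Om A" "is_algebra Om B"
  shows "in_variety Om E (coprod Om E A B)"
  unfolding coprod_def using assms by (intro presented_in_variety coprod_rels_trms)

lemma coprod_insertion:
  fixes A :: "('f, 'a) alg" and B :: "('f, 'b) alg"
  assumes I: "is_identities Om E" and A: "is_algebra Om A" and B: "is_algebra Om B"
  shows "coprod_inl Om E A B \<in> alg_hom Om A (coprod Om E A B)"
    and "coprod_inr Om E A B \<in> alg_hom Om B (coprod Om E A B)"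
proof -
  let ?X = "Sum_Type.Plus (carrier A) (carrier B)" let ?R = "coprod_rels Om A B"
  let ?c = "\<lambda>t. pcong Om E ?X ?R `` {t}"
  note R = coprod_rels_trms[OF A B]
  have gen: "(\<lambda>d. ?c (Var (j d))) \<in> alg_hom Om D (presented Om E ?X ?R)"
    if j: "\<forall>d\<in>carrier D. j d \<in> ?X" and sub: "op_table Om D j \<subseteq> ?R" for D and j :: "'d \<Rightarrow> 'a + 'b"
    unfolding alg_hom_def
  proof (intro CollectI conjI allI impI)
    show "(\<lambda>d. ?c (Var (j d))) \<in> carrier D \<rightarrow> carrier (presented Om E ?X ?R)"
      using j by (auto simp: presented_def intro!: quotientI trms.Var)
    fix f as assume f: "f \<in> Om (length as)" and as: "set as \<subseteq> carrier D"
    let ?ts = "map (Var \<circ> j) as"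
    have "(App f ?ts, Var (j (opr D f as))) \<in> ?R"
      using f as sub by (auto simp: op_table_def)
    then have "?c (App f ?ts) = ?c (Var (j (opr D f as)))"
      by (intro equiv_class_eq[OF pcong_equiv[OF I R]] pcong.rel)
    moreover have "set ?ts \<subseteq> trms Om ?X" using as j by (auto intro!: trms.Var)
    then have "opr (presented Om E ?X ?R) f (map ?c ?ts) = ?c (App f ?ts)"
      using f by (intro presented_opr[OF I R]) auto
    ultimately show "?c (Var (j (opr D f as)))
        = opr (presented Om E ?X ?R) f (map (\<lambda>d. ?c (Var (j d))) as)"
      by (simp add: comp_def)
  qed
  show "coprod_inl Om E A B \<in> alg_hom Om A (coprod Om E A B)"
    unfolding coprod_def coprod_inl_def[abs_def]
    by (rule gen) (auto simp: coprod_rels_def)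
  show "coprod_inr Om E A B \<in> alg_hom Om B (coprod Om E A B)"
    unfolding coprod_def coprod_inr_def[abs_def]
    by (rule gen) (auto simp: coprod_rels_def)
qed

lemma coprod_universal:
  assumes I: "is_identities Om E" and A: "is_algebra Om A" and B: "is_algebra Om B"
    and C: "in_variety Om E C" and g: "g \<in> alg_hom Om A C" and h: "h \<in> alg_hom Om B C"
  shows "\<exists>!k. k \<in> alg_hom Om (coprod Om E A B) C \<and> k \<in> extensional (carrier (coprod Om E A B)) \<and>
    (\<forall>a\<in>carrier A. k (coprod_inl Om E A B a) = g a) \<and>
    (\<forall>b\<in>carrier B. k (coprod_inr Om E A B b) = h b)"
proof -
  have rel: "trm_val C (case_sum g h) s = trm_val C (case_sum g h) t"
    if "(s, t) \<in> coprod_rels Om A B" for s t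
    using that g h
    by (auto simp: coprod_rels_def op_table_def alg_hom_def comp_def)
  have car: "\<forall>x\<in>Sum_Type.Plus (carrier A) (carrier B). case_sum g h x \<in> carrier C"
    using g h by (auto simp: alg_hom_def)
  have "(\<forall>x\<in>Sum_Type.Plus (carrier A) (carrier B). P x) \<longleftrightarrow>
    (\<forall>a\<in>carrier A. P (Inl a)) \<and> (\<forall>b\<in>carrier B. P (Inr b))" for P by auto
  then show ?thesis
    using presented_universal[OF I coprod_rels_trms[OF A B] C car] rel
    by (simp add: coprod_def coprod_inl_def coprod_inr_def split_beta)
qed



section \<open>Modules and pointed overalgebras\<close>

text \<open>Abelian groups are \<^const>\<open>comm_group\<close>s; their operation is written additively in the
  mathematics and multiplicatively in HOL-Algebra, so \<open>\<one>\<close> is the zero element. Elements of the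
  products over the entries of an index list \<open>as\<close> are lists. Only indices in the carrier of the
  base algebra matter.\<close>

record ('f, 'a, 'm) amod =
  mgrp :: "'a \<Rightarrow> 'm monoid"
  mop :: "'f \<Rightarrow> 'a list \<Rightarrow> 'm list \<Rightarrow> 'm"

record ('f, 'a, 'p) pover =
  pset :: "'a \<Rightarrow> 'p set"
  pbase :: "'a \<Rightarrow> 'p"
  pop :: "'f \<Rightarrow> 'a list \<Rightarrow> 'p list \<Rightarrow> 'p"

definition is_module :: "(nat \<Rightarrow> 'f set) \<Rightarrow> ('f, 'a) alg \<Rightarrow> ('f, 'a, 'm) amod \<Rightarrow> bool" where
  "is_module Om A M \<longleftrightarrow>
     (\<forall>a\<in>carrier A. comm_group (mgrp M a)) \<and>
     (\<forall>f as. f \<in> Om (length as) \<longrightarrow> set as \<subseteq> carrier A \<longrightarrow>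
        mop M f as \<in> hom (DirProd_list (map (mgrp M) as)) (mgrp M (opr A f as)))"

definition is_pover :: "(nat \<Rightarrow> 'f set) \<Rightarrow> ('f, 'a) alg \<Rightarrow> ('f, 'a, 'p) pover \<Rightarrow> bool" where
  "is_pover Om A P \<longleftrightarrow>
     (\<forall>a\<in>carrier A. pbase P a \<in> pset P a) \<and>
     (\<forall>f as. f \<in> Om (length as) \<longrightarrow> set as \<subseteq> carrier A \<longrightarrow>
        pop P f as \<in> listset (map (pset P) as) \<rightarrow> pset P (opr A f as) \<and>
        pop P f as (map (pbase P) as) = pbase P (opr A f as))"

definition module_hom ::
  "(nat \<Rightarrow> 'f set) \<Rightarrow> ('f, 'a) alg \<Rightarrow> ('f, 'a, 'm) amod \<Rightarrow> ('f, 'a, 'n) amod \<Rightarrow>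
   ('a \<Rightarrow> 'm \<Rightarrow> 'n) set" where
  "module_hom Om A M M' = {\<phi>.
     (\<forall>a\<in>carrier A. \<phi> a \<in> hom (mgrp M a) (mgrp M' a)) \<and>
     (\<forall>f as. f \<in> Om (length as) \<longrightarrow> set as \<subseteq> carrier A \<longrightarrow>
        (\<forall>ms\<in>listset (map (\<lambda>a. carrier (mgrp M a)) as).
           \<phi> (opr A f as) (mop M f as ms) = mop M' f as (map2 \<phi> as ms)))}"

definition pover_hom ::
  "(nat \<Rightarrow> 'f set) \<Rightarrow> ('f, 'a) alg \<Rightarrow> ('f, 'a, 'p) pover \<Rightarrow> ('f, 'a, 'q) pover \<Rightarrow>
   ('a \<Rightarrow> 'p \<Rightarrow> 'q) set" where
  "pover_hom Om A P Q = {\<phi>.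
     (\<forall>a\<in>carrier A. \<phi> a \<in> pset P a \<rightarrow> pset Q a \<and> \<phi> a (pbase P a) = pbase Q a) \<and>
     (\<forall>f as. f \<in> Om (length as) \<longrightarrow> set as \<subseteq> carrier A \<longrightarrow>
        (\<forall>ps\<in>listset (map (pset P) as).
           \<phi> (opr A f as) (pop P f as ps) = pop Q f as (map2 \<phi> as ps)))}"

definition forget :: "('f, 'a, 'm) amod \<Rightarrow> ('f, 'a, 'm) pover" where
  "forget M = \<lparr>pset = (\<lambda>a. carrier (mgrp M a)), pbase = (\<lambda>a. \<one>\<^bsub>mgrp M a\<^esub>), pop = mop M\<rparr>"

definition total_alg :: "('f, 'a) alg \<Rightarrow> ('f, 'a, 'p) pover \<Rightarrow> ('f, 'a \<times> 'p) alg" where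
  "total_alg A P =
     \<lparr>carrier = Sigma (carrier A) (pset P),
      opr = (\<lambda>f xs. (opr A f (map fst xs), pop P f (map fst xs) (map snd xs)))\<rparr>"

text \<open>The objects of \<open>Ab[A, V]\<close>. The total algebra of a module only depends on the underlying
  overalgebra.\<close>

definition module_in ::
  "(nat \<Rightarrow> 'f set) \<Rightarrow> (('f, nat) trm \<times> ('f, nat) trm) set \<Rightarrow> ('f, 'a) alg \<Rightarrow>
   ('f, 'a, 'm) amod \<Rightarrow> bool" where
  "module_in Om E A M \<longleftrightarrow> is_module Om A M \<and> in_variety Om E (total_alg A (forget M))"


section \<open>Modulization\<close>

definition hat_op ::
  "('f, 'a, 'p) pover \<Rightarrow> 'f \<Rightarrow> 'a list \<Rightarrow> nat \<Rightarrow> ('p \<Rightarrow>\<^sub>0 int) \<Rightarrow> ('p \<Rightarrow>\<^sub>0 int)" where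
  "hat_op P f as i = frag_extend (\<lambda>p. frag_of (pop P f as ((map (pbase P) as)[i := p])))"

definition hat_mod :: "('f, 'a, 'p) pover \<Rightarrow> ('f, 'a, 'p \<Rightarrow>\<^sub>0 int) amod" where
  "hat_mod P =
     \<lparr>mgrp = (\<lambda>a. free_Abelian_group (pset P a)),
      mop = (\<lambda>f as ms. \<Sum>i<length as. hat_op P f as i (ms ! i))\<rparr>"

definition submodule ::
  "(nat \<Rightarrow> 'f set) \<Rightarrow> ('f, 'a) alg \<Rightarrow> ('f, 'a, 'm) amod \<Rightarrow> ('a \<Rightarrow> 'm set) \<Rightarrow> bool" where
  "submodule Om A M N \<longleftrightarrow>
     (\<forall>a\<in>carrier A. subgroup (N a) (mgrp M a)) \<and>
     (\<forall>f as. f \<in> Om (length as) \<longrightarrow> set as \<subseteq> carrier A \<longrightarrow>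
        mop M f as \<in> listset (map N as) \<rightarrow> N (opr A f as))"

definition modulize_ker ::
  "(nat \<Rightarrow> 'f set) \<Rightarrow> ('f, 'a) alg \<Rightarrow> ('f, 'a, 'p) pover \<Rightarrow> 'a \<Rightarrow> ('p \<Rightarrow>\<^sub>0 int) set" where
  "modulize_ker Om A P a = \<Inter>{N a | N.
     submodule Om A (hat_mod P) N \<and>
     (\<forall>b\<in>carrier A. frag_of (pbase P b) \<in> N b) \<and>
     (\<forall>f as. f \<in> Om (length as) \<longrightarrow> set as \<subseteq> carrier A \<longrightarrow>
        (\<forall>ps\<in>listset (map (pset P) as).
           frag_of (pop P f as ps) - (\<Sum>i<length as. hat_op P f as i (frag_of (ps ! i)))
             \<in> N (opr A f as)))}"

text \<open>The operation of a quotient module sends a tuple of cosets to the coset of the value at any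
  choice of representatives; the union below is over all these choices.\<close>

definition quot_mod ::
  "('f, 'a) alg \<Rightarrow> ('f, 'a, 'm) amod \<Rightarrow> ('a \<Rightarrow> 'm set) \<Rightarrow> ('f, 'a, 'm set) amod" where
  "quot_mod A M K =
     \<lparr>mgrp = (\<lambda>a. mgrp M a Mod K a),
      mop = (\<lambda>f as Xs. \<Union>ms\<in>listset Xs.
               K (opr A f as) #>\<^bsub>mgrp M (opr A f as)\<^esub> mop M f as ms)\<rparr>"

definition modulize ::
  "(nat \<Rightarrow> 'f set) \<Rightarrow> ('f, 'a) alg \<Rightarrow> ('f, 'a, 'p) pover \<Rightarrow> ('f, 'a, ('p \<Rightarrow>\<^sub>0 int) set) amod" where
  "modulize Om A P = quot_mod A (hat_mod P) (modulize_ker Om A P)"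

definition modulize_unit ::
  "(nat \<Rightarrow> 'f set) \<Rightarrow> ('f, 'a) alg \<Rightarrow> ('f, 'a, 'p) pover \<Rightarrow> 'a \<Rightarrow> 'p \<Rightarrow> ('p \<Rightarrow>\<^sub>0 int) set" where
  "modulize_unit Om A P a p = modulize_ker Om A P a #>\<^bsub>mgrp (hat_mod P) a\<^esub> frag_of p"


section \<open>Unary polynomials\<close>

type_synonym ('f, 'a) pol = "('f, 'a + ('f, unit) trm set) trm set"

definition Pol1 ::
  "(nat \<Rightarrow> 'f set) \<Rightarrow> (('f, nat) trm \<times> ('f, nat) trm) set \<Rightarrow> ('f, 'a) alg \<Rightarrow>
   ('f, ('f, 'a) pol) alg" where
  "Pol1 Om E A = coprod Om E A (free_alg Om E {()})"

definition pol_const ::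
  "(nat \<Rightarrow> 'f set) \<Rightarrow> (('f, nat) trm \<times> ('f, nat) trm) set \<Rightarrow> ('f, 'a) alg \<Rightarrow> 'a \<Rightarrow> ('f, 'a) pol"
where
  "pol_const Om E A = coprod_inl Om E A (free_alg Om E {()})"

definition pol_x ::
  "(nat \<Rightarrow> 'f set) \<Rightarrow> (('f, nat) trm \<times> ('f, nat) trm) set \<Rightarrow> ('f, 'a) alg \<Rightarrow> ('f, 'a) pol" where
  "pol_x Om E A = coprod_inr Om E A (free_alg Om E {()}) (free_gen Om E {()} ())"

text \<open>Homomorphisms given by a universal property are made unique as HOL functions by requiring
  them to be \<^const>\<open>extensional\<close>.\<close>

definition pol_hom ::
  "(nat \<Rightarrow> 'f set) \<Rightarrow> (('f, nat) trm \<times> ('f, nat) trm) set \<Rightarrow> ('f, 'a) alg \<Rightarrow> ('f, 'b) alg \<Rightarrow>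
   ('a \<Rightarrow> 'b) \<Rightarrow> 'b \<Rightarrow> ('f, 'a) pol \<Rightarrow> 'b" where
  "pol_hom Om E A B g y = (THE h.
     h \<in> alg_hom Om (Pol1 Om E A) B \<and> h \<in> extensional (carrier (Pol1 Om E A)) \<and>
     (\<forall>a\<in>carrier A. h (pol_const Om E A a) = g a) \<and> h (pol_x Om E A) = y)"

lemma pol_hom_ex1:
  assumes I: "is_identities Om E" and A: "in_variety Om E A" and B: "in_variety Om E B"
    and g: "g \<in> alg_hom Om A B" and y: "y \<in> carrier B"
  shows "\<exists>!h. h \<in> alg_hom Om (Pol1 Om E A) B \<and> h \<in> extensional (carrier (Pol1 Om E A)) \<and>
    (\<forall>a\<in>carrier A. h (pol_const Om E A a) = g a) \<and> h (pol_x Om E A) = y"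
proof -
  let ?F = "free_alg Om E {()}" let ?x = "free_gen Om E {()} ()"
  let ?inr = "coprod_inr Om E A ?F" and ?U = "Pol1 Om E A"
  note U = Pol1_def[of Om E A] pol_const_def[of Om E A] pol_x_def[of Om E A]
  have alg: "is_algebra Om A" "is_algebra Om ?F"
    using A free_alg_in_variety[OF I] by (auto simp: in_variety_def)
  have x: "?x \<in> carrier ?F" by (simp add: free_gen_closed)
  obtain q where q: "q \<in> alg_hom Om ?F B" "q ?x = y"
    using free_alg_universal[OF I B, of "{()}" "\<lambda>_. y"] y by auto
  note ins = coprod_insertion(2)[OF I alg]
  have eq_on: "k (?inr b) = q b"
    if k: "k \<in> alg_hom Om ?U B" "k (?inr ?x) = y" and b: "b \<in> carrier ?F" for k b
  proof -
    have "(\<lambda>b\<in>carrier ?F. k (?inr b)) \<in> alg_hom Om ?F B"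
      unfolding alg_hom_def
    proof (intro CollectI conjI allI impI)
      show "(\<lambda>b\<in>carrier ?F. k (?inr b)) \<in> carrier ?F \<rightarrow> carrier B"
        using ins k(1) by (auto simp: alg_hom_def U)
      fix f as assume f: "f \<in> Om (length as)" and as: "set as \<subseteq> carrier ?F"
      have im: "set (map ?inr as) \<subseteq> carrier ?U" using ins as by (auto simp: alg_hom_def U)
      have "opr ?F f as \<in> carrier ?F" using alg(2) f as by (auto simp: is_algebra_def)
      moreover have "?inr (opr ?F f as) = opr ?U f (map ?inr as)"
        using ins f as by (auto simp: alg_hom_def U)
      moreover have "k (opr ?U f (map ?inr as)) = opr B f (map k (map ?inr as))"
        using k(1) f im by (simp add: alg_hom_def)
      moreover have "map k (map ?inr as) = map (\<lambda>b\<in>carrier ?F. k (?inr b)) as" using as by auto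
      ultimately show "(\<lambda>b\<in>carrier ?F. k (?inr b)) (opr ?F f as)
          = opr B f (map (\<lambda>b\<in>carrier ?F. k (?inr b)) as)" by (simp del: map_map map_eq_conv)
    qed
    moreover have "(\<lambda>b\<in>carrier ?F. q b) \<in> alg_hom Om ?F B"
      unfolding alg_hom_def
    proof (intro CollectI conjI allI impI)
      show "(\<lambda>b\<in>carrier ?F. q b) \<in> carrier ?F \<rightarrow> carrier B" using q(1) by (auto simp: alg_hom_def)
      fix f as assume f: "f \<in> Om (length as)" and as: "set as \<subseteq> carrier ?F"
      have "map q as = map (\<lambda>b\<in>carrier ?F. q b) as" using as by auto
      moreover have "opr ?F f as \<in> carrier ?F" using alg(2) f as by (auto simp: is_algebra_def)
      ultimately show "(\<lambda>b\<in>carrier ?F. q b) (opr ?F f as) = opr B f (map (\<lambda>b\<in>carrier ?F. q b) as)"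
        using q(1) f as by (simp add: alg_hom_def del: map_eq_conv)
    qed
    moreover have "f = g"
      if "f \<in> alg_hom Om ?F B" "g \<in> alg_hom Om ?F B" "f \<in> extensional (carrier ?F)"
        "g \<in> extensional (carrier ?F)" "f ?x = y" "g ?x = y" for f g
      using free_alg_universal[OF I B, of "{()}" "\<lambda>_. y"] y that by blast
    ultimately have "(\<lambda>b\<in>carrier ?F. k (?inr b)) = (\<lambda>b\<in>carrier ?F. q b)"
      using k(2) q(2) x by (simp add: restrict_extensional)
    from fun_cong[OF this, of b] show ?thesis using b by simp
  qed
  have "(\<forall>b\<in>carrier ?F. k (?inr b) = q b) \<longleftrightarrow> k (?inr ?x) = y" if "k \<in> alg_hom Om ?U B" for k
    using eq_on[OF that] x q(2) by auto
  then show ?thesis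
    using coprod_universal[OF I alg B g q(1)] by (simp add: U cong: conj_cong)
qed


text \<open>\<open>pol_at Om E A u b\<close> is \<open>u(b)\<close>, and \<open>pol_comp Om E A v u\<close> is the composite \<open>vu\<close>.\<close>

definition pol_at ::
  "(nat \<Rightarrow> 'f set) \<Rightarrow> (('f, nat) trm \<times> ('f, nat) trm) set \<Rightarrow> ('f, 'a) alg \<Rightarrow>
   ('f, 'a) pol \<Rightarrow> 'a \<Rightarrow> 'a" where
  "pol_at Om E A u b = pol_hom Om E A A (\<lambda>a. a) b u"

definition pol_comp ::
  "(nat \<Rightarrow> 'f set) \<Rightarrow> (('f, nat) trm \<times> ('f, nat) trm) set \<Rightarrow> ('f, 'a) alg \<Rightarrow>
   ('f, 'a) pol \<Rightarrow> ('f, 'a) pol \<Rightarrow> ('f, 'a) pol" where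
  "pol_comp Om E A v u = pol_hom Om E A (Pol1 Om E A) (pol_const Om E A) u v"

definition pol_over ::
  "(nat \<Rightarrow> 'f set) \<Rightarrow> (('f, nat) trm \<times> ('f, nat) trm) set \<Rightarrow> ('f, 'a) alg \<Rightarrow> 'a \<Rightarrow>
   ('f, 'a, ('f, 'a) pol) pover" where
  "pol_over Om E A b =
     \<lparr>pset = (\<lambda>a. {u \<in> carrier (Pol1 Om E A). pol_at Om E A u b = a}),
      pbase = pol_const Om E A,
      pop = (\<lambda>f as us. opr (Pol1 Om E A) f us)\<rparr>"

lemma pol_over_is_pover:
  assumes I: "is_identities Om E" and A: "in_variety Om E A" and b: "b \<in> carrier A"
  shows "is_pover Om A (pol_over Om E A b)"
proof -
  let ?U = "Pol1 Om E A" and ?\<pi> = "pol_hom Om E A A (\<lambda>a. a) b"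
  have "(\<lambda>a. a) \<in> alg_hom Om A A" by (simp add: alg_hom_def)
  from theI'[OF pol_hom_ex1[OF I A A this b]]
  have \<pi>: "?\<pi> \<in> alg_hom Om ?U A" "\<forall>a\<in>carrier A. ?\<pi> (pol_const Om E A a) = a"
    by (simp_all add: pol_hom_def)
  have alg: "is_algebra Om A" "is_algebra Om (free_alg Om E {()})"
    using A free_alg_in_variety[OF I] by (auto simp: in_variety_def)
  then have U: "is_algebra Om ?U"
    using coprod_in_variety[OF I alg] by (simp add: Pol1_def in_variety_def)
  have c: "pol_const Om E A \<in> alg_hom Om A ?U"
    using coprod_insertion(1)[OF I alg] by (simp add: Pol1_def pol_const_def)
  have "opr ?U f us \<in> carrier ?U \<and> ?\<pi> (opr ?U f us) = opr A f as"
    if "f \<in> Om (length as)" and "us \<in> listset (map (pset (pol_over Om E A b)) as)" for f as us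
  proof -
    have "list_all2 (\<lambda>u a. u \<in> carrier ?U \<and> ?\<pi> u = a) us as"
      using that(2) by (simp add: in_listset list_all2_map2 pol_over_def pol_at_def)
    then have "length us = length as" "set us \<subseteq> carrier ?U" "map ?\<pi> us = as"
      by (induction rule: list_all2_induct) auto
    then show ?thesis using U \<pi>(1) that(1) by (auto simp: is_algebra_def alg_hom_def)
  qed
  then show ?thesis using c \<pi>(2) by (auto simp: is_pover_def pol_over_def pol_at_def alg_hom_def)
qed

text \<open>The homomorphism \<open>\<psi>\<close> from \<open>U\<^bsub>b\<^esub>\<close> to \<open>P\<close> with \<open>x \<mapsto> p\<close>, and the element
  \<open>u\<^bsup>P\<^esup>\<^bsub>\<langle>b\<rangle>\<^esub>(p)\<close>.\<close>

definition pol_psi ::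
  "(nat \<Rightarrow> 'f set) \<Rightarrow> (('f, nat) trm \<times> ('f, nat) trm) set \<Rightarrow> ('f, 'a) alg \<Rightarrow>
   ('f, 'a, 'p) pover \<Rightarrow> 'a \<Rightarrow> 'p \<Rightarrow> 'a \<Rightarrow> ('f, 'a) pol \<Rightarrow> 'p" where
  "pol_psi Om E A P b p = (THE \<psi>.
     \<psi> \<in> pover_hom Om A (pol_over Om E A b) P \<and>
     \<psi> \<in> (\<Pi>\<^sub>E a\<in>carrier A. extensional (pset (pol_over Om E A b) a)) \<and>
     \<psi> b (pol_x Om E A) = p)"

definition pol_act ::
  "(nat \<Rightarrow> 'f set) \<Rightarrow> (('f, nat) trm \<times> ('f, nat) trm) set \<Rightarrow> ('f, 'a) alg \<Rightarrow>
   ('f, 'a, 'p) pover \<Rightarrow> 'a \<Rightarrow> ('f, 'a) pol \<Rightarrow> 'p \<Rightarrow> 'p" where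
  "pol_act Om E A P b u p = pol_psi Om E A P b p (pol_at Om E A u b) u"


section \<open>The family Z and its actions\<close>

type_synonym ('f, 'a) zel = "(('f, 'a) pol \<Rightarrow>\<^sub>0 int) set"

definition Zmod ::
  "(nat \<Rightarrow> 'f set) \<Rightarrow> (('f, nat) trm \<times> ('f, nat) trm) set \<Rightarrow> ('f, 'a) alg \<Rightarrow> 'a \<Rightarrow>
   ('f, 'a, ('f, 'a) zel) amod" where
  "Zmod Om E A b = modulize Om A (pol_over Om E A b)"

definition Z ::
  "(nat \<Rightarrow> 'f set) \<Rightarrow> (('f, nat) trm \<times> ('f, nat) trm) set \<Rightarrow> ('f, 'a) alg \<Rightarrow> 'a \<Rightarrow> 'a \<Rightarrow>
   ('f, 'a) zel monoid" where
  "Z Om E A a b = mgrp (Zmod Om E A b) a"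

text \<open>\<open>Zcls Om E A b u\<close> is \<open>(u)\<^bsub>b\<^esub>\<close>.\<close>

definition Zcls ::
  "(nat \<Rightarrow> 'f set) \<Rightarrow> (('f, nat) trm \<times> ('f, nat) trm) set \<Rightarrow> ('f, 'a) alg \<Rightarrow> 'a \<Rightarrow>
   ('f, 'a) pol \<Rightarrow> ('f, 'a) zel" where
  "Zcls Om E A b u = modulize_unit Om A (pol_over Om E A b) (pol_at Om E A u b) u"

definition Ztheta ::
  "(nat \<Rightarrow> 'f set) \<Rightarrow> (('f, nat) trm \<times> ('f, nat) trm) set \<Rightarrow> ('f, 'a) alg \<Rightarrow>
   ('f, 'a, 'm) amod \<Rightarrow> 'a \<Rightarrow> 'm \<Rightarrow> 'a \<Rightarrow> ('f, 'a) zel \<Rightarrow> 'm" where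
  "Ztheta Om E A M b m = (THE \<theta>.
     \<theta> \<in> module_hom Om A (Zmod Om E A b) M \<and>
     \<theta> \<in> (\<Pi>\<^sub>E a\<in>carrier A. extensional (carrier (Z Om E A a b))) \<and>
     \<theta> b (Zcls Om E A b (pol_x Om E A)) = m)"

text \<open>\<open>Zact Om E A M a b z m\<close> is \<open>zm\<close> for \<open>z\<close> in \<open>\<^sub>aZ\<^sub>b\<close> and \<open>m\<close> in \<open>\<^sub>bM\<close>;
  \<open>Zmult Om E A a b c z z'\<close> is \<open>zz'\<close> for \<open>z\<close> in \<open>\<^sub>aZ\<^sub>b\<close> and \<open>z'\<close> in \<open>\<^sub>bZ\<^sub>c\<close>. The indices
  are explicit because a set of polynomials does not determine them.\<close>

definition Zact ::
  "(nat \<Rightarrow> 'f set) \<Rightarrow> (('f, nat) trm \<times> ('f, nat) trm) set \<Rightarrow> ('f, 'a) alg \<Rightarrow>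
   ('f, 'a, 'm) amod \<Rightarrow> 'a \<Rightarrow> 'a \<Rightarrow> ('f, 'a) zel \<Rightarrow> 'm \<Rightarrow> 'm" where
  "Zact Om E A M a b z m = Ztheta Om E A M b m a z"

definition Zmult ::
  "(nat \<Rightarrow> 'f set) \<Rightarrow> (('f, nat) trm \<times> ('f, nat) trm) set \<Rightarrow> ('f, 'a) alg \<Rightarrow>
   'a \<Rightarrow> 'a \<Rightarrow> 'a \<Rightarrow> ('f, 'a) zel \<Rightarrow> ('f, 'a) zel \<Rightarrow> ('f, 'a) zel" where
  "Zmult Om E A a b c z z' = Zact Om E A (Zmod Om E A c) a b z z'"


section \<open>Ringoids and their modules\<close>

definition bilinear_map ::
  "'g monoid \<Rightarrow> 'h monoid \<Rightarrow> 'k monoid \<Rightarrow> ('g \<Rightarrow> 'h \<Rightarrow> 'k) \<Rightarrow> bool" where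
  "bilinear_map G H K \<beta> \<longleftrightarrow>
     (\<forall>h\<in>carrier H. (\<lambda>g. \<beta> g h) \<in> hom G K) \<and> (\<forall>g\<in>carrier G. \<beta> g \<in> hom H K)"

text \<open>\<open>rhom X a' a\<close> is the group of morphisms from \<open>a\<close> to \<open>a'\<close>, and \<open>rcomp X a'' a' a\<close> the
  composition of \<open>rhom X a'' a'\<close> with \<open>rhom X a' a\<close>.\<close>

record ('o, 'x) ringoid_data =
  robj :: "'o set"
  rhom :: "'o \<Rightarrow> 'o \<Rightarrow> 'x monoid"
  rcomp :: "'o \<Rightarrow> 'o \<Rightarrow> 'o \<Rightarrow> 'x \<Rightarrow> 'x \<Rightarrow> 'x"
  rid :: "'o \<Rightarrow> 'x"

definition is_ringoid :: "('o, 'x) ringoid_data \<Rightarrow> bool" where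
  "is_ringoid X \<longleftrightarrow>
     (\<forall>a\<in>robj X. \<forall>b\<in>robj X. comm_group (rhom X a b)) \<and>
     (\<forall>a\<in>robj X. \<forall>b\<in>robj X. \<forall>c\<in>robj X.
        bilinear_map (rhom X a b) (rhom X b c) (rhom X a c) (rcomp X a b c)) \<and>
     (\<forall>a\<in>robj X. rid X a \<in> carrier (rhom X a a)) \<and>
     (\<forall>a\<in>robj X. \<forall>b\<in>robj X. \<forall>r\<in>carrier (rhom X a b).
        rcomp X a b b r (rid X b) = r \<and> rcomp X a a b (rid X a) r = r) \<and>
     (\<forall>a\<in>robj X. \<forall>b\<in>robj X. \<forall>c\<in>robj X. \<forall>d\<in>robj X.
        \<forall>r\<in>carrier (rhom X a b). \<forall>s\<in>carrier (rhom X b c). \<forall>t\<in>carrier (rhom X c d).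
          rcomp X a c d (rcomp X a b c r s) t = rcomp X a b d r (rcomp X b c d s t))"

definition is_left_module ::
  "('o, 'x) ringoid_data \<Rightarrow> ('o \<Rightarrow> 'm monoid) \<Rightarrow> ('o \<Rightarrow> 'o \<Rightarrow> 'x \<Rightarrow> 'm \<Rightarrow> 'm) \<Rightarrow> bool" where
  "is_left_module X G act \<longleftrightarrow>
     (\<forall>a\<in>robj X. comm_group (G a)) \<and>
     (\<forall>a\<in>robj X. \<forall>b\<in>robj X. bilinear_map (rhom X a b) (G b) (G a) (act a b)) \<and>
     (\<forall>a\<in>robj X. \<forall>m\<in>carrier (G a). act a a (rid X a) m = m) \<and>
     (\<forall>a\<in>robj X. \<forall>b\<in>robj X. \<forall>c\<in>robj X.
        \<forall>r\<in>carrier (rhom X a b). \<forall>s\<in>carrier (rhom X b c). \<forall>m\<in>carrier (G c).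
          act a c (rcomp X a b c r s) m = act a b r (act b c s m))"

definition Zringoid ::
  "(nat \<Rightarrow> 'f set) \<Rightarrow> (('f, nat) trm \<times> ('f, nat) trm) set \<Rightarrow> ('f, 'a) alg \<Rightarrow>
   ('a, ('f, 'a) zel) ringoid_data" where
  "Zringoid Om E A =
     \<lparr>robj = carrier A, rhom = Z Om E A, rcomp = Zmult Om E A,
      rid = (\<lambda>b. Zcls Om E A b (pol_x Om E A))\<rparr>"

end

theory Submission
  imports Defs
begin

text \<open>The module \<open>\<M>U\<^sub>b\<close> is free on \<open>(x)\<^sub>b\<close> among the modules totally in the variety, and the action
  of \<open>Z\<close> on \<open>m\<close> evaluates the unique homomorphism that sends \<open>(x)\<^sub>b\<close> to \<open>m\<close>. So every claim compares
  two homomorphisms on the generator. Additivity in \<open>m\<close> holds because a pointwise sum of module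
  homomorphisms is one. Associativity is naturality (11) for the homomorphism \<open>\<theta>\<^bsub>c,m\<^esub>\<close>.
  Everything about multiplication in \<open>Z\<close> is the corresponding fact for the module
  \<open>\<M>U\<^sub>c\<close>, which is why this module must itself be shown to be totally in the variety.\<close>

section \<open>Homomorphisms on finite products\<close>

text \<open>The obstacle is to carry an identity of the variety from \<open>total_alg A P\<close> to
  the total algebra of the modulization, whose fibres contain sums that do not come from
  \<open>P\<close>. A module operation is additive in its whole argument tuple at once, so over a
  fixed assignment of base elements both sides of an identity are additive in the tuple of fibre
  components. Such a map is determined by the tuples with one generator and zeros elsewhere, and
  these are images of tuples over \<open>P\<close> with basepoints elsewhere.
  \<open>additive_agree\<close> isolates this principle, which also shows that the free extension of
  an overalgebra homomorphism respects the operations of \<open>hat_mod\<close>. Freeness of the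
  overalgebra of polynomials rests on a translation: a homomorphism from it to \<open>P\<close>
  amounts to an algebra homomorphism from \<open>Pol1\<close> to \<open>total_alg A P\<close> whose
  first component is evaluation at \<open>b\<close>. The universal properties are proved for an
  arbitrary element type, so that they apply to \<open>M\<close> and to \<open>Zmod Om E A c\<close>
  alike.\<close>

lemma in_listset_map:
  "xs \<in> listset (map S as) \<longleftrightarrow> length xs = length as \<and> (\<forall>i<length as. xs ! i \<in> S (as ! i))"
  by (auto simp: in_listset list_all2_conv_all_nth)

lemma carrier_DirProd_list: "carrier (DirProd_list Gs) = listset (map carrier Gs)"
  by (auto simp: in_listset_map intro: DirProd_list_carrier_memI dest: DirProd_list_carrier_mem)

text \<open>Consing is a homomorphism from \<open>G \<times>\<times> DirProd_list Gs\<close> by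
  \<open>DirProd_list_iso\<close>; peeling off one factor at a time through it gives the
  componentwise formula.\<close>

lemma mult_DirProd_list:
  assumes "xs \<in> carrier (DirProd_list Gs)" "ys \<in> carrier (DirProd_list Gs)"
  shows "xs \<otimes>\<^bsub>DirProd_list Gs\<^esub> ys = map (\<lambda>i. xs ! i \<otimes>\<^bsub>Gs ! i\<^esub> ys ! i) [0..<length Gs]"
  using assms
proof (induction Gs arbitrary: xs ys)
  case Nil
  then show ?case by (simp add: DirProd_list_def)
next
  case (Cons G Gs)
  let ?D = "DirProd_list Gs"
  obtain x xs' where x: "xs = x # xs'" "x \<in> carrier G" "xs' \<in> carrier ?D"
    using Cons.prems(1) unfolding DirProd_list_carrier by auto
  obtain y ys' where y: "ys = y # ys'" "y \<in> carrier G" "ys' \<in> carrier ?D"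
    using Cons.prems(2) unfolding DirProd_list_carrier by auto
  have "(\<lambda>(g, gs). g # gs) \<in> hom (G \<times>\<times> ?D) (DirProd_list (G # Gs))"
    using DirProd_list_iso by (auto simp: iso_def)
  from hom_mult[OF this, of "(x, xs')" "(y, ys')"]
  have "xs \<otimes>\<^bsub>DirProd_list (G # Gs)\<^esub> ys = (x \<otimes>\<^bsub>G\<^esub> y) # (xs' \<otimes>\<^bsub>?D\<^esub> ys')"
    using x y by simp
  also have "\<dots> = map (\<lambda>i. xs ! i \<otimes>\<^bsub>(G # Gs) ! i\<^esub> ys ! i) (0 # map Suc [0..<length Gs])"
    using Cons.IH[OF x(3) y(3)] x(1) y(1) by simp
  finally show ?case by (simp only: upt_conv_Cons map_Suc_upt length_Cons zero_less_Suc)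
qed

text \<open>Replaces the product group by conditions on plain lists. Through
  \<open>is_module_iff\<close>, all later arguments about modules work with entries of lists
  only.\<close>

lemma hom_DirProd_list_iff:
  "h \<in> hom (DirProd_list (map G as)) H \<longleftrightarrow>
     (\<forall>xs\<in>listset (map (\<lambda>a. carrier (G a)) as). h xs \<in> carrier H) \<and>
     (\<forall>xs\<in>listset (map (\<lambda>a. carrier (G a)) as). \<forall>ys\<in>listset (map (\<lambda>a. carrier (G a)) as).
        h (map (\<lambda>i. xs ! i \<otimes>\<^bsub>G (as ! i)\<^esub> ys ! i) [0..<length as]) = h xs \<otimes>\<^bsub>H\<^esub> h ys)"
proof -
  have c: "carrier (DirProd_list (map G as)) = listset (map (\<lambda>a. carrier (G a)) as)"
    by (simp add: carrier_DirProd_list comp_def)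
  have "xs \<otimes>\<^bsub>DirProd_list (map G as)\<^esub> ys
      = map (\<lambda>i. xs ! i \<otimes>\<^bsub>G (as ! i)\<^esub> ys ! i) [0..<length as]"
    if "xs \<in> listset (map (\<lambda>a. carrier (G a)) as)" "ys \<in> listset (map (\<lambda>a. carrier (G a)) as)"
    for xs ys
    using that by (simp add: mult_DirProd_list c)
  then show ?thesis by (auto simp: hom_def c Pi_iff)
qed

lemma hom_agree_generate:
  assumes "group G" "group H" "h \<in> hom G H" "k \<in> hom G H" "S \<subseteq> carrier G"
    and "\<And>s. s \<in> S \<Longrightarrow> h s = k s" "x \<in> generate G S"
  shows "h x = k x"
proof -
  interpret h: group_hom G H h using assms by (simp add: group_hom_def group_hom_axioms_def)
  interpret k: group_hom G H k using assms by (simp add: group_hom_def group_hom_axioms_def)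
  have "x \<in> carrier G \<and> h x = k x" using assms(7)
    by induction (use assms(5,6) in auto)
  then show ?thesis by simp
qed

text \<open>A tuple supported on the finite set \<open>J\<close> is a product of tuples with a
  single nontrivial entry. In that entry each of \<open>F\<close> and \<open>K\<close> restricts to
  a homomorphism from \<open>G j\<close>, so agreement on the generators \<open>S j\<close> is
  enough. The index type may be infinite, which is why the support of \<open>x\<close> has to be
  bounded.\<close>

lemma additive_agree:
  fixes G :: "'i \<Rightarrow> 'g monoid" and F K :: "('i \<Rightarrow> 'g) \<Rightarrow> 'h"
  defines "one_fun \<equiv> \<lambda>i. \<one>\<^bsub>G i\<^esub>"
  assumes G: "\<And>i. group (G i)" and H: "group H"
    and Fc: "\<And>x. (\<And>i. x i \<in> carrier (G i)) \<Longrightarrow> F x \<in> carrier H"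
    and Kc: "\<And>x. (\<And>i. x i \<in> carrier (G i)) \<Longrightarrow> K x \<in> carrier H"
    and F: "\<And>x y. (\<And>i. x i \<in> carrier (G i)) \<Longrightarrow> (\<And>i. y i \<in> carrier (G i)) \<Longrightarrow>
      F (\<lambda>i. x i \<otimes>\<^bsub>G i\<^esub> y i) = F x \<otimes>\<^bsub>H\<^esub> F y"
    and K: "\<And>x y. (\<And>i. x i \<in> carrier (G i)) \<Longrightarrow> (\<And>i. y i \<in> carrier (G i)) \<Longrightarrow>
      K (\<lambda>i. x i \<otimes>\<^bsub>G i\<^esub> y i) = K x \<otimes>\<^bsub>H\<^esub> K y"
    and S: "\<And>i. S i \<subseteq> carrier (G i)" "\<And>i. carrier (G i) \<subseteq> generate (G i) (S i)"
    and agree: "\<And>i s. s \<in> S i \<Longrightarrow> F (one_fun(i := s)) = K (one_fun(i := s))"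
    and "finite J" "\<And>i. x i \<in> carrier (G i)" "\<And>i. i \<notin> J \<Longrightarrow> x i = \<one>\<^bsub>G i\<^esub>"
  shows "F x = K x"
  using assms(11-13)
proof (induction J arbitrary: x rule: finite_induct)
  interpret G: group "G i" for i by (rule G)
  interpret H: group H by (rule H)
  have u: "one_fun i \<in> carrier (G i)" for i by (simp add: one_fun_def)
  {
    case empty
    then have x: "x = one_fun" by (auto simp: one_fun_def)
    \<comment> \<open>The trivial tuple is its own square, so both values are idempotents of the
      group \<open>H\<close>.\<close>
    have "F one_fun \<otimes>\<^bsub>H\<^esub> F one_fun = F one_fun" "K one_fun \<otimes>\<^bsub>H\<^esub> K one_fun = K one_fun"
      using F[OF u u, symmetric] K[OF u u, symmetric] by (simp_all add: one_fun_def)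
    then have "F one_fun = \<one>\<^bsub>H\<^esub>" "K one_fun = \<one>\<^bsub>H\<^esub>"
      using Fc[OF u] Kc[OF u] by simp_all
    then show ?case by (simp add: x)
  next
    case (insert j J)
    have 1: "(x(j := \<one>\<^bsub>G j\<^esub>)) i \<in> carrier (G i)" for i using insert.prems by simp
    have 2: "(one_fun(j := s)) i \<in> carrier (G i)" if "s \<in> carrier (G j)" for s i
      using that by (simp add: one_fun_def)
    have hom: "(\<lambda>s. L (one_fun(j := s))) \<in> hom (G j) H"
      if c: "\<And>x. (\<And>i. x i \<in> carrier (G i)) \<Longrightarrow> L x \<in> carrier H"
        and L: "\<And>x y. (\<And>i. x i \<in> carrier (G i)) \<Longrightarrow> (\<And>i. y i \<in> carrier (G i)) \<Longrightarrow>
      L (\<lambda>i. x i \<otimes>\<^bsub>G i\<^esub> y i) = L x \<otimes>\<^bsub>H\<^esub> L y" for L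
    proof (rule homI)
      fix s t assume s: "s \<in> carrier (G j)" and t: "t \<in> carrier (G j)"
      have "one_fun(j := s \<otimes>\<^bsub>G j\<^esub> t) = (\<lambda>i. (one_fun(j := s)) i \<otimes>\<^bsub>G i\<^esub> (one_fun(j := t)) i)"
        by (auto simp: one_fun_def)
      then show "L (one_fun(j := s \<otimes>\<^bsub>G j\<^esub> t)) = L (one_fun(j := s)) \<otimes>\<^bsub>H\<^esub> L (one_fun(j := t))"
        using L[OF 2[OF s] 2[OF t]] by (simp only:)
    qed (rule c[OF 2])
    have xj: "x j \<in> carrier (G j)" using insert.prems by simp
    have "F (one_fun(j := x j)) = K (one_fun(j := x j))"
    proof (rule hom_agree_generate[OF G H hom[of F] hom[of K] S(1)])
      show "x j \<in> generate (G j) (S j)" using xj S(2) by blast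
    qed (use Fc Kc F K agree in simp_all)
    moreover have "F (x(j := \<one>\<^bsub>G j\<^esub>)) = K (x(j := \<one>\<^bsub>G j\<^esub>))"
      by (rule insert.IH) (use insert.prems in auto)
    \<comment> \<open>Erasing the entry at \<open>j\<close> leaves a tuple supported on
      \<open>J\<close>, covered by the induction hypothesis; the other factor has its only
      nontrivial entry at \<open>j\<close>.\<close>
    moreover have x: "x = (\<lambda>i. (x(j := \<one>\<^bsub>G j\<^esub>)) i \<otimes>\<^bsub>G i\<^esub> (one_fun(j := x j)) i)"
      using insert.prems(1) by (auto simp: one_fun_def)
    moreover have "F x = F (x(j := \<one>\<^bsub>G j\<^esub>)) \<otimes>\<^bsub>H\<^esub> F (one_fun(j := x j))"
      by (subst x) (rule F[OF 1 2[OF xj]])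
    moreover have "K x = K (x(j := \<one>\<^bsub>G j\<^esub>)) \<otimes>\<^bsub>H\<^esub> K (one_fun(j := x j))"
      by (subst x) (rule K[OF 1 2[OF xj]])
    ultimately show ?case by simp
  }
qed

section \<open>Module operations on lists of elements\<close>

lemma is_module_iff:
  "is_module Om A M \<longleftrightarrow>
     (\<forall>a\<in>carrier A. comm_group (mgrp M a)) \<and>
     (\<forall>f as. f \<in> Om (length as) \<longrightarrow> set as \<subseteq> carrier A \<longrightarrow>
       (\<forall>ms\<in>listset (map (\<lambda>a. carrier (mgrp M a)) as).
          mop M f as ms \<in> carrier (mgrp M (opr A f as))) \<and>
       (\<forall>ms\<in>listset (map (\<lambda>a. carrier (mgrp M a)) as).
        \<forall>ns\<in>listset (map (\<lambda>a. carrier (mgrp M a)) as).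
          mop M f as (map (\<lambda>i. ms ! i \<otimes>\<^bsub>mgrp M (as ! i)\<^esub> ns ! i) [0..<length as])
            = mop M f as ms \<otimes>\<^bsub>mgrp M (opr A f as)\<^esub> mop M f as ns))"
  unfolding is_module_def hom_DirProd_list_iff by blast

lemma is_module_group:
  assumes "is_module Om A M" "a \<in> carrier A"
  shows "comm_group (mgrp M a)" "group (mgrp M a)"
  using assms by (auto simp: is_module_def comm_group_def)

lemma mop_closed:
  assumes "is_module Om A M" "f \<in> Om (length as)" "set as \<subseteq> carrier A" "length ms = length as"
    and "\<And>i. i < length as \<Longrightarrow> ms ! i \<in> carrier (mgrp M (as ! i))"
  shows "mop M f as ms \<in> carrier (mgrp M (opr A f as))"
  using assms by (auto simp: is_module_iff in_listset_map)

lemma mop_mult: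
  assumes "is_module Om A M" "f \<in> Om (length as)" "set as \<subseteq> carrier A"
    and "length ms = length as" "length ns = length as"
    and "\<And>i. i < length as \<Longrightarrow> ms ! i \<in> carrier (mgrp M (as ! i))"
    and "\<And>i. i < length as \<Longrightarrow> ns ! i \<in> carrier (mgrp M (as ! i))"
  shows "mop M f as (map (\<lambda>i. ms ! i \<otimes>\<^bsub>mgrp M (as ! i)\<^esub> ns ! i) [0..<length as])
            = mop M f as ms \<otimes>\<^bsub>mgrp M (opr A f as)\<^esub> mop M f as ns"
  using assms by (auto simp: is_module_iff in_listset_map)

text \<open>The tuple of zeros is its own double, so its image is an idempotent of a group.\<close>

lemma mop_one:
  assumes "is_module Om A M" "is_algebra Om A" "f \<in> Om (length as)" "set as \<subseteq> carrier A"
  shows "mop M f as (map (\<lambda>a. \<one>\<^bsub>mgrp M a\<^esub>) as) = \<one>\<^bsub>mgrp M (opr A f as)\<^esub>"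
proof -
  let ?u = "map (\<lambda>a. \<one>\<^bsub>mgrp M a\<^esub>) as" and ?H = "mgrp M (opr A f as)"
  have a: "as ! i \<in> carrier A" if "i < length as" for i using that assms(4) by auto
  have g: "group (mgrp M (as ! i))" if "i < length as" for i
    using that is_module_group(2)[OF assms(1) a] by simp
  have "opr A f as \<in> carrier A" using assms by (auto simp: is_algebra_def)
  then interpret H: group ?H using is_module_group(2)[OF assms(1)] by blast
  have u: "?u ! i \<in> carrier (mgrp M (as ! i))" if "i < length as" for i
    using that group.is_monoid[OF g] by simp
  have "map (\<lambda>i. ?u ! i \<otimes>\<^bsub>mgrp M (as ! i)\<^esub> ?u ! i) [0..<length as] = ?u"
    by (rule nth_equalityI) (simp_all add: group.is_monoid[OF g])
  with mop_mult[OF assms(1,3,4), of ?u ?u] u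
  have e: "mop M f as ?u = mop M f as ?u \<otimes>\<^bsub>?H\<^esub> mop M f as ?u" by simp
  have "mop M f as ?u \<in> carrier ?H" by (rule mop_closed[OF assms(1,3,4)]) (use u in auto)
  with e show ?thesis using H.r_cancel_one' by metis
qed

lemma forget_pover:
  assumes "is_module Om A M" "is_algebra Om A"
  shows "is_pover Om A (forget M)"
  using assms is_module_group(2)[OF assms(1), THEN group.is_monoid] mop_one[OF assms]
  by (auto simp: is_pover_def forget_def is_module_iff)

section \<open>Homomorphisms and quotients of modules\<close>

lemma module_homI:
  assumes "\<And>a. a \<in> carrier A \<Longrightarrow> \<phi> a \<in> hom (mgrp M a) (mgrp M' a)"
    and "\<And>f as ms. f \<in> Om (length as) \<Longrightarrow> set as \<subseteq> carrier A \<Longrightarrow> length ms = length as \<Longrightarrow>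
      (\<And>i. i < length as \<Longrightarrow> ms ! i \<in> carrier (mgrp M (as ! i))) \<Longrightarrow>
      \<phi> (opr A f as) (mop M f as ms) = mop M' f as (map2 \<phi> as ms)"
  shows "\<phi> \<in> module_hom Om A M M'"
  using assms by (auto simp: module_hom_def in_listset_map)

lemma module_hom_mop:
  assumes "\<phi> \<in> module_hom Om A M M'" "f \<in> Om (length as)" "set as \<subseteq> carrier A"
    and "length ms = length as" "\<And>i. i < length as \<Longrightarrow> ms ! i \<in> carrier (mgrp M (as ! i))"
  shows "\<phi> (opr A f as) (mop M f as ms) = mop M' f as (map2 \<phi> as ms)"
  using assms by (auto simp: module_hom_def in_listset_map)

lemma module_hom_hom:
  "\<phi> \<in> module_hom Om A M M' \<Longrightarrow> a \<in> carrier A \<Longrightarrow> \<phi> a \<in> hom (mgrp M a) (mgrp M' a)"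
  by (simp add: module_hom_def)

lemma module_hom_group_hom:
  assumes "is_module Om A M" "is_module Om A M'" "\<phi> \<in> module_hom Om A M M'" "a \<in> carrier A"
  shows "group_hom (mgrp M a) (mgrp M' a) (\<phi> a)"
  using is_module_group(2)[OF assms(1,4)] is_module_group(2)[OF assms(2,4)] module_hom_hom[OF assms(3,4)]
  by (simp add: group_hom_def group_hom_axioms_def)

lemma pover_homI:
  assumes "\<And>a p. a \<in> carrier A \<Longrightarrow> p \<in> pset P a \<Longrightarrow> \<phi> a p \<in> pset Q a"
    and "\<And>a. a \<in> carrier A \<Longrightarrow> \<phi> a (pbase P a) = pbase Q a"
    and "\<And>f as ps. f \<in> Om (length as) \<Longrightarrow> set as \<subseteq> carrier A \<Longrightarrow> length ps = length as \<Longrightarrow>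
      (\<And>i. i < length as \<Longrightarrow> ps ! i \<in> pset P (as ! i)) \<Longrightarrow>
      \<phi> (opr A f as) (pop P f as ps) = pop Q f as (map2 \<phi> as ps)"
  shows "\<phi> \<in> pover_hom Om A P Q"
  using assms by (auto simp: pover_hom_def in_listset_map)

lemma pover_hom_pop:
  assumes "\<phi> \<in> pover_hom Om A P Q" "f \<in> Om (length as)" "set as \<subseteq> carrier A"
    and "length ps = length as" "\<And>i. i < length as \<Longrightarrow> ps ! i \<in> pset P (as ! i)"
  shows "\<phi> (opr A f as) (pop P f as ps) = pop Q f as (map2 \<phi> as ps)"
  using assms by (auto simp: pover_hom_def in_listset_map)

lemma pover_hom_closed:
  assumes "\<phi> \<in> pover_hom Om A P Q" "a \<in> carrier A"
  shows "p \<in> pset P a \<Longrightarrow> \<phi> a p \<in> pset Q a" "\<phi> a (pbase P a) = pbase Q a"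
  using assms by (auto simp: pover_hom_def)

lemma pop_closed:
  assumes "is_pover Om A P" "f \<in> Om (length as)" "set as \<subseteq> carrier A"
    and "length ps = length as" "\<And>i. i < length as \<Longrightarrow> ps ! i \<in> pset P (as ! i)"
  shows "pop P f as ps \<in> pset P (opr A f as)"
  using assms by (auto simp: is_pover_def in_listset_map Pi_iff)

lemma is_pover_base:
  "is_pover Om A P \<Longrightarrow> a \<in> carrier A \<Longrightarrow> pbase P a \<in> pset P a"
  by (simp add: is_pover_def)

lemma is_algebra_opr:
  "is_algebra Om A \<Longrightarrow> f \<in> Om (length as) \<Longrightarrow> set as \<subseteq> carrier A \<Longrightarrow> opr A f as \<in> carrier A"
  by (simp add: is_algebra_def)

lemma module_hom_forget:
  assumes M: "is_module Om A M" and M': "is_module Om A M'" and \<phi>: "\<phi> \<in> module_hom Om A M M'"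
  shows "\<phi> \<in> pover_hom Om A (forget M) (forget M')"
proof (rule pover_homI)
  fix a assume a: "a \<in> carrier A"
  interpret group_hom "mgrp M a" "mgrp M' a" "\<phi> a"
    by (rule module_hom_group_hom[OF M M' \<phi> a])
  show "\<phi> a (pbase (forget M) a) = pbase (forget M') a" by (simp add: forget_def)
  show "p \<in> pset (forget M) a \<Longrightarrow> \<phi> a p \<in> pset (forget M') a" for p by (simp add: forget_def)
qed (use module_hom_mop[OF \<phi>] in \<open>simp add: forget_def\<close>)

lemma pover_hom_comp:
  assumes \<phi>: "\<phi> \<in> pover_hom Om A P Q" and \<psi>: "\<psi> \<in> pover_hom Om A Q R"
  shows "(\<lambda>a p. \<psi> a (\<phi> a p)) \<in> pover_hom Om A P R"
proof (rule pover_homI)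
  fix f as ps
  assume f: "f \<in> Om (length as)" and as: "set as \<subseteq> carrier A" and l: "length ps = length as"
    and ps: "\<And>i. i < length as \<Longrightarrow> ps ! i \<in> pset P (as ! i)"
  have "map2 \<phi> as ps ! i \<in> pset Q (as ! i)" if "i < length as" for i
    using that ps[OF that] pover_hom_closed(1)[OF \<phi> subsetD[OF as nth_mem]] l by auto
  then have "\<psi> (opr A f as) (\<phi> (opr A f as) (pop P f as ps)) = pop R f as (map2 \<psi> as (map2 \<phi> as ps))"
    using pover_hom_pop[OF \<phi> f as l ps] pover_hom_pop[OF \<psi> f as, of "map2 \<phi> as ps"] l by simp
  also have "map2 \<psi> as (map2 \<phi> as ps) = map2 (\<lambda>a p. \<psi> a (\<phi> a p)) as ps"
    using l by (intro nth_equalityI) auto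
  finally show "\<psi> (opr A f as) (\<phi> (opr A f as) (pop P f as ps))
    = pop R f as (map2 (\<lambda>a p. \<psi> a (\<phi> a p)) as ps)" .
qed (use pover_hom_closed[OF \<phi>] pover_hom_closed[OF \<psi>] in auto)

lemma module_hom_comp:
  assumes \<phi>: "\<phi> \<in> module_hom Om A M M'" and \<psi>: "\<psi> \<in> module_hom Om A M' M''"
  shows "(\<lambda>a m. \<psi> a (\<phi> a m)) \<in> module_hom Om A M M''"
proof (rule module_homI)
  show "(\<lambda>m. \<psi> a (\<phi> a m)) \<in> hom (mgrp M a) (mgrp M'' a)" if "a \<in> carrier A" for a
    using module_hom_hom[OF \<phi> that] module_hom_hom[OF \<psi> that] by (auto simp: hom_def Pi_iff)
  fix f as ms
  assume f: "f \<in> Om (length as)" and as: "set as \<subseteq> carrier A" and l: "length ms = length as"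
    and ms: "\<And>i. i < length as \<Longrightarrow> ms ! i \<in> carrier (mgrp M (as ! i))"
  have "map2 \<phi> as ms ! i \<in> carrier (mgrp M' (as ! i))" if "i < length as" for i
    using that hom_in_carrier[OF module_hom_hom[OF \<phi> subsetD[OF as nth_mem]] ms] l by auto
  then have "\<psi> (opr A f as) (\<phi> (opr A f as) (mop M f as ms)) = mop M'' f as (map2 \<psi> as (map2 \<phi> as ms))"
    using module_hom_mop[OF \<phi> f as l ms] module_hom_mop[OF \<psi> f as, of "map2 \<phi> as ms"] l by simp
  also have "map2 \<psi> as (map2 \<phi> as ms) = map2 (\<lambda>a p. \<psi> a (\<phi> a p)) as ms"
    using l by (intro nth_equalityI) auto
  finally show "\<psi> (opr A f as) (\<phi> (opr A f as) (mop M f as ms))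
    = mop M'' f as (map2 (\<lambda>a p. \<psi> a (\<phi> a p)) as ms)" .
qed

text \<open>The definite description of \<open>pol_psi\<close> asks for an extensional family.
  Forgetting the values outside the fibres keeps a homomorphism one, because arguments and results
  of the operations stay inside them. \<open>module_hom_restrict\<close> does the same for
  \<open>Ztheta\<close>.\<close>

lemma pover_hom_restrict:
  assumes A: "is_algebra Om A" and P: "is_pover Om A P" and \<phi>: "\<phi> \<in> pover_hom Om A P Q"
  shows "(\<lambda>a\<in>carrier A. \<lambda>p\<in>pset P a. \<phi> a p) \<in> pover_hom Om A P Q"
proof (rule pover_homI)
  fix f as ps
  assume f: "f \<in> Om (length as)" and as: "set as \<subseteq> carrier A" and l: "length ps = length as"
    and ps: "\<And>i. i < length as \<Longrightarrow> ps ! i \<in> pset P (as ! i)"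
  have eq: "map2 (\<lambda>a\<in>carrier A. \<lambda>p\<in>pset P a. \<phi> a p) as ps = map2 \<phi> as ps"
    using l ps subsetD[OF as nth_mem] by (intro nth_equalityI) auto
  show "(\<lambda>a\<in>carrier A. \<lambda>p\<in>pset P a. \<phi> a p) (opr A f as) (pop P f as ps) =
      pop Q f as (map2 (\<lambda>a\<in>carrier A. \<lambda>p\<in>pset P a. \<phi> a p) as ps)"
    unfolding eq using pover_hom_pop[OF \<phi> f as l ps] pop_closed[OF P f as l ps] is_algebra_opr[OF A f as] by simp
qed (use pover_hom_closed[OF \<phi>] is_pover_base[OF P] in auto)

lemma module_hom_restrict:
  assumes A: "is_algebra Om A" and M: "is_module Om A M" and \<phi>: "\<phi> \<in> module_hom Om A M M'"
  shows "(\<lambda>a\<in>carrier A. \<lambda>m\<in>carrier (mgrp M a). \<phi> a m) \<in> module_hom Om A M M'"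
proof (rule module_homI)
  fix f as ms
  assume f: "f \<in> Om (length as)" and as: "set as \<subseteq> carrier A" and l: "length ms = length as"
    and ms: "\<And>i. i < length as \<Longrightarrow> ms ! i \<in> carrier (mgrp M (as ! i))"
  have eq: "map2 (\<lambda>a\<in>carrier A. \<lambda>m\<in>carrier (mgrp M a). \<phi> a m) as ms = map2 \<phi> as ms"
    using l ms subsetD[OF as nth_mem] by (intro nth_equalityI) auto
  show "(\<lambda>a\<in>carrier A. \<lambda>m\<in>carrier (mgrp M a). \<phi> a m) (opr A f as) (mop M f as ms) =
      mop M' f as (map2 (\<lambda>a\<in>carrier A. \<lambda>m\<in>carrier (mgrp M a). \<phi> a m) as ms)"
    unfolding eq using module_hom_mop[OF \<phi> f as l ms] mop_closed[OF M f as l ms] is_algebra_opr[OF A f as] by simp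
next
  fix a assume a: "a \<in> carrier A"
  then show "(\<lambda>a\<in>carrier A. \<lambda>m\<in>carrier (mgrp M a). \<phi> a m) a \<in> hom (mgrp M a) (mgrp M' a)"
    using module_hom_hom[OF \<phi> a] is_module_group(2)[OF M a]
    by (auto simp: hom_def group.is_monoid monoid.m_closed)
qed

text \<open>Commutativity of \<open>mgrp M' a\<close> makes each component additive. Compatibility
  with the operations is \<open>mop_mult\<close> in \<open>M'\<close>: an operation applied to an
  entrywise sum of two tuples is the sum of its values.\<close>

lemma module_hom_mult:
  assumes M': "is_module Om A M'" and A: "is_algebra Om A"
    and \<phi>: "\<phi> \<in> module_hom Om A M M'" and \<psi>: "\<psi> \<in> module_hom Om A M M'"
  shows "(\<lambda>a m. \<phi> a m \<otimes>\<^bsub>mgrp M' a\<^esub> \<psi> a m) \<in> module_hom Om A M M'"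
proof (rule module_homI)
  show "(\<lambda>m. \<phi> a m \<otimes>\<^bsub>mgrp M' a\<^esub> \<psi> a m) \<in> hom (mgrp M a) (mgrp M' a)" if "a \<in> carrier A" for a
  proof -
    interpret comm_group "mgrp M' a" by (rule is_module_group(1)[OF M' that])
    show ?thesis
      using module_hom_hom[OF \<phi> that] module_hom_hom[OF \<psi> that]
      by (intro homI) (simp_all add: hom_in_carrier hom_mult m_ac)
  qed
  fix f as ms
  assume f: "f \<in> Om (length as)" and as: "set as \<subseteq> carrier A" and l: "length ms = length as"
    and ms: "\<And>i. i < length as \<Longrightarrow> ms ! i \<in> carrier (mgrp M (as ! i))"
  have c: "map2 \<theta> as ms ! i \<in> carrier (mgrp M' (as ! i))"
    if "i < length as" "\<theta> \<in> module_hom Om A M M'" for i \<theta>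
    using that(1) hom_in_carrier[OF module_hom_hom[OF that(2) subsetD[OF as nth_mem]] ms] l by auto
  have "map2 (\<lambda>a m. \<phi> a m \<otimes>\<^bsub>mgrp M' a\<^esub> \<psi> a m) as ms =
      map (\<lambda>i. map2 \<phi> as ms ! i \<otimes>\<^bsub>mgrp M' (as ! i)\<^esub> map2 \<psi> as ms ! i) [0..<length as]"
    using l by (intro nth_equalityI) auto
  then show "\<phi> (opr A f as) (mop M f as ms) \<otimes>\<^bsub>mgrp M' (opr A f as)\<^esub> \<psi> (opr A f as) (mop M f as ms)
      = mop M' f as (map2 (\<lambda>a m. \<phi> a m \<otimes>\<^bsub>mgrp M' a\<^esub> \<psi> a m) as ms)"
    using mop_mult[OF M' f as, of "map2 \<phi> as ms" "map2 \<psi> as ms"] l c[OF _ \<phi>] c[OF _ \<psi>]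
      module_hom_mop[OF \<phi> f as l ms] module_hom_mop[OF \<psi> f as l ms] by simp
qed

section \<open>Quotients of a module by a submodule\<close>

text \<open>Well-definedness of the quotient operation. Another tuple of representatives differs
  from \<open>ms\<close> by a tuple \<open>?ks\<close> with entries in \<open>N\<close>; by
  additivity the values differ by \<open>mop M f as ?ks\<close>, which the submodule
  \<open>N\<close> contains. The union in \<open>quot_mod\<close> thus runs over copies of one
  coset, and it is not empty since \<open>ms\<close> itself is a choice.\<close>

lemma coset_mop:
  assumes M: "is_module Om A M" and A: "is_algebra Om A" and N: "submodule Om A M N"
    and f: "f \<in> Om (length as)" and as: "set as \<subseteq> carrier A" and l: "length ms = length as"
    and ms: "\<And>i. i < length as \<Longrightarrow> ms ! i \<in> carrier (mgrp M (as ! i))"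
  shows "mop (quot_mod A M N) f as (map2 (\<lambda>a m. N a #>\<^bsub>mgrp M a\<^esub> m) as ms)
    = N (opr A f as) #>\<^bsub>mgrp M (opr A f as)\<^esub> mop M f as ms"
proof -
  let ?b = "opr A f as" let ?H = "mgrp M ?b"
  let ?Xs = "map2 (\<lambda>a m. N a #>\<^bsub>mgrp M a\<^esub> m) as ms"
  have a: "as ! i \<in> carrier A" if "i < length as" for i using that as by auto
  have b: "?b \<in> carrier A" by (rule is_algebra_opr[OF A f as])
  interpret H: group ?H by (rule is_module_group(2)[OF M b])
  have Nb: "subgroup (N ?b) ?H" using N b by (simp add: submodule_def)
  have g: "group (mgrp M (as ! i))" if "i < length as" for i
    using that is_module_group(2)[OF M a] by simp
  have Ni: "subgroup (N (as ! i)) (mgrp M (as ! i))" if "i < length as" for i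
    using N a[OF that] by (simp add: submodule_def)
  have eq: "N ?b #>\<^bsub>?H\<^esub> mop M f as ns = N ?b #>\<^bsub>?H\<^esub> mop M f as ms"
    if "ns \<in> listset ?Xs" for ns
  proof -
    have ln: "length ns = length as"
      and "\<And>i. i < length as \<Longrightarrow> ns ! i \<in> N (as ! i) #>\<^bsub>mgrp M (as ! i)\<^esub> ms ! i"
      using that l by (auto simp: in_listset list_all2_conv_all_nth)
    then have "\<forall>i. \<exists>k. i < length as \<longrightarrow> k \<in> N (as ! i) \<and> ns ! i = k \<otimes>\<^bsub>mgrp M (as ! i)\<^esub> ms ! i"
      unfolding r_coset_def by blast
    then obtain k where k: "\<And>i. i < length as \<Longrightarrow> k i \<in> N (as ! i)"
      "\<And>i. i < length as \<Longrightarrow> ns ! i = k i \<otimes>\<^bsub>mgrp M (as ! i)\<^esub> ms ! i" by metis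
    let ?ks = "map k [0..<length as]"
    have "ns = map (\<lambda>i. ?ks ! i \<otimes>\<^bsub>mgrp M (as ! i)\<^esub> ms ! i) [0..<length as]"
      using ln k by (intro nth_equalityI) auto
    moreover have "?ks ! i \<in> carrier (mgrp M (as ! i))" if "i < length as" for i
      using subgroup.mem_carrier[OF Ni k(1)] that by simp
    ultimately have "mop M f as ns = mop M f as ?ks \<otimes>\<^bsub>?H\<^esub> mop M f as ms"
      using mop_mult[OF M f as _ l _ ms, of ?ks] by simp
    moreover have ks: "mop M f as ?ks \<in> N ?b"
      using N f as k(1) by (auto simp: submodule_def in_listset_map Pi_iff)
    moreover have "mop M f as ms \<in> carrier ?H" by (rule mop_closed[OF M f as l ms])
    ultimately show ?thesis
      using H.coset_mult_assoc[OF subgroup.subset[OF Nb] subgroup.mem_carrier[OF Nb ks]]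
        H.coset_join2[OF subgroup.mem_carrier[OF Nb ks] Nb ks] by simp
  qed
  have "ms ! i \<in> N (as ! i) #>\<^bsub>mgrp M (as ! i)\<^esub> ms ! i" if "i < length as" for i
    by (rule group.rcos_self[OF g ms Ni]) (use that in auto)
  then have "ms \<in> listset ?Xs" using l by (auto simp: in_listset list_all2_conv_all_nth)
  then have "(\<Union>ns\<in>listset ?Xs. N ?b #>\<^bsub>?H\<^esub> mop M f as ns) = N ?b #>\<^bsub>?H\<^esub> mop M f as ms"
    using eq by blast
  then show ?thesis by (simp add: quot_mod_def)
qed

lemma quot_mod_reps:
  assumes "Xs \<in> listset (map (\<lambda>a. carrier (mgrp (quot_mod A M N) a)) as)"
  obtains ms where "length ms = length as"
    "\<And>i. i < length as \<Longrightarrow> ms ! i \<in> carrier (mgrp M (as ! i))"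
    "Xs = map2 (\<lambda>a m. N a #>\<^bsub>mgrp M a\<^esub> m) as ms"
proof -
  have "\<exists>m. i < length as \<longrightarrow> m \<in> carrier (mgrp M (as ! i)) \<and>
      Xs ! i = N (as ! i) #>\<^bsub>mgrp M (as ! i)\<^esub> m" for i
    using assms by (auto simp: in_listset_map quot_mod_def FactGroup_def RCOSETS_def)
  then obtain m where m: "\<And>i. i < length as \<Longrightarrow> m i \<in> carrier (mgrp M (as ! i)) \<and>
      Xs ! i = N (as ! i) #>\<^bsub>mgrp M (as ! i)\<^esub> m i" by metis
  show thesis
    by (rule that[of "map m [0..<length as]"])
      (use m assms in \<open>auto simp: in_listset_map intro!: nth_equalityI\<close>)
qed

lemma submodule_normal:
  assumes "is_module Om A M" "submodule Om A M N" "a \<in> carrier A"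
  shows "N a \<lhd> mgrp M a"
  using comm_group.subgroup_imp_normal[OF is_module_group(1)[OF assms(1,3)]] assms(2,3)
  by (simp add: submodule_def)

text \<open>By \<open>coset_mop\<close> the projection commutes with the operations, so once
  representatives are chosen each law of the quotient is the image of that law in
  \<open>M\<close>.\<close>

lemma quot_mod_module:
  assumes M: "is_module Om A M" and A: "is_algebra Om A" and N: "submodule Om A M N"
  shows "is_module Om A (quot_mod A M N)"
    and "(\<lambda>a m. N a #>\<^bsub>mgrp M a\<^esub> m) \<in> module_hom Om A M (quot_mod A M N)"
proof -
  let ?Q = "quot_mod A M N" let ?q = "\<lambda>a m. N a #>\<^bsub>mgrp M a\<^esub> m"
  have Q: "mgrp ?Q a = mgrp M a Mod N a" for a by (simp add: quot_mod_def)
  have hom: "?q a \<in> hom (mgrp M a) (mgrp ?Q a)" if "a \<in> carrier A" for a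
    unfolding Q by (rule normal.r_coset_hom_Mod[OF submodule_normal[OF M N that]])
  show q: "?q \<in> module_hom Om A M ?Q"
    by (rule module_homI) (use hom coset_mop[OF M A N] in auto)
  show "is_module Om A ?Q"
    unfolding is_module_iff
  proof (intro conjI ballI allI impI)
    show "comm_group (mgrp ?Q a)" if "a \<in> carrier A" for a
      unfolding Q using M N that
      by (intro comm_group.abelian_FactGroup) (auto simp: is_module_def submodule_def)
    fix f as
    assume f: "f \<in> Om (length as)" and as: "set as \<subseteq> carrier A"
    note b = is_algebra_opr[OF A f as]
    note c = mop_closed[OF M f as]
    show "mop ?Q f as Xs \<in> carrier (mgrp ?Q (opr A f as))"
      if X: "Xs \<in> listset (map (\<lambda>a. carrier (mgrp ?Q a)) as)" for Xs
    proof -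
      obtain ms where ms: "length ms = length as"
        "\<And>i. i < length as \<Longrightarrow> ms ! i \<in> carrier (mgrp M (as ! i))" "Xs = map2 ?q as ms"
        using quot_mod_reps[OF X] by blast
      show ?thesis
        using coset_mop[OF M A N f as ms(1,2)] ms(3) c[OF ms(1,2)] hom_in_carrier[OF hom[OF b]] by simp
    qed
    show "mop ?Q f as (map (\<lambda>i. Xs ! i \<otimes>\<^bsub>mgrp ?Q (as ! i)\<^esub> Ys ! i) [0..<length as])
        = mop ?Q f as Xs \<otimes>\<^bsub>mgrp ?Q (opr A f as)\<^esub> mop ?Q f as Ys"
      if X: "Xs \<in> listset (map (\<lambda>a. carrier (mgrp ?Q a)) as)"
        and Y: "Ys \<in> listset (map (\<lambda>a. carrier (mgrp ?Q a)) as)" for Xs Ys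
    proof -
      obtain ms where ms: "length ms = length as"
        "\<And>i. i < length as \<Longrightarrow> ms ! i \<in> carrier (mgrp M (as ! i))" "Xs = map2 ?q as ms"
        using quot_mod_reps[OF X] by blast
      obtain ns where ns: "length ns = length as"
        "\<And>i. i < length as \<Longrightarrow> ns ! i \<in> carrier (mgrp M (as ! i))" "Ys = map2 ?q as ns"
        using quot_mod_reps[OF Y] by blast
      let ?s = "map (\<lambda>i. ms ! i \<otimes>\<^bsub>mgrp M (as ! i)\<^esub> ns ! i) [0..<length as]"
      have s: "?s ! i \<in> carrier (mgrp M (as ! i))" if "i < length as" for i
        using ms(2)[OF that] ns(2)[OF that] that is_module_group(2)[OF M subsetD[OF as nth_mem]]
        by (auto intro!: monoid.m_closed group.is_monoid)
      have "map (\<lambda>i. Xs ! i \<otimes>\<^bsub>mgrp ?Q (as ! i)\<^esub> Ys ! i) [0..<length as] = map2 ?q as ?s"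
      proof (rule nth_equalityI)
        fix i assume "i < length (map (\<lambda>i. Xs ! i \<otimes>\<^bsub>mgrp ?Q (as ! i)\<^esub> Ys ! i) [0..<length as])"
        then have i: "i < length as" by simp
        then have "as ! i \<in> carrier A" using as by auto
        from hom_mult[OF hom[OF this] ms(2)[OF i] ns(2)[OF i]]
        show "map (\<lambda>i. Xs ! i \<otimes>\<^bsub>mgrp ?Q (as ! i)\<^esub> Ys ! i) [0..<length as] ! i = map2 ?q as ?s ! i"
          using i ms(1,3) ns(1,3) by simp
      qed simp
      then show ?thesis
        using coset_mop[OF M A N f as ms(1,2)] coset_mop[OF M A N f as ns(1,2)]
          coset_mop[OF M A N f as _ s] mop_mult[OF M f as ms(1) ns(1) ms(2) ns(2)] ms(3) ns(3)
          hom_mult[OF hom[OF b] c[OF ms(1,2)] c[OF ns(1,2)]]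
        by simp
    qed
  qed
qed

lemma quot_mod_universal:
  assumes M: "is_module Om A M" and A: "is_algebra Om A" and N: "submodule Om A M N"
    and M': "is_module Om A M'" and \<psi>: "\<psi> \<in> module_hom Om A M M'"
    and ker: "\<And>a n. a \<in> carrier A \<Longrightarrow> n \<in> N a \<Longrightarrow> \<psi> a n = \<one>\<^bsub>mgrp M' a\<^esub>"
  obtains \<theta> where "\<theta> \<in> module_hom Om A (quot_mod A M N) M'"
    "\<And>a m. a \<in> carrier A \<Longrightarrow> m \<in> carrier (mgrp M a) \<Longrightarrow> \<theta> a (N a #>\<^bsub>mgrp M a\<^esub> m) = \<psi> a m"
proof -
  let ?Q = "quot_mod A M N" let ?q = "\<lambda>a m. N a #>\<^bsub>mgrp M a\<^esub> m"
  \<comment> \<open>Any representative will do: two of them differ by an element of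
    \<open>N a\<close>, which \<psi> sends to zero.\<close>
  define \<theta> where "\<theta> = (\<lambda>a X. \<psi> a (SOME m. m \<in> X))"
  have \<theta>: "\<theta> a (?q a m) = \<psi> a m" if a: "a \<in> carrier A" and m: "m \<in> carrier (mgrp M a)" for a m
  proof -
    interpret \<psi>: group_hom "mgrp M a" "mgrp M' a" "\<psi> a"
      by (rule module_hom_group_hom[OF M M' \<psi> a])
    have Na: "subgroup (N a) (mgrp M a)" using N a by (simp add: submodule_def)
    have "m \<in> ?q a m" by (rule \<psi>.G.rcos_self[OF m Na])
    then have "(SOME m'. m' \<in> ?q a m) \<in> ?q a m" by (rule someI)
    then obtain k where k: "k \<in> N a" "(SOME m'. m' \<in> ?q a m) = k \<otimes>\<^bsub>mgrp M a\<^esub> m"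
      by (auto simp: r_coset_def)
    then show ?thesis
      using ker[OF a k(1)] m subgroup.mem_carrier[OF Na k(1)] by (simp add: \<theta>_def)
  qed
  have "\<theta> \<in> module_hom Om A ?Q M'"
  proof (rule module_homI)
    fix a assume a: "a \<in> carrier A"
    have h: "?q a \<in> hom (mgrp M a) (mgrp ?Q a)"
      by (rule module_hom_hom[OF quot_mod_module(2)[OF M A N] a])
    have c: "carrier (mgrp ?Q a) = ?q a ` carrier (mgrp M a)"
      by (auto simp: quot_mod_def FactGroup_def RCOSETS_def)
    have m: "m \<otimes>\<^bsub>mgrp M a\<^esub> n \<in> carrier (mgrp M a)"
      if "m \<in> carrier (mgrp M a)" "n \<in> carrier (mgrp M a)" for m n
      using that is_module_group(2)[OF M a] by (simp add: group.is_monoid monoid.m_closed)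
    show "\<theta> a \<in> hom (mgrp ?Q a) (mgrp M' a)"
    proof (rule homI)
      show "\<theta> a X \<in> carrier (mgrp M' a)" if "X \<in> carrier (mgrp ?Q a)" for X
        using that \<theta>[OF a] hom_in_carrier[OF module_hom_hom[OF \<psi> a]] by (auto simp: c)
      fix X Y assume "X \<in> carrier (mgrp ?Q a)" "Y \<in> carrier (mgrp ?Q a)"
      then obtain m n where mn: "m \<in> carrier (mgrp M a)" "n \<in> carrier (mgrp M a)"
        "X = ?q a m" "Y = ?q a n" unfolding c by blast
      then show "\<theta> a (X \<otimes>\<^bsub>mgrp ?Q a\<^esub> Y) = \<theta> a X \<otimes>\<^bsub>mgrp M' a\<^esub> \<theta> a Y"
        using hom_mult[OF h mn(1,2)] hom_mult[OF module_hom_hom[OF \<psi> a] mn(1,2)]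
          \<theta>[OF a m[OF mn(1,2)]] \<theta>[OF a mn(1)] \<theta>[OF a mn(2)] by simp
    qed
  next
    fix f as Xs
    assume f: "f \<in> Om (length as)" and as: "set as \<subseteq> carrier A" and X: "length Xs = length as"
      "\<And>i. i < length as \<Longrightarrow> Xs ! i \<in> carrier (mgrp ?Q (as ! i))"
    from X have X': "Xs \<in> listset (map (\<lambda>a. carrier (mgrp ?Q a)) as)" by (simp add: in_listset_map)
    obtain ms where ms: "length ms = length as"
      "\<And>i. i < length as \<Longrightarrow> ms ! i \<in> carrier (mgrp M (as ! i))" "Xs = map2 ?q as ms"
      using quot_mod_reps[OF X'] by blast
    have "map2 \<psi> as ms = map2 \<theta> as Xs"
    proof (rule nth_equalityI)
      fix i assume "i < length (map2 \<psi> as ms)"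
      then have i: "i < length as" by simp
      then have "as ! i \<in> carrier A" using as by auto
      from \<theta>[OF this ms(2)[OF i]] show "map2 \<psi> as ms ! i = map2 \<theta> as Xs ! i"
        using i ms(1,3) by simp
    qed (use ms in simp)
    then show "\<theta> (opr A f as) (mop ?Q f as Xs) = mop M' f as (map2 \<theta> as Xs)"
      using coset_mop[OF M A N f as ms(1,2)] ms(3) \<theta>[OF is_algebra_opr[OF A f as] mop_closed[OF M f as ms(1,2)]]
        module_hom_mop[OF \<psi> f as ms(1,2)] by simp
  qed
  then show thesis using \<theta> by (rule that)
qed

section \<open>The universal property of modulization\<close>

lemma mgrp_hat_mod [simp]: "mgrp (hat_mod P) a = free_Abelian_group (pset P a)"
  by (simp add: hat_mod_def)

lemma hat_op_add: "hat_op P f as i (x + y) = hat_op P f as i x + hat_op P f as i y"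
  by (simp add: hat_op_def frag_extend_add)

lemma hat_op_closed:
  assumes P: "is_pover Om A P" and f: "f \<in> Om (length as)" and as: "set as \<subseteq> carrier A"
    and i: "i < length as" and m: "Poly_Mapping.keys m \<subseteq> pset P (as ! i)"
  shows "Poly_Mapping.keys (hat_op P f as i m) \<subseteq> pset P (opr A f as)"
proof -
  have "pop P f as ((map (pbase P) as)[i := p]) \<in> pset P (opr A f as)" if "p \<in> pset P (as ! i)" for p
    by (rule pop_closed[OF P f as])
      (use that i is_pover_base[OF P subsetD[OF as nth_mem]] in \<open>auto simp: nth_list_update\<close>)
  then show ?thesis
    using m keys_frag_extend[of "\<lambda>p. frag_of (pop P f as ((map (pbase P) as)[i := p]))" m]
    unfolding hat_op_def by fastforce
qed

lemma hat_mod_module: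
  assumes P: "is_pover Om A P"
  shows "is_module Om A (hat_mod P)"
  unfolding is_module_iff
proof (intro conjI allI impI ballI)
  fix f as ms ns
  assume f: "f \<in> Om (length as)" and as: "set as \<subseteq> carrier A"
  {
    assume "ms \<in> listset (map (\<lambda>a. carrier (mgrp (hat_mod P) a)) as)"
    then have "Poly_Mapping.keys (ms ! i) \<subseteq> pset P (as ! i)" if "i < length as" for i
      using that by (simp add: in_listset_map)
    then have "Poly_Mapping.keys (hat_op P f as i (ms ! i)) \<subseteq> pset P (opr A f as)"
      if "i < length as" for i
      using hat_op_closed[OF P f as] that by blast
    then show "mop (hat_mod P) f as ms \<in> carrier (mgrp (hat_mod P) (opr A f as))"
      using sum_closed_free_Abelian_group[of "{..<length as}" "\<lambda>i. hat_op P f as i (ms ! i)"]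
      by (simp add: hat_mod_def)
  }
  show "mop (hat_mod P) f as (map (\<lambda>i. ms ! i \<otimes>\<^bsub>mgrp (hat_mod P) (as ! i)\<^esub> ns ! i) [0..<length as])
    = mop (hat_mod P) f as ms \<otimes>\<^bsub>mgrp (hat_mod P) (opr A f as)\<^esub> mop (hat_mod P) f as ns"
    by (simp add: hat_mod_def hat_op_add sum.distrib)
qed (simp add: abelian_free_Abelian_group)

lemma generate_free_Abelian_group:
  "carrier (free_Abelian_group S) \<subseteq> generate (free_Abelian_group S) (frag_of ` S)"
proof
  fix x assume "x \<in> carrier (free_Abelian_group S)"
  then have "Poly_Mapping.keys x \<subseteq> S" by simp
  then show "x \<in> generate (free_Abelian_group S) (frag_of ` S)"
  proof (rule free_Abelian_group_induct)
    show "0 \<in> generate (free_Abelian_group S) (frag_of ` S)"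
      using generate.one[of "free_Abelian_group S"] by simp
  next
    fix x y
    assume xy: "Poly_Mapping.keys y \<subseteq> S" "x \<in> generate (free_Abelian_group S) (frag_of ` S)"
      "y \<in> generate (free_Abelian_group S) (frag_of ` S)"
    then have "inv\<^bsub>free_Abelian_group S\<^esub> y \<in> generate (free_Abelian_group S) (frag_of ` S)"
      by (intro group.generate_m_inv_closed[OF group_free_Abelian_group]) auto
    then show "x - y \<in> generate (free_Abelian_group S) (frag_of ` S)"
      using generate.eng[OF xy(2), of "- y"] xy(1) by simp
  qed (simp add: generate.incl)
qed

section \<open>The kernel and the unit of modulization\<close>

text \<open>These are the conditions inside the intersection that defines
  \<open>modulize_ker\<close>. Under a name they can be proved of a family: of the full carriers, of
  the kernel itself, and of the kernel of a given homomorphism.\<close>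

definition modulize_gens ::
  "(nat \<Rightarrow> 'f set) \<Rightarrow> ('f, 'a) alg \<Rightarrow> ('f, 'a, 'p) pover \<Rightarrow> ('a \<Rightarrow> ('p \<Rightarrow>\<^sub>0 int) set) \<Rightarrow> bool" where
  "modulize_gens Om A P N \<longleftrightarrow>
     submodule Om A (hat_mod P) N \<and>
     (\<forall>b\<in>carrier A. frag_of (pbase P b) \<in> N b) \<and>
     (\<forall>f as. f \<in> Om (length as) \<longrightarrow> set as \<subseteq> carrier A \<longrightarrow>
        (\<forall>ps\<in>listset (map (pset P) as).
           frag_of (pop P f as ps) - (\<Sum>i<length as. hat_op P f as i (frag_of (ps ! i)))
             \<in> N (opr A f as)))"

lemma modulize_ker_eq: "modulize_ker Om A P a = \<Inter>{N a | N. modulize_gens Om A P N}"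
  by (simp add: modulize_ker_def modulize_gens_def)

text \<open>Shows that the intersection defining \<open>modulize_ker\<close> is taken over a
  nonempty collection, without which it would not be a family of subgroups.\<close>

lemma modulize_gens_carrier:
  assumes P: "is_pover Om A P" and A: "is_algebra Om A"
  shows "modulize_gens Om A P (\<lambda>a. carrier (free_Abelian_group (pset P a)))"
proof -
  let ?c = "\<lambda>a. carrier (mgrp (hat_mod P) a)"
  have M: "is_module Om A (hat_mod P)" by (rule hat_mod_module[OF P])
  have "submodule Om A (hat_mod P) ?c"
    using M by (auto simp: submodule_def is_module_iff group.subgroup_self simp del: mgrp_hat_mod)
      (simp add: group.subgroup_self)
  moreover have "frag_of (pop P f as ps) - (\<Sum>i<length as. hat_op P f as i (frag_of (ps ! i))) \<in> ?c (opr A f as)"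
    if f: "f \<in> Om (length as)" and as: "set as \<subseteq> carrier A" and ps: "ps \<in> listset (map (pset P) as)"
    for f as ps
  proof -
    have "(\<Sum>i<length as. hat_op P f as i (frag_of (ps ! i))) \<in> ?c (opr A f as)"
      using sum_closed_free_Abelian_group[of "{..<length as}" "\<lambda>i. hat_op P f as i (frag_of (ps ! i))"]
        hat_op_closed[OF P f as] ps by (simp add: in_listset_map)
    moreover have "pop P f as ps \<in> pset P (opr A f as)"
      by (rule pop_closed[OF P f as]) (use ps in \<open>simp_all add: in_listset_map\<close>)
    ultimately show ?thesis
      using keys_diff[of "frag_of (pop P f as ps)" "\<Sum>i<length as. hat_op P f as i (frag_of (ps ! i))"]
      by auto
  qed
  ultimately show ?thesis using is_pover_base[OF P] by (simp add: modulize_gens_def)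
qed

lemma modulize_ker_gens:
  assumes P: "is_pover Om A P" and A: "is_algebra Om A"
  shows "modulize_gens Om A P (modulize_ker Om A P)"
proof -
  let ?K = "modulize_ker Om A P"
  have sub: "submodule Om A (hat_mod P) N" if "modulize_gens Om A P N" for N
    using that by (simp add: modulize_gens_def)
  have "subgroup (?K a) (mgrp (hat_mod P) a)" if "a \<in> carrier A" for a
    unfolding modulize_ker_eq
    by (rule group.subgroups_Inter)
      (use that sub modulize_gens_carrier[OF P A] in \<open>auto simp: submodule_def\<close>)
  moreover have "mop (hat_mod P) f as ms \<in> ?K (opr A f as)"
    if f: "f \<in> Om (length as)" and as: "set as \<subseteq> carrier A" and ms: "ms \<in> listset (map ?K as)" for f as ms
  proof -
    have "mop (hat_mod P) f as ms \<in> N (opr A f as)" if N: "modulize_gens Om A P N" for N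
    proof -
      have "ms \<in> listset (map N as)"
        using ms N by (fastforce simp: in_listset_map modulize_ker_eq)
      moreover have "mop (hat_mod P) f as \<in> listset (map N as) \<rightarrow> N (opr A f as)"
        using sub[OF N] f as by (simp add: submodule_def)
      ultimately show ?thesis by blast
    qed
    then show ?thesis by (auto simp: modulize_ker_eq)
  qed
  ultimately have "submodule Om A (hat_mod P) ?K" by (auto simp: submodule_def)
  then show ?thesis unfolding modulize_gens_def by (auto simp: modulize_ker_eq modulize_gens_def)
qed

lemma modulize_ker_submodule:
  "is_pover Om A P \<Longrightarrow> is_algebra Om A \<Longrightarrow> submodule Om A (hat_mod P) (modulize_ker Om A P)"
  using modulize_ker_gens by (auto simp: modulize_gens_def)

lemma modulize_module:
  "is_pover Om A P \<Longrightarrow> is_algebra Om A \<Longrightarrow> is_module Om A (modulize Om A P)"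
  unfolding modulize_def by (intro quot_mod_module hat_mod_module modulize_ker_submodule)

lemma modulize_proj_hom:
  assumes "is_pover Om A P" "is_algebra Om A"
  shows "(\<lambda>a m. modulize_ker Om A P a #>\<^bsub>mgrp (hat_mod P) a\<^esub> m)
    \<in> module_hom Om A (hat_mod P) (modulize Om A P)"
  unfolding modulize_def
  by (rule quot_mod_module(2)[OF hat_mod_module[OF assms(1)] assms(2) modulize_ker_submodule[OF assms]])

lemma modulize_unit_closed:
  assumes "is_pover Om A P" "is_algebra Om A" "a \<in> carrier A" "p \<in> pset P a"
  shows "modulize_unit Om A P a p \<in> carrier (mgrp (modulize Om A P) a)"
  using hom_in_carrier[OF module_hom_hom[OF modulize_proj_hom[OF assms(1,2)] assms(3)], of "frag_of p"]
    assms(4) by (simp add: modulize_unit_def)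

text \<open>The free group is generated by the elements \<open>frag_of p\<close>, and the projection
  to the quotient is onto. Homomorphisms out of \<open>modulize\<close> therefore need comparing
  only on the image of the unit.\<close>

lemma modulize_generated:
  assumes P: "is_pover Om A P" and A: "is_algebra Om A" and a: "a \<in> carrier A"
  shows "carrier (mgrp (modulize Om A P) a)
    \<subseteq> generate (mgrp (modulize Om A P) a) (modulize_unit Om A P a ` pset P a)"
proof
  let ?q = "\<lambda>m. modulize_ker Om A P a #>\<^bsub>mgrp (hat_mod P) a\<^esub> m"
  interpret q: group_hom "mgrp (hat_mod P) a" "mgrp (modulize Om A P) a" ?q
    by (rule module_hom_group_hom[OF hat_mod_module[OF P] modulize_module[OF P A] modulize_proj_hom[OF P A] a])
  fix z assume "z \<in> carrier (mgrp (modulize Om A P) a)"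
  then obtain m where "m \<in> carrier (mgrp (hat_mod P) a)" "z = ?q m"
    by (auto simp: modulize_def quot_mod_def FactGroup_def RCOSETS_def)
  then have "z \<in> ?q ` generate (mgrp (hat_mod P) a) (frag_of ` pset P a)"
    using generate_free_Abelian_group by fastforce
  also have "\<dots> = generate (mgrp (modulize Om A P) a) (?q ` frag_of ` pset P a)"
    by (rule q.generate_img[symmetric]) auto
  also have "?q ` frag_of ` pset P a = modulize_unit Om A P a ` pset P a"
    by (simp add: image_image modulize_unit_def)
  finally show "z \<in> generate (mgrp (modulize Om A P) a) (modulize_unit Om A P a ` pset P a)" .
qed

lemma coset_eq_if_diff:
  assumes "group G" "subgroup N G" "x \<in> carrier G" "y \<in> carrier G" "x \<otimes>\<^bsub>G\<^esub> inv\<^bsub>G\<^esub> y \<in> N"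
  shows "N #>\<^bsub>G\<^esub> x = N #>\<^bsub>G\<^esub> y"
proof -
  interpret group G by fact
  have "x = (x \<otimes>\<^bsub>G\<^esub> inv\<^bsub>G\<^esub> y) \<otimes>\<^bsub>G\<^esub> y" using assms(3,4) by (simp add: m_assoc)
  then show ?thesis
    using coset_mult_assoc[OF subgroup.subset[OF assms(2)], of "x \<otimes>\<^bsub>G\<^esub> inv\<^bsub>G\<^esub> y" y]
      coset_join2[OF _ assms(2,5)] assms(3,4) by simp
qed

text \<open>The two families of generators of the kernel are what \<open>frag_of\<close> lacks to be
  a homomorphism of overalgebras. One turns basepoints into zero. The other identifies the value of
  an operation with the sum of its values in one variable, and that sum is the operation of
  \<open>hat_mod\<close>.\<close>

lemma modulize_unit_hom:
  assumes P: "is_pover Om A P" and A: "is_algebra Om A"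
  shows "modulize_unit Om A P \<in> pover_hom Om A P (forget (modulize Om A P))"
proof (rule pover_homI)
  let ?K = "modulize_ker Om A P" and ?M = "modulize Om A P"
  note K = modulize_ker_gens[OF P A] modulize_ker_submodule[OF P A]
  have sub: "subgroup (?K a) (free_Abelian_group (pset P a))" if "a \<in> carrier A" for a
    using K(2) that by (simp add: submodule_def)
  show "modulize_unit Om A P a p \<in> pset (forget ?M) a" if "a \<in> carrier A" "p \<in> pset P a" for a p
    using modulize_unit_closed[OF P A that] by (simp add: forget_def)
  show "modulize_unit Om A P a (pbase P a) = pbase (forget ?M) a" if a: "a \<in> carrier A" for a
  proof -
    have k: "frag_of (pbase P a) \<in> ?K a" using K(1) a by (simp add: modulize_gens_def)
    then have "?K a #>\<^bsub>mgrp (hat_mod P) a\<^esub> frag_of (pbase P a) = ?K a"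
      using group.coset_join2[OF group_free_Abelian_group _ sub[OF a] k] is_pover_base[OF P a] by simp
    then show ?thesis
      by (simp add: modulize_unit_def forget_def modulize_def quot_mod_def FactGroup_def)
  qed
  fix f as ps
  assume f: "f \<in> Om (length as)" and as: "set as \<subseteq> carrier A" and l: "length ps = length as"
    and ps: "\<And>i. i < length as \<Longrightarrow> ps ! i \<in> pset P (as ! i)"
  let ?b = "opr A f as" and ?ms = "map frag_of ps"
  have b: "?b \<in> carrier A" by (rule is_algebra_opr[OF A f as])
  have ms: "length ?ms = length as" "\<And>i. i < length as \<Longrightarrow> ?ms ! i \<in> carrier (mgrp (hat_mod P) (as ! i))"
    using l ps by simp_all
  have s: "mop (hat_mod P) f as ?ms = (\<Sum>i<length as. hat_op P f as i (frag_of (ps ! i)))"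
    using l by (simp add: hat_mod_def)
  have c: "Poly_Mapping.keys (mop (hat_mod P) f as ?ms) \<subseteq> pset P ?b"
    using mop_closed[OF hat_mod_module[OF P] f as ms] by simp
  have "frag_of (pop P f as ps) - mop (hat_mod P) f as ?ms \<in> ?K ?b"
    using K(1) f as l ps unfolding s by (auto simp: modulize_gens_def in_listset_map)
  then have "modulize_unit Om A P ?b (pop P f as ps)
      = ?K ?b #>\<^bsub>mgrp (hat_mod P) ?b\<^esub> mop (hat_mod P) f as ?ms"
    unfolding modulize_unit_def mgrp_hat_mod
    by (intro coset_eq_if_diff[OF group_free_Abelian_group sub[OF b]])
      (use pop_closed[OF P f as l ps] c in auto)
  also have "\<dots> = mop ?M f as (map2 (\<lambda>a m. ?K a #>\<^bsub>mgrp (hat_mod P) a\<^esub> m) as ?ms)"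
    by (rule module_hom_mop[OF modulize_proj_hom[OF P A] f as ms])
  also have "map2 (\<lambda>a m. ?K a #>\<^bsub>mgrp (hat_mod P) a\<^esub> m) as ?ms = map2 (modulize_unit Om A P) as ps"
    using l by (intro nth_equalityI) (auto simp: modulize_unit_def)
  finally show "modulize_unit Om A P ?b (pop P f as ps) = pop (forget ?M) f as (map2 (modulize_unit Om A P) as ps)"
    by (simp add: forget_def)
qed

section \<open>Extension of overalgebra homomorphisms along the unit\<close>

text \<open>Freeness of each group gives \<psi> index by index. Commutation with an operation is
  checked on tuples with one generator and zeros elsewhere, where \<open>hat_op\<close> is an
  operation of \<open>P\<close> with basepoints in the other places and \<phi> is a homomorphism.
  Additivity does the rest; no passage to the quotient is needed for this.\<close>

lemma hat_mod_universal:
  assumes P: "is_pover Om A P" and A: "is_algebra Om A" and M: "is_module Om A M"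
    and \<phi>: "\<phi> \<in> pover_hom Om A P (forget M)"
  obtains \<psi> where "\<psi> \<in> module_hom Om A (hat_mod P) M"
    "\<And>a p. a \<in> carrier A \<Longrightarrow> p \<in> pset P a \<Longrightarrow> \<psi> a (frag_of p) = \<phi> a p"
proof -
  have c: "\<phi> a p \<in> carrier (mgrp M a)" if "a \<in> carrier A" "p \<in> pset P a" for a p
    using pover_hom_closed(1)[OF \<phi> that] by (simp add: forget_def)
  have "\<exists>h. a \<in> carrier A \<longrightarrow> h \<in> hom (free_Abelian_group (pset P a)) (mgrp M a) \<and>
      (\<forall>p\<in>pset P a. h (frag_of p) = \<phi> a p)" for a
    using comm_group.free_Abelian_group_universal[OF is_module_group(1)[OF M], of a "\<phi> a" "pset P a"] c
    by (metis image_subsetI)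
  then obtain \<psi> where \<psi>: "\<And>a. a \<in> carrier A \<Longrightarrow> \<psi> a \<in> hom (free_Abelian_group (pset P a)) (mgrp M a)"
    "\<And>a p. a \<in> carrier A \<Longrightarrow> p \<in> pset P a \<Longrightarrow> \<psi> a (frag_of p) = \<phi> a p" by metis
  have "\<psi> \<in> module_hom Om A (hat_mod P) M"
  proof (rule module_homI)
    fix f as ms
    assume f: "f \<in> Om (length as)" and as: "set as \<subseteq> carrier A" and l: "length ms = length as"
      and ms: "\<And>i. i < length as \<Longrightarrow> ms ! i \<in> carrier (mgrp (hat_mod P) (as ! i))"
    let ?b = "opr A f as" and ?n = "length as"
    have b: "?b \<in> carrier A" by (rule is_algebra_opr[OF A f as])
    note hat = hat_mod_module[OF P]
    note pa = is_pover_base[OF P subsetD[OF as nth_mem]]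
    \<comment> \<open>Indices beyond the arity get the trivial group, so that tuples can be treated as functions on all of \<open>nat\<close>.\<close>
    define G where "G = (\<lambda>i. free_Abelian_group (if i < ?n then pset P (as ! i) else {}))"
    define S where "S = (\<lambda>i. frag_of ` (if i < ?n then pset P (as ! i) else {}) :: ('c \<Rightarrow>\<^sub>0 int) set)"
    let ?F = "\<lambda>x. \<psi> ?b (mop (hat_mod P) f as (map x [0..<?n]))"
    let ?K = "\<lambda>x. mop M f as (map (\<lambda>i. \<psi> (as ! i) (x i)) [0..<?n])"
    have x: "map x [0..<?n] ! i \<in> carrier (mgrp (hat_mod P) (as ! i))"
      if "\<And>i. x i \<in> carrier (G i)" "i < ?n" for x i
      using that(1)[of i] that(2) by (simp add: G_def)
    have \<psi>x: "map (\<lambda>i. \<psi> (as ! i) (x i)) [0..<?n] ! i \<in> carrier (mgrp M (as ! i))"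
      if "\<And>i. x i \<in> carrier (G i)" "i < ?n" for x i
      using hom_in_carrier[OF \<psi>(1)[OF subsetD[OF as nth_mem]], of i "x i"] that(1)[of i] that(2)
      by (simp add: G_def)
    have "?F (\<lambda>i. if i < ?n then ms ! i else 0) = ?K (\<lambda>i. if i < ?n then ms ! i else 0)"
    proof (rule additive_agree[where G = G and S = S and J = "{..<?n}" and H = "mgrp M ?b"
        and F = ?F and K = ?K])
      show "group (mgrp M ?b)" by (rule is_module_group(2)[OF M b])
      show "group (G i)" for i by (simp add: G_def)
      show "?F x \<in> carrier (mgrp M ?b)" if "\<And>i. x i \<in> carrier (G i)" for x
        using hom_in_carrier[OF \<psi>(1)[OF b]] mop_closed[OF hat f as, of "map x [0..<?n]"] x[OF that] by simp
      show "?K x \<in> carrier (mgrp M ?b)" if "\<And>i. x i \<in> carrier (G i)" for x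
        by (rule mop_closed[OF M f as _ \<psi>x[OF that]]) simp_all
      show "?F (\<lambda>i. x i \<otimes>\<^bsub>G i\<^esub> y i) = ?F x \<otimes>\<^bsub>mgrp M ?b\<^esub> ?F y"
        if xc: "\<And>i. x i \<in> carrier (G i)" and yc: "\<And>i. y i \<in> carrier (G i)" for x y
      proof -
        have "mop (hat_mod P) f as (map (\<lambda>i. x i \<otimes>\<^bsub>G i\<^esub> y i) [0..<?n])
          = mop (hat_mod P) f as (map x [0..<?n]) + mop (hat_mod P) f as (map y [0..<?n])"
          by (simp add: hat_mod_def G_def hat_op_add sum.distrib)
        then show ?thesis
          using hom_mult[OF \<psi>(1)[OF b]] mop_closed[OF hat f as, of "map x [0..<?n]"]
            mop_closed[OF hat f as, of "map y [0..<?n]"] x[OF xc] x[OF yc] by simp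
      qed
      show "?K (\<lambda>i. x i \<otimes>\<^bsub>G i\<^esub> y i) = ?K x \<otimes>\<^bsub>mgrp M ?b\<^esub> ?K y"
        if xc: "\<And>i. x i \<in> carrier (G i)" and yc: "\<And>i. y i \<in> carrier (G i)" for x y
      proof -
        have "\<psi> (as ! i) (x i \<otimes>\<^bsub>G i\<^esub> y i) = \<psi> (as ! i) (x i) \<otimes>\<^bsub>mgrp M (as ! i)\<^esub> \<psi> (as ! i) (y i)"
          if "i < ?n" for i
          using hom_mult[OF \<psi>(1)[OF subsetD[OF as nth_mem[OF that]]]] xc[of i] yc[of i] that by (simp add: G_def)
        then have eq: "map (\<lambda>i. \<psi> (as ! i) (x i \<otimes>\<^bsub>G i\<^esub> y i)) [0..<?n] =
          map (\<lambda>i. map (\<lambda>i. \<psi> (as ! i) (x i)) [0..<?n] ! i \<otimes>\<^bsub>mgrp M (as ! i)\<^esub>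
            map (\<lambda>i. \<psi> (as ! i) (y i)) [0..<?n] ! i) [0..<?n]" by simp
        show ?thesis
          unfolding eq by (rule mop_mult[OF M f as _ _ \<psi>x[OF xc] \<psi>x[OF yc]]) simp_all
      qed
      show "S i \<subseteq> carrier (G i)" for i by (auto simp: S_def G_def)
      show "carrier (G i) \<subseteq> generate (G i) (S i)" for i
        unfolding S_def G_def by (rule generate_free_Abelian_group)
      show "?F ((\<lambda>i. \<one>\<^bsub>G i\<^esub>)(i := s)) = ?K ((\<lambda>i. \<one>\<^bsub>G i\<^esub>)(i := s))" if sS: "s \<in> S i" for i s
      proof -
        obtain p where i: "i < ?n" and p: "p \<in> pset P (as ! i)" and s: "s = frag_of p"
          using sS by (auto simp: S_def split: if_splits)
        have hz: "hat_op P f as j 0 = 0" for j by (simp add: hat_op_def)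
        let ?ps = "(map (pbase P) as)[i := p]"
        have ps: "?ps ! j \<in> pset P (as ! j)" if "j < ?n" for j
          using pa[OF that] p i that by (auto simp: nth_list_update)
        \<comment> \<open>Only the summand at \<open>i\<close> survives, since \<open>hat_op\<close>
          vanishes at zero; by definition it is the generator for the operation of \<open>P\<close>
          at \<open>?ps\<close>.\<close>
        have "mop (hat_mod P) f as (map ((\<lambda>i. \<one>\<^bsub>G i\<^esub>)(i := s)) [0..<?n])
            = (\<Sum>j<?n. if j = i then hat_op P f as i s else 0)"
          unfolding hat_mod_def amod.simps by (rule sum.cong) (auto simp: G_def hz)
        also have "\<dots> = frag_of (pop P f as ?ps)" using i by (simp add: s hat_op_def)
        finally have "?F ((\<lambda>i. \<one>\<^bsub>G i\<^esub>)(i := s)) = \<phi> ?b (pop P f as ?ps)"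
          using \<psi>(2)[OF b pop_closed[OF P f as _ ps]] by simp
        also have "\<dots> = mop M f as (map2 \<phi> as ?ps)"
          using pover_hom_pop[OF \<phi> f as _ ps] by (simp add: forget_def)
        \<comment> \<open>Away from \<open>i\<close> the left side has \<phi> at a basepoint and the
          right side has \<psi> at zero; both are the zero of the fibre of \<open>M\<close>.\<close>
        also have "map2 \<phi> as ?ps = map (\<lambda>j. \<psi> (as ! j) (((\<lambda>i. \<one>\<^bsub>G i\<^esub>)(i := s)) j)) [0..<?n]"
        proof (rule nth_equalityI)
          fix j assume "j < length (map2 \<phi> as ?ps)"
          then have j: "j < ?n" by simp
          then have aj: "as ! j \<in> carrier A" using as by auto
          have "\<psi> (as ! j) 0 = \<one>\<^bsub>mgrp M (as ! j)\<^esub>"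
            using hom_one[OF \<psi>(1)[OF aj]] is_module_group(2)[OF M aj] by simp
          then show "map2 \<phi> as ?ps ! j = map (\<lambda>j. \<psi> (as ! j) (((\<lambda>i. \<one>\<^bsub>G i\<^esub>)(i := s)) j)) [0..<?n] ! j"
            using j i p s \<psi>(2)[OF aj] pover_hom_closed(2)[OF \<phi> aj]
            by (auto simp: nth_list_update G_def forget_def)
        qed simp
        finally show ?thesis .
      qed
      show "(if i < ?n then ms ! i else 0) \<in> carrier (G i)" for i
        using ms[of i] by (simp add: G_def)
    qed (simp_all add: G_def)
    moreover have "map (\<lambda>i. if i < ?n then ms ! i else 0) [0..<?n] = ms"
      "map (\<lambda>i. \<psi> (as ! i) (if i < ?n then ms ! i else 0)) [0..<?n] = map2 \<psi> as ms"
      using l by (auto intro: nth_equalityI)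
    ultimately show "\<psi> ?b (mop (hat_mod P) f as ms) = mop M f as (map2 \<psi> as ms)" by simp
  qed (simp add: \<psi>(1))
  then show thesis using \<psi>(2) by (rule that)
qed

text \<open>The kernels of the free extension \<psi> satisfy \<open>modulize_gens\<close>, because
  \<phi> preserves basepoints and commutes with the operations. They contain
  \<open>modulize_ker\<close>, the intersection of all such families, so \<psi> factors through the
  quotient.\<close>

lemma modulize_universal:
  assumes P: "is_pover Om A P" and A: "is_algebra Om A" and M: "is_module Om A M"
    and \<phi>: "\<phi> \<in> pover_hom Om A P (forget M)"
  obtains \<theta> where "\<theta> \<in> module_hom Om A (modulize Om A P) M"
    "\<And>a p. a \<in> carrier A \<Longrightarrow> p \<in> pset P a \<Longrightarrow> \<theta> a (modulize_unit Om A P a p) = \<phi> a p"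
proof -
  obtain \<psi> where \<psi>: "\<psi> \<in> module_hom Om A (hat_mod P) M"
    "\<And>a p. a \<in> carrier A \<Longrightarrow> p \<in> pset P a \<Longrightarrow> \<psi> a (frag_of p) = \<phi> a p"
    using hat_mod_universal[OF P A M \<phi>] by blast
  note hat = hat_mod_module[OF P]
  let ?N = "\<lambda>a. kernel (mgrp (hat_mod P) a) (mgrp M a) (\<psi> a)"
  have h: "group_hom (mgrp (hat_mod P) a) (mgrp M a) (\<psi> a)" if "a \<in> carrier A" for a
    by (rule module_hom_group_hom[OF hat M \<psi>(1) that])
  have "submodule Om A (hat_mod P) ?N"
    unfolding submodule_def
  proof (intro conjI ballI allI impI funcsetI)
    show "subgroup (?N a) (mgrp (hat_mod P) a)" if "a \<in> carrier A" for a
      by (rule group_hom.subgroup_kernel[OF h[OF that]])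
    fix f as ms
    assume f: "f \<in> Om (length as)" and as: "set as \<subseteq> carrier A" and "ms \<in> listset (map ?N as)"
    then have ms: "length ms = length as" "\<And>i. i < length as \<Longrightarrow> ms ! i \<in> carrier (mgrp (hat_mod P) (as ! i))"
      "\<And>i. i < length as \<Longrightarrow> \<psi> (as ! i) (ms ! i) = \<one>\<^bsub>mgrp M (as ! i)\<^esub>"
      by (simp_all add: in_listset_map kernel_def)
    have "map2 \<psi> as ms = map (\<lambda>a. \<one>\<^bsub>mgrp M a\<^esub>) as"
      using ms by (intro nth_equalityI) auto
    then have "\<psi> (opr A f as) (mop (hat_mod P) f as ms) = \<one>\<^bsub>mgrp M (opr A f as)\<^esub>"
      using module_hom_mop[OF \<psi>(1) f as ms(1,2)] mop_one[OF M A f as] by simp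
    then show "mop (hat_mod P) f as ms \<in> ?N (opr A f as)"
      using mop_closed[OF hat f as ms(1,2)] by (simp add: kernel_def)
  qed
  moreover have "frag_of (pbase P a) \<in> ?N a" if a: "a \<in> carrier A" for a
    using is_pover_base[OF P a] \<psi>(2)[OF a] pover_hom_closed(2)[OF \<phi> a]
    by (simp add: kernel_def forget_def)
  moreover have "frag_of (pop P f as ps) - (\<Sum>i<length as. hat_op P f as i (frag_of (ps ! i))) \<in> ?N (opr A f as)"
    if f: "f \<in> Om (length as)" and as: "set as \<subseteq> carrier A" and "ps \<in> listset (map (pset P) as)"
    for f as ps
  proof -
    have ps: "length ps = length as" "\<And>i. i < length as \<Longrightarrow> ps ! i \<in> pset P (as ! i)"
      using that by (simp_all add: in_listset_map)
    let ?b = "opr A f as" and ?ms = "map frag_of ps"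
    have b: "?b \<in> carrier A" by (rule is_algebra_opr[OF A f as])
    interpret h: group_hom "mgrp (hat_mod P) ?b" "mgrp M ?b" "\<psi> ?b" by (rule h[OF b])
    have s: "(\<Sum>i<length as. hat_op P f as i (frag_of (ps ! i))) = mop (hat_mod P) f as ?ms"
      using ps(1) by (simp add: hat_mod_def)
    have ms: "length ?ms = length as" "\<And>i. i < length as \<Longrightarrow> ?ms ! i \<in> carrier (mgrp (hat_mod P) (as ! i))"
      using ps by simp_all
    have c: "frag_of (pop P f as ps) \<in> carrier (mgrp (hat_mod P) ?b)"
      "mop (hat_mod P) f as ?ms \<in> carrier (mgrp (hat_mod P) ?b)"
      using pop_closed[OF P f as ps] mop_closed[OF hat f as ms] by simp_all
    have "map2 \<psi> as ?ms = map2 \<phi> as ps"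
      using ps \<psi>(2)[OF subsetD[OF as nth_mem]] by (intro nth_equalityI) auto
    then have eq: "\<psi> ?b (frag_of (pop P f as ps)) = \<psi> ?b (mop (hat_mod P) f as ?ms)"
      using module_hom_mop[OF \<psi>(1) f as ms] \<psi>(2)[OF b pop_closed[OF P f as ps]]
        pover_hom_pop[OF \<phi> f as ps] by (simp add: forget_def)
    \<comment> \<open>The difference of formal sums is rewritten in the language of the group, so
      that the rules for the homomorphism \<open>\<psi> ?b\<close> apply to it.\<close>
    have d: "frag_of (pop P f as ps) - mop (hat_mod P) f as ?ms =
        frag_of (pop P f as ps) \<otimes>\<^bsub>mgrp (hat_mod P) ?b\<^esub> inv\<^bsub>mgrp (hat_mod P) ?b\<^esub> mop (hat_mod P) f as ?ms"
      using c(2) by simp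
    show ?thesis
      unfolding s d kernel_def using c eq by (simp del: mgrp_hat_mod)
  qed
  ultimately have "modulize_gens Om A P ?N" by (simp add: modulize_gens_def)
  then have "modulize_ker Om A P a \<subseteq> ?N a" for a by (auto simp: modulize_ker_eq)
  then have "\<psi> a n = \<one>\<^bsub>mgrp M a\<^esub>" if "a \<in> carrier A" "n \<in> modulize_ker Om A P a" for a n
    using that(2) by (auto simp: kernel_def)
  then obtain \<theta> where \<theta>: "\<theta> \<in> module_hom Om A (modulize Om A P) M"
    "\<And>a m. a \<in> carrier A \<Longrightarrow> m \<in> carrier (mgrp (hat_mod P) a) \<Longrightarrow>
      \<theta> a (modulize_ker Om A P a #>\<^bsub>mgrp (hat_mod P) a\<^esub> m) = \<psi> a m"
    unfolding modulize_def
    using quot_mod_universal[OF hat A modulize_ker_submodule[OF P A] M \<psi>(1)] by blast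
  show thesis
    by (rule that[OF \<theta>(1)]) (use \<theta>(2) \<psi>(2) in \<open>simp add: modulize_unit_def\<close>)
qed

lemma modulize_hom_unique:
  assumes P: "is_pover Om A P" and A: "is_algebra Om A" and M: "is_module Om A M"
    and \<theta>: "\<theta> \<in> module_hom Om A (modulize Om A P) M" "\<theta>' \<in> module_hom Om A (modulize Om A P) M"
    and eq: "\<And>a p. a \<in> carrier A \<Longrightarrow> p \<in> pset P a \<Longrightarrow>
      \<theta> a (modulize_unit Om A P a p) = \<theta>' a (modulize_unit Om A P a p)"
    and a: "a \<in> carrier A" and z: "z \<in> carrier (mgrp (modulize Om A P) a)"
  shows "\<theta> a z = \<theta>' a z"
proof (rule hom_agree_generate[where G = "mgrp (modulize Om A P) a" and H = "mgrp M a"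
      and S = "modulize_unit Om A P a ` pset P a"])
  show "z \<in> generate (mgrp (modulize Om A P) a) (modulize_unit Om A P a ` pset P a)"
    using modulize_generated[OF P A a] z by blast
qed (use is_module_group(2)[OF M a] is_module_group(2)[OF modulize_module[OF P A] a]
    module_hom_hom[OF \<theta>(1) a] module_hom_hom[OF \<theta>(2) a] modulize_unit_closed[OF P A a] eq[OF a] in auto)

section \<open>Total algebras and varieties\<close>

lemma alg_hom_comp:
  assumes "h \<in> alg_hom Om B C" "k \<in> alg_hom Om C D"
  shows "(\<lambda>u. k (h u)) \<in> alg_hom Om B D"
  unfolding alg_hom_def
proof (intro CollectI conjI allI impI)
  show "(\<lambda>u. k (h u)) \<in> carrier B \<rightarrow> carrier D" using assms by (auto simp: alg_hom_def)
  fix f us assume f: "f \<in> Om (length us)" and us: "set us \<subseteq> carrier B"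
  then have "set (map h us) \<subseteq> carrier C" using assms(1) by (auto simp: alg_hom_def)
  moreover have "h (opr B f us) = opr C f (map h us)" using assms(1) f us by (simp add: alg_hom_def)
  ultimately have "k (h (opr B f us)) = opr D f (map k (map h us))"
    using assms(2) f unfolding alg_hom_def by (metis (mono_tags, lifting) length_map mem_Collect_eq)
  then show "k (h (opr B f us)) = opr D f (map (\<lambda>u. k (h u)) us)" by (simp add: comp_def)
qed

lemma trm_val_hom:
  assumes B: "is_algebra Om B" and h: "h \<in> alg_hom Om B C" and \<sigma>: "\<And>v. v \<in> X \<Longrightarrow> \<sigma> v \<in> carrier B"
    and t: "t \<in> trms Om X"
  shows "trm_val C (\<lambda>v. h (\<sigma> v)) t = h (trm_val B \<sigma> t)"
  using t
proof induction
  case (App f ts)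
  have "set (map (trm_val B \<sigma>) ts) \<subseteq> carrier B"
    using App(2) trm_val_closed[OF B, of X \<sigma>] \<sigma> by auto
  then have "h (opr B f (map (trm_val B \<sigma>) ts)) = opr C f (map h (map (trm_val B \<sigma>) ts))"
    using h App(1) unfolding alg_hom_def by (metis (mono_tags, lifting) length_map mem_Collect_eq)
  moreover have "map h (map (trm_val B \<sigma>) ts) = map (trm_val C (\<lambda>v. h (\<sigma> v))) ts"
    using App(2) by auto
  ultimately show ?case by (simp del: map_map)
qed simp

lemma trm_val_cong:
  "(\<And>v. v \<in> set2_trm t \<Longrightarrow> \<sigma> v = \<tau> v) \<Longrightarrow> trm_val A \<sigma> t = trm_val A \<tau> t"
proof (induction t)
  case (App f ts)
  have "map (trm_val A \<sigma>) ts = map (trm_val A \<tau>) ts"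
    by (rule map_cong[OF HOL.refl]) (use App in auto)
  then show ?case by (simp only: trm_val.simps)
qed simp

lemma in_varietyD:
  assumes "in_variety Om E A" "(l, r) \<in> E" "\<And>v. \<sigma> v \<in> carrier A"
  shows "trm_val A \<sigma> l = trm_val A \<sigma> r"
proof -
  have "range \<sigma> \<subseteq> carrier A" using assms(3) by auto
  then show ?thesis using assms(1,2) by (auto simp: in_variety_def)
qed

lemma finite_set2_trm: "finite (set2_trm t)"
  by (induction t) auto

section \<open>Total algebras and the homomorphisms into and out of them\<close>

lemma carrier_total_alg: "x \<in> carrier (total_alg A P) \<longleftrightarrow> fst x \<in> carrier A \<and> snd x \<in> pset P (fst x)"
  by (cases x) (simp add: total_alg_def)

lemma opr_total_alg:
  "opr (total_alg A P) f xs = (opr A f (map fst xs), pop P f (map fst xs) (map snd xs))"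
  by (simp add: total_alg_def)

lemma total_alg_algebra:
  assumes P: "is_pover Om A P" and A: "is_algebra Om A"
  shows "is_algebra Om (total_alg A P)"
  unfolding is_algebra_def
proof (intro allI impI)
  fix f xs assume f: "f \<in> Om (length xs)" and xs: "set xs \<subseteq> carrier (total_alg A P)"
  then have as: "set (map fst xs) \<subseteq> carrier A" by (auto simp: carrier_total_alg)
  have "snd (xs ! i) \<in> pset P (fst (xs ! i))" if "i < length xs" for i
    using subsetD[OF xs nth_mem[OF that]] by (simp add: carrier_total_alg)
  then show "opr (total_alg A P) f xs \<in> carrier (total_alg A P)"
    using is_algebra_opr[OF A _ as] pop_closed[OF P _ as, of f "map snd xs"] f
    by (simp add: carrier_total_alg opr_total_alg)
qed

lemma fst_total_alg: "fst \<in> alg_hom Om (total_alg A P) A"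
  by (auto simp: alg_hom_def total_alg_def)

lemma total_alg_map:
  assumes \<phi>: "\<phi> \<in> pover_hom Om A P Q"
  shows "(\<lambda>x. (fst x, \<phi> (fst x) (snd x))) \<in> alg_hom Om (total_alg A P) (total_alg A Q)"
  unfolding alg_hom_def
proof (intro CollectI conjI allI impI)
  show "(\<lambda>x. (fst x, \<phi> (fst x) (snd x))) \<in> carrier (total_alg A P) \<rightarrow> carrier (total_alg A Q)"
    using pover_hom_closed(1)[OF \<phi>] by (auto simp: carrier_total_alg)
  fix f xs assume f: "f \<in> Om (length xs)" and xs: "set xs \<subseteq> carrier (total_alg A P)"
  then have as: "set (map fst xs) \<subseteq> carrier A" by (auto simp: carrier_total_alg)
  have "snd (xs ! i) \<in> pset P (fst (xs ! i))" if "i < length xs" for i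
    using subsetD[OF xs nth_mem[OF that]] by (simp add: carrier_total_alg)
  then have "\<phi> (opr A f (map fst xs)) (pop P f (map fst xs) (map snd xs))
      = pop Q f (map fst xs) (map2 \<phi> (map fst xs) (map snd xs))"
    using pover_hom_pop[OF \<phi> _ as, of f "map snd xs"] f by simp
  also have "map2 \<phi> (map fst xs) (map snd xs) = map (\<lambda>x. \<phi> (fst x) (snd x)) xs"
    by (intro nth_equalityI) (auto simp: case_prod_beta)
  finally show "(fst (opr (total_alg A P) f xs),
      \<phi> (fst (opr (total_alg A P) f xs)) (snd (opr (total_alg A P) f xs)))
    = opr (total_alg A Q) f (map (\<lambda>x. (fst x, \<phi> (fst x) (snd x))) xs)"
    by (simp add: opr_total_alg comp_def)
qed

text \<open>The section of the projection to \<open>A\<close> through the basepoints. It supplies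
  the images of the constants when a homomorphism from the polynomial algebra to
  \<open>total_alg A P\<close> is built.\<close>

lemma pbase_total_hom:
  assumes "is_pover Om A P"
  shows "(\<lambda>a. (a, pbase P a)) \<in> alg_hom Om A (total_alg A P)"
  using assms by (auto simp: alg_hom_def is_pover_def total_alg_def comp_def)

section \<open>Linearity of terms, and identities in the modulization\<close>

lemma trm_val_total:
  assumes "is_pover Om A P" "is_algebra Om A" "\<And>v. v \<in> X \<Longrightarrow> \<alpha> v \<in> carrier A"
    and "\<And>v. v \<in> X \<Longrightarrow> x v \<in> pset P (\<alpha> v)" "t \<in> trms Om X"
  shows "fst (trm_val (total_alg A P) (\<lambda>v. (\<alpha> v, x v)) t) = trm_val A \<alpha> t"
    and "snd (trm_val (total_alg A P) (\<lambda>v. (\<alpha> v, x v)) t) \<in> pset P (trm_val A \<alpha> t)"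
proof -
  have "trm_val (total_alg A P) (\<lambda>v. (\<alpha> v, x v)) t \<in> carrier (total_alg A P)"
    by (rule trm_val_closed[OF total_alg_algebra[OF assms(1,2)] _ assms(5)])
      (use assms(3,4) in \<open>simp add: carrier_total_alg\<close>)
  moreover show "fst (trm_val (total_alg A P) (\<lambda>v. (\<alpha> v, x v)) t) = trm_val A \<alpha> t"
    using trm_val_hom[OF total_alg_algebra[OF assms(1,2)] fst_total_alg _ assms(5), of "\<lambda>v. (\<alpha> v, x v)"]
      assms(3,4) by (simp add: carrier_total_alg)
  ultimately show "snd (trm_val (total_alg A P) (\<lambda>v. (\<alpha> v, x v)) t) \<in> pset P (trm_val A \<alpha> t)"
    by (simp add: carrier_total_alg)
qed

text \<open>With the base assignment \<alpha> held fixed, a term is a composite of operations that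
  are homomorphisms on products, so its fibre component is additive in all fibre variables
  jointly.\<close>

lemma trm_val_total_mult:
  fixes A :: "('f, 'a) alg" and M :: "('f, 'a, 'm) amod"
  defines "T \<equiv> total_alg A (forget M)"
  assumes M: "is_module Om A M" and A: "is_algebra Om A" and \<alpha>: "\<And>v. v \<in> X \<Longrightarrow> \<alpha> v \<in> carrier A"
    and x: "\<And>v. v \<in> X \<Longrightarrow> x v \<in> carrier (mgrp M (\<alpha> v))"
    and y: "\<And>v. v \<in> X \<Longrightarrow> y v \<in> carrier (mgrp M (\<alpha> v))" and t: "t \<in> trms Om X"
  shows "snd (trm_val T (\<lambda>v. (\<alpha> v, x v \<otimes>\<^bsub>mgrp M (\<alpha> v)\<^esub> y v)) t)
    = snd (trm_val T (\<lambda>v. (\<alpha> v, x v)) t) \<otimes>\<^bsub>mgrp M (trm_val A \<alpha> t)\<^esub> snd (trm_val T (\<lambda>v. (\<alpha> v, y v)) t)"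
  using t
proof induction
  case (App f ts)
  let ?xy = "\<lambda>v. x v \<otimes>\<^bsub>mgrp M (\<alpha> v)\<^esub> y v" and ?as = "map (trm_val A \<alpha>) ts"
  let ?w = "\<lambda>z. trm_val T (\<lambda>v. (\<alpha> v, z v))"
  have P: "is_pover Om A (forget M)" by (rule forget_pover[OF M A])
  have xy: "?xy v \<in> carrier (mgrp M (\<alpha> v))" if "v \<in> X" for v
    using x[OF that] y[OF that] is_module_group(2)[OF M \<alpha>[OF that]]
    by (simp add: group.is_monoid monoid.m_closed)
  have as: "set ?as \<subseteq> carrier A" using App(2) trm_val_closed[OF A, of X \<alpha>] \<alpha> by auto
  \<comment> \<open>The base component does not depend on the fibre assignment. So the subterm
    values for \<open>x\<close>, for \<open>y\<close> and for their product lie over the same index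
    list \<open>?as\<close>, where \<open>mop_mult\<close> can combine them.\<close>
  have fst_w: "fst (?w z t) = trm_val A \<alpha> t" "snd (?w z t) \<in> carrier (mgrp M (trm_val A \<alpha> t))"
    if "\<And>v. v \<in> X \<Longrightarrow> z v \<in> carrier (mgrp M (\<alpha> v))" "t \<in> trms Om X" for z t
    using trm_val_total[OF P A \<alpha> _ that(2), where x = z] that(1) by (simp_all add: T_def forget_def)
  have step: "snd (?w z (App f ts)) = mop M f ?as (map (snd \<circ> ?w z) ts)"
    if "\<And>v. v \<in> X \<Longrightarrow> z v \<in> carrier (mgrp M (\<alpha> v))" for z
  proof -
    have "map (fst \<circ> ?w z) ts = ?as" using App(2) fst_w(1)[OF that] by auto
    moreover have "snd (?w z (App f ts)) = mop M f (map (fst \<circ> ?w z) ts) (map (snd \<circ> ?w z) ts)"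
      by (simp add: T_def opr_total_alg forget_def comp_def)
    ultimately show ?thesis by (simp only:)
  qed
  have ts: "ts ! i \<in> trms Om X" if "i < length ts" for i using App(2) that by auto
  have eq: "map (snd \<circ> ?w ?xy) ts = map (\<lambda>i. map (snd \<circ> ?w x) ts ! i
      \<otimes>\<^bsub>mgrp M (?as ! i)\<^esub> map (snd \<circ> ?w y) ts ! i) [0..<length ?as]"
    using App(2) by (intro nth_equalityI) auto
  have "mop M f ?as (map (snd \<circ> ?w ?xy) ts) = mop M f ?as (map (snd \<circ> ?w x) ts)
      \<otimes>\<^bsub>mgrp M (opr A f ?as)\<^esub> mop M f ?as (map (snd \<circ> ?w y) ts)"
    unfolding eq
    by (rule mop_mult[OF M _ as]) (use App(1) ts fst_w(2)[OF x] fst_w(2)[OF y] in simp_all)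
  then show ?case using step[OF xy] step[OF x] step[OF y] by simp
qed simp

text \<open>On base components an identity holds because it holds in \<open>A\<close>. On fibre
  components its two sides are additive maps into the same group, and \<open>additive_agree\<close>
  reduces it to an identity already valid in \<open>total_alg A P\<close>.\<close>

lemma modulize_in_variety:
  assumes I: "is_identities Om E" and VA: "in_variety Om E A" and P: "is_pover Om A P"
    and V: "in_variety Om E (total_alg A P)"
  shows "module_in Om E A (modulize Om A P)"
proof -
  have A: "is_algebra Om A" using VA by (simp add: in_variety_def)
  let ?M = "modulize Om A P" and ?\<eta> = "modulize_unit Om A P"
  let ?T = "total_alg A (forget ?M)"
  have M: "is_module Om A ?M" by (rule modulize_module[OF P A])
  have PM: "is_pover Om A (forget ?M)" by (rule forget_pover[OF M A])
  have \<eta>: "?\<eta> \<in> pover_hom Om A P (forget ?M)" by (rule modulize_unit_hom[OF P A])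
  have "trm_val ?T \<sigma> l = trm_val ?T \<sigma> r"
    if lr: "(l, r) \<in> E" and \<sigma>: "range \<sigma> \<subseteq> carrier ?T" for l r and \<sigma> :: "nat \<Rightarrow> _"
  proof -
    define \<alpha> where "\<alpha> = fst \<circ> \<sigma>"
    \<comment> \<open>Fibre entries at variables outside the identity are reset to zero, which gives
      the tuple finite support. By \<open>trm_val_cong\<close> the values of \<open>l\<close> and
      \<open>r\<close> do not notice.\<close>
    define x where "x = (\<lambda>v. if v \<in> set2_trm l \<union> set2_trm r then snd (\<sigma> v) else \<one>\<^bsub>mgrp ?M (\<alpha> v)\<^esub>)"
    let ?w = "\<lambda>z. trm_val ?T (\<lambda>v. (\<alpha> v, z v))" and ?b = "trm_val A \<alpha> l"
    have t: "l \<in> trms Om UNIV" "r \<in> trms Om UNIV" using I lr by (auto simp: is_identities_def)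
    have "\<sigma> v \<in> carrier ?T" for v using \<sigma> by auto
    then have \<sigma>v: "fst (\<sigma> v) \<in> carrier A" "snd (\<sigma> v) \<in> carrier (mgrp ?M (fst (\<sigma> v)))" for v
      by (auto simp: carrier_total_alg forget_def)
    then have \<alpha>: "\<alpha> v \<in> carrier A" for v by (simp add: \<alpha>_def)
    have b: "?b \<in> carrier A" "trm_val A \<alpha> r = ?b"
      using trm_val_closed[OF A, of UNIV \<alpha> l] \<alpha> t(1) in_varietyD[OF VA lr \<alpha>] by simp_all
    have g: "group (mgrp ?M (\<alpha> v))" for v by (rule is_module_group(2)[OF M \<alpha>])
    have xc: "x v \<in> carrier (mgrp ?M (\<alpha> v))" for v
      using \<sigma>v(2) group.is_monoid[OF g] by (simp add: x_def \<alpha>_def)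
    have w: "fst (?w z s) = trm_val A \<alpha> s" "snd (?w z s) \<in> carrier (mgrp ?M (trm_val A \<alpha> s))"
      if "\<And>v. z v \<in> carrier (mgrp ?M (\<alpha> v))" "s \<in> trms Om UNIV" for z s
      using trm_val_total[OF PM A, of UNIV \<alpha> z s] \<alpha> that by (simp_all add: forget_def)
    have "snd (?w x l) = snd (?w x r)"
    proof (rule additive_agree[where G = "\<lambda>v. mgrp ?M (\<alpha> v)" and H = "mgrp ?M ?b"
          and S = "\<lambda>v. ?\<eta> (\<alpha> v) ` pset P (\<alpha> v)" and J = "set2_trm l \<union> set2_trm r"
          and F = "\<lambda>z. snd (?w z l)" and K = "\<lambda>z. snd (?w z r)"])
      show "group (mgrp ?M ?b)" by (rule is_module_group(2)[OF M b(1)])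
      show "snd (?w z l) \<in> carrier (mgrp ?M ?b)" "snd (?w z r) \<in> carrier (mgrp ?M ?b)"
        if "\<And>v. z v \<in> carrier (mgrp ?M (\<alpha> v))" for z
        using w(2)[OF that t(1)] w(2)[OF that t(2)] b(2) by simp_all
      fix y z
      assume "\<And>v. y v \<in> carrier (mgrp ?M (\<alpha> v))" "\<And>v. z v \<in> carrier (mgrp ?M (\<alpha> v))"
      then have "snd (?w (\<lambda>v. y v \<otimes>\<^bsub>mgrp ?M (\<alpha> v)\<^esub> z v) s)
          = snd (?w y s) \<otimes>\<^bsub>mgrp ?M (trm_val A \<alpha> s)\<^esub> snd (?w z s)" if "s \<in> trms Om UNIV" for s
        by (intro trm_val_total_mult[OF M A \<alpha> _ _ that])
      from this[OF t(1)] this[OF t(2)]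
      show "snd (?w (\<lambda>v. y v \<otimes>\<^bsub>mgrp ?M (\<alpha> v)\<^esub> z v) l) = snd (?w y l) \<otimes>\<^bsub>mgrp ?M ?b\<^esub> snd (?w z l)"
        "snd (?w (\<lambda>v. y v \<otimes>\<^bsub>mgrp ?M (\<alpha> v)\<^esub> z v) r) = snd (?w y r) \<otimes>\<^bsub>mgrp ?M ?b\<^esub> snd (?w z r)"
        unfolding b(2) .
    next
      show "?\<eta> (\<alpha> v) ` pset P (\<alpha> v) \<subseteq> carrier (mgrp ?M (\<alpha> v))" for v
        using modulize_unit_closed[OF P A \<alpha>] by blast
      show "carrier (mgrp ?M (\<alpha> v)) \<subseteq> generate (mgrp ?M (\<alpha> v)) (?\<eta> (\<alpha> v) ` pset P (\<alpha> v))" for v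
        by (rule modulize_generated[OF P A \<alpha>])
      fix i s assume "s \<in> ?\<eta> (\<alpha> i) ` pset P (\<alpha> i)"
      then obtain p where p: "p \<in> pset P (\<alpha> i)" "s = ?\<eta> (\<alpha> i) p" by blast
      \<comment> \<open>The preimage over \<open>P\<close> of the tuple with the one entry
        \<open>s\<close>. The unit preserves basepoints, so \<open>total_alg_map\<close> carries the
        identity at \<open>?u\<close> to the one wanted.\<close>
      let ?u = "\<lambda>v. (\<alpha> v, ((\<lambda>v. pbase P (\<alpha> v))(i := p)) v)"
      have u: "?u v \<in> carrier (total_alg A P)" for v
        using p(1) \<alpha> is_pover_base[OF P \<alpha>] by (simp add: carrier_total_alg)
      have "trm_val (total_alg A P) ?u l = trm_val (total_alg A P) ?u r"
        by (rule in_varietyD[OF V lr u])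
      moreover have "(\<lambda>v. (\<alpha> v, ((\<lambda>v. \<one>\<^bsub>mgrp ?M (\<alpha> v)\<^esub>)(i := s)) v))
          = (\<lambda>v. (fst (?u v), ?\<eta> (fst (?u v)) (snd (?u v))))"
        using pover_hom_closed(2)[OF \<eta> \<alpha>] by (intro ext) (simp add: p(2) forget_def)
      ultimately show "snd (?w ((\<lambda>v. \<one>\<^bsub>mgrp ?M (\<alpha> v)\<^esub>)(i := s)) l)
          = snd (?w ((\<lambda>v. \<one>\<^bsub>mgrp ?M (\<alpha> v)\<^esub>)(i := s)) r)"
        using trm_val_hom[OF total_alg_algebra[OF P A] total_alg_map[OF \<eta>] u t(1)]
          trm_val_hom[OF total_alg_algebra[OF P A] total_alg_map[OF \<eta>] u t(2)] by simp
    next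
      show "x v \<in> carrier (mgrp ?M (\<alpha> v))" for v by (rule xc)
    qed (simp_all add: g x_def finite_set2_trm)
    moreover have "?w x s = trm_val ?T \<sigma> s" if "set2_trm s \<subseteq> set2_trm l \<union> set2_trm r" for s
      by (rule trm_val_cong) (use that in \<open>auto simp: x_def \<alpha>_def\<close>)
    then have "?w x l = trm_val ?T \<sigma> l" "?w x r = trm_val ?T \<sigma> r" by blast+
    moreover have "fst (?w x l) = fst (?w x r)" using w(1)[OF xc t(1)] w(1)[OF xc t(2)] b(2) by simp
    ultimately show ?thesis by (simp add: prod_eq_iff)
  qed
  then show ?thesis
    using M total_alg_algebra[OF PM A] by (auto simp: module_in_def in_variety_def)
qed

section \<open>Unary polynomials and the family Z\<close>

text \<open>Only the variety and \<open>A\<close> are fixed. The module remains a parameter of each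
  lemma, since the facts on multiplication come from instances at \<open>ZM c\<close>, whose element
  type differs from that of a general \<open>M\<close>.\<close>

locale pol_algebra =
  fixes Om :: "nat \<Rightarrow> 'f set" and E :: "(('f, nat) trm \<times> ('f, nat) trm) set" and A :: "('f, 'a) alg"
  assumes I: "is_identities Om E" and A: "in_variety Om E A"
begin

abbreviation "U \<equiv> Pol1 Om E A"
abbreviation "const \<equiv> pol_const Om E A"
abbreviation "x \<equiv> pol_x Om E A"
abbreviation "at u b \<equiv> pol_at Om E A u b"
abbreviation "Ub b \<equiv> pol_over Om E A b"
abbreviation "ZM b \<equiv> Zmod Om E A b"
abbreviation "cls b u \<equiv> Zcls Om E A b u"

lemma alg: "is_algebra Om A" "is_algebra Om (free_alg Om E {()})"
  using A free_alg_in_variety[OF I] by (auto simp: in_variety_def)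

lemma U_in: "in_variety Om E U" "is_algebra Om U"
  using coprod_in_variety[OF I alg] by (simp_all add: Pol1_def in_variety_def)

lemma const_hom: "const \<in> alg_hom Om A U"
  using coprod_insertion(1)[OF I alg] by (simp add: Pol1_def pol_const_def)

lemma const_closed: "a \<in> carrier A \<Longrightarrow> const a \<in> carrier U"
  using const_hom by (auto simp: alg_hom_def)

lemma x_closed: "x \<in> carrier U"
  using coprod_insertion(2)[OF I alg] free_gen_closed[of "()" "{()}" Om E]
  by (auto simp: Pol1_def pol_x_def alg_hom_def)

lemma id_hom: "(\<lambda>a. a) \<in> alg_hom Om A A" by (simp add: alg_hom_def)

lemma pol_hom:
  assumes "in_variety Om E B" "g \<in> alg_hom Om A B" "y \<in> carrier B"
  shows "pol_hom Om E A B g y \<in> alg_hom Om U B"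
    and "\<And>a. a \<in> carrier A \<Longrightarrow> pol_hom Om E A B g y (const a) = g a"
    and "pol_hom Om E A B g y x = y"
  using theI'[OF pol_hom_ex1[OF I A assms]] by (simp_all add: pol_hom_def)

text \<open>\<open>pol_hom_ex1\<close> gives uniqueness among extensional functions only. Arbitrary
  homomorphisms are first restricted to \<open>carrier U\<close>, which leaves them
  homomorphisms.\<close>

lemma pol_hom_unique:
  assumes B: "in_variety Om E B" and g: "g \<in> alg_hom Om A B"
    and h: "h \<in> alg_hom Om U B" "\<And>a. a \<in> carrier A \<Longrightarrow> h (const a) = g a"
    and k: "k \<in> alg_hom Om U B" "\<And>a. a \<in> carrier A \<Longrightarrow> k (const a) = g a"
    and eq: "h x = k x" and u: "u \<in> carrier U"
  shows "h u = k u"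
proof -
  have res: "restrict j (carrier U) \<in> alg_hom Om U B" if j: "j \<in> alg_hom Om U B" for j
    unfolding alg_hom_def
  proof (intro CollectI conjI allI impI)
    show "restrict j (carrier U) \<in> carrier U \<rightarrow> carrier B" using j by (auto simp: alg_hom_def)
    fix f us assume f: "f \<in> Om (length us)" and us: "set us \<subseteq> carrier U"
    have eq: "map (restrict j (carrier U)) us = map j us" using us by auto
    show "restrict j (carrier U) (opr U f us) = opr B f (map (restrict j (carrier U)) us)"
      unfolding eq using j f us is_algebra_opr[OF U_in(2) f us] by (simp add: alg_hom_def)
  qed
  have "h x \<in> carrier B" using h(1) x_closed by (auto simp: alg_hom_def)
  from pol_hom_ex1[OF I A B g this] obtain j
    where j: "\<And>l. l \<in> alg_hom Om U B \<and> l \<in> extensional (carrier U) \<and>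
      (\<forall>a\<in>carrier A. l (const a) = g a) \<and> l x = h x \<Longrightarrow> l = j" by blast
  have "restrict h (carrier U) = j" "restrict k (carrier U) = j"
    using res[OF h(1)] res[OF k(1)] h(2) k(2) eq const_closed x_closed by (intro j, simp)+
  then have "restrict h (carrier U) = restrict k (carrier U)" by simp
  from fun_cong[OF this, of u] show ?thesis using u by simp
qed

lemma at_hom:
  assumes "b \<in> carrier A"
  shows "(\<lambda>u. at u b) \<in> alg_hom Om U A"
    and "\<And>a. a \<in> carrier A \<Longrightarrow> at (const a) b = a"
    and "at x b = b"
  using pol_hom[OF A id_hom assms] by (simp_all add: pol_at_def)

lemma at_closed: "b \<in> carrier A \<Longrightarrow> u \<in> carrier U \<Longrightarrow> at u b \<in> carrier A"
  using at_hom(1)[of b] by (auto simp: alg_hom_def)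

lemma comp_hom:
  assumes "u \<in> carrier U"
  shows "(\<lambda>v. pol_comp Om E A v u) \<in> alg_hom Om U U"
    and "\<And>a. a \<in> carrier A \<Longrightarrow> pol_comp Om E A (const a) u = const a"
    and "pol_comp Om E A x u = u"
  using pol_hom[OF U_in(1) const_hom assms] by (simp_all add: pol_comp_def)

lemma comp_closed: "u \<in> carrier U \<Longrightarrow> v \<in> carrier U \<Longrightarrow> pol_comp Om E A v u \<in> carrier U"
  using comp_hom(1)[of u] by (auto simp: alg_hom_def)

text \<open>As functions of \<open>v\<close> both sides are homomorphisms from \<open>U\<close> to
  \<open>A\<close> that fix the constants and send \<open>x\<close> to
  \<open>at u b\<close>.\<close>

lemma at_comp:
  assumes b: "b \<in> carrier A" and u: "u \<in> carrier U" and v: "v \<in> carrier U"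
  shows "at (pol_comp Om E A v u) b = at v (at u b)"
  by (rule pol_hom_unique[OF A id_hom, where h = "\<lambda>v. at (pol_comp Om E A v u) b" and k = "\<lambda>v. at v (at u b)"])
    (use alg_hom_comp[OF comp_hom(1)[OF u] at_hom(1)[OF b]] at_hom[OF b] at_hom[OF at_closed[OF b u]]
      comp_hom[OF u] v in auto)

section \<open>The overalgebra of polynomials over \<open>b\<close> and its freeness\<close>

lemma Ub_simps: "pset (Ub b) a = {u \<in> carrier U. at u b = a}" "pbase (Ub b) = const" "pop (Ub b) f as us = opr U f us"
  by (simp_all add: pol_over_def)

lemma Ub_pover: "b \<in> carrier A \<Longrightarrow> is_pover Om A (Ub b)"
  by (rule pol_over_is_pover[OF I A])

lemma Ub_tuple:
  assumes "length ps = length as" "\<And>i. i < length as \<Longrightarrow> ps ! i \<in> pset (Ub b) (as ! i)"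
  shows "set ps \<subseteq> carrier U" "map (\<lambda>u. at u b) ps = as"
  using assms by (auto simp: Ub_simps in_set_conv_nth intro: nth_equalityI)

text \<open>An element of the total algebra is a pair of an element of \<open>A\<close> and a
  polynomial, and both projections are homomorphisms. An identity is therefore checked separately in
  \<open>A\<close> and in \<open>U\<close>.\<close>

lemma Ub_total: 
  assumes b: "b \<in> carrier A"
  shows "in_variety Om E (total_alg A (Ub b))"
proof -
  let ?T = "total_alg A (Ub b)"
  have T: "is_algebra Om ?T" by (rule total_alg_algebra[OF Ub_pover[OF b] alg(1)])
  have snd: "snd \<in> alg_hom Om ?T U"
    by (auto simp: alg_hom_def carrier_total_alg opr_total_alg Ub_simps)
  have "trm_val ?T \<sigma> l = trm_val ?T \<sigma> r"
    if lr: "(l, r) \<in> E" and \<sigma>: "range \<sigma> \<subseteq> carrier ?T" for l r and \<sigma> :: "nat \<Rightarrow> _"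
  proof (rule prod_eqI)
    have t: "l \<in> trms Om UNIV" "r \<in> trms Om UNIV" using I lr by (auto simp: is_identities_def)
    have \<sigma>c: "\<sigma> v \<in> carrier ?T" for v using \<sigma> by auto
    have "fst (\<sigma> v) \<in> carrier A" "snd (\<sigma> v) \<in> carrier U" for v
      using \<sigma>c[of v] by (simp_all add: carrier_total_alg Ub_simps)
    note eq = in_varietyD[OF A lr this(1)] in_varietyD[OF U_in(1) lr this(2)]
    show "fst (trm_val ?T \<sigma> l) = fst (trm_val ?T \<sigma> r)"
      using eq(1) trm_val_hom[OF T fst_total_alg \<sigma>c t(1)]
        trm_val_hom[OF T fst_total_alg \<sigma>c t(2)] by simp
    show "snd (trm_val ?T \<sigma> l) = snd (trm_val ?T \<sigma> r)"
      using eq(2) trm_val_hom[OF T snd \<sigma>c t(1)] trm_val_hom[OF T snd \<sigma>c t(2)] by simp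
  qed
  with T show ?thesis by (auto simp: in_variety_def)
qed

text \<open>The homomorphism \<open>?h\<close> from \<open>U\<close> to the total algebra sends
  constants to basepoints and \<open>x\<close> to \<open>(b, p)\<close>. Its first component is
  evaluation at \<open>b\<close> by uniqueness, so its second component maps each fibre of that
  evaluation into the matching fibre of \<open>P\<close>.\<close>

lemma Ub_hom_ex:
  assumes P: "is_pover Om A P" and V: "in_variety Om E (total_alg A P)"
    and b: "b \<in> carrier A" and p: "p \<in> pset P b"
  obtains \<psi> where "\<psi> \<in> pover_hom Om A (Ub b) P" "\<psi> b x = p"
proof -
  let ?T = "total_alg A P"
  have "(b, p) \<in> carrier ?T" using b p by (simp add: carrier_total_alg)
  note h = pol_hom[OF V pbase_total_hom[OF P] this]
  let ?h = "pol_hom Om E A ?T (\<lambda>a. (a, pbase P a)) (b, p)"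
  have fst_h: "fst (?h u) = at u b" if "u \<in> carrier U" for u
    by (rule pol_hom_unique[OF A id_hom, where h = "\<lambda>u. fst (?h u)" and k = "\<lambda>u. at u b"])
      (use alg_hom_comp[OF h(1) fst_total_alg] h(2,3) at_hom[OF b] that in auto)
  have h_c: "?h u \<in> carrier ?T" if "u \<in> carrier U" for u using h(1) that by (auto simp: alg_hom_def)
  have "(\<lambda>a u. snd (?h u)) \<in> pover_hom Om A (Ub b) P"
  proof (rule pover_homI)
    show "snd (?h u) \<in> pset P a" if "a \<in> carrier A" "u \<in> pset (Ub b) a" for a u
      using h_c[of u] fst_h[of u] that by (simp add: Ub_simps carrier_total_alg)
    show "snd (?h (pbase (Ub b) a)) = pbase P a" if "a \<in> carrier A" for a
      using h(2)[OF that] by (simp add: Ub_simps)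
    fix f as us
    assume f: "f \<in> Om (length as)" and as: "set as \<subseteq> carrier A" and l: "length us = length as"
      and "\<And>i. i < length as \<Longrightarrow> us ! i \<in> pset (Ub b) (as ! i)"
    with Ub_tuple[OF l] have us: "set us \<subseteq> carrier U" "map (\<lambda>u. at u b) us = as" by blast+
    have "?h (opr U f us) = opr ?T f (map ?h us)" using h(1) f l us(1) by (simp add: alg_hom_def)
    moreover have "map (fst \<circ> ?h) us = as" using fst_h subsetD[OF us(1)] by (subst us(2)[symmetric]) simp
    moreover have "map2 (\<lambda>a u. snd (?h u)) as us = map (snd \<circ> ?h) us"
      using l by (intro nth_equalityI) auto
    ultimately show "snd (?h (pop (Ub b) f as us)) = pop P f as (map2 (\<lambda>a u. snd (?h u)) as us)"
      by (simp add: Ub_simps opr_total_alg)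
  qed
  then show thesis by (rule that) (simp add: h(3))
qed

text \<open>The fibres of evaluation at \<open>b\<close> partition \<open>U\<close>, so a
  homomorphism of overalgebras glues to one algebra homomorphism from \<open>U\<close> to the total
  algebra, which is determined by its value at \<open>x\<close>. The index \<open>at u b\<close> is
  the only one whose fibre contains \<open>u\<close>.\<close>

lemma Ub_hom_unique:
  assumes P: "is_pover Om A P" and V: "in_variety Om E (total_alg A P)" and b: "b \<in> carrier A"
    and \<psi>: "\<psi> \<in> pover_hom Om A (Ub b) P" and \<psi>': "\<psi>' \<in> pover_hom Om A (Ub b) P"
    and eq: "\<psi> b x = \<psi>' b x" and u: "u \<in> carrier U"
  shows "\<psi> (at u b) u = \<psi>' (at u b) u"
proof -
  have hom: "(\<lambda>u. (at u b, \<phi> (at u b) u)) \<in> alg_hom Om U (total_alg A P)"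
    if \<phi>: "\<phi> \<in> pover_hom Om A (Ub b) P" for \<phi>
    unfolding alg_hom_def
  proof (intro CollectI conjI allI impI)
    show "(\<lambda>u. (at u b, \<phi> (at u b) u)) \<in> carrier U \<rightarrow> carrier (total_alg A P)"
    proof (rule funcsetI)
      fix u assume u: "u \<in> carrier U"
      then have "u \<in> pset (Ub b) (at u b)" by (simp add: Ub_simps)
      from pover_hom_closed(1)[OF \<phi> at_closed[OF b u] this]
      show "(at u b, \<phi> (at u b) u) \<in> carrier (total_alg A P)"
        using at_closed[OF b u] by (simp add: carrier_total_alg)
    qed
    fix f us assume f: "f \<in> Om (length us)" and us: "set us \<subseteq> carrier U"
    let ?as = "map (\<lambda>u. at u b) us"
    have as: "set ?as \<subseteq> carrier A" using at_closed[OF b subsetD[OF us]] by auto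
    have at: "at (opr U f us) b = opr A f ?as" using at_hom(1)[OF b] f us by (simp add: alg_hom_def)
    have c: "us ! i \<in> pset (Ub b) (?as ! i)" if "i < length ?as" for i
      using that subsetD[OF us nth_mem, of i] by (simp add: Ub_simps)
    have "\<phi> (opr A f ?as) (pop (Ub b) f ?as us) = pop P f ?as (map2 \<phi> ?as us)"
      by (rule pover_hom_pop[OF \<phi> _ as _ c]) (use f in simp_all)
    also have "map2 \<phi> ?as us = map (\<lambda>u. \<phi> (at u b) u) us" by (intro nth_equalityI) auto
    finally show "(at (opr U f us) b, \<phi> (at (opr U f us) b) (opr U f us))
      = opr (total_alg A P) f (map (\<lambda>u. (at u b, \<phi> (at u b) u)) us)"
      unfolding at by (simp add: opr_total_alg comp_def Ub_simps)
  qed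
  have c: "(at (const a) b, \<phi> (at (const a) b) (const a)) = (a, pbase P a)"
    if "\<phi> \<in> pover_hom Om A (Ub b) P" "a \<in> carrier A" for \<phi> a
    using pover_hom_closed(2)[OF that] at_hom(2)[OF b that(2)] by (simp add: Ub_simps)
  have "(at u b, \<psi> (at u b) u) = (at u b, \<psi>' (at u b) u)"
    by (rule pol_hom_unique[OF V pbase_total_hom[OF P] hom[OF \<psi>] c[OF \<psi>] hom[OF \<psi>'] c[OF \<psi>'] _ u])
      (simp_all add: at_hom(3)[OF b] eq)
  then show ?thesis by simp
qed

lemma pol_psi:
  assumes P: "is_pover Om A P" and V: "in_variety Om E (total_alg A P)"
    and b: "b \<in> carrier A" and p: "p \<in> pset P b"
  shows "pol_psi Om E A P b p \<in> pover_hom Om A (Ub b) P \<and> pol_psi Om E A P b p b x = p"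
proof -
  let ?C = "\<lambda>\<psi>. \<psi> \<in> pover_hom Om A (Ub b) P \<and>
     \<psi> \<in> (\<Pi>\<^sub>E a\<in>carrier A. extensional (pset (Ub b) a)) \<and> \<psi> b x = p"
  obtain \<psi> where \<psi>: "\<psi> \<in> pover_hom Om A (Ub b) P" "\<psi> b x = p"
    using Ub_hom_ex[OF P V b p] by blast
  define r where "r = (\<lambda>a\<in>carrier A. \<lambda>p\<in>pset (Ub b) a. \<psi> a p)"
  have xb: "x \<in> pset (Ub b) b" using at_hom(3)[OF b] x_closed by (simp add: Ub_simps)
  have r: "r \<in> pover_hom Om A (Ub b) P" "r \<in> (\<Pi>\<^sub>E a\<in>carrier A. extensional (pset (Ub b) a))" "r b x = p"
    using pover_hom_restrict[OF alg(1) Ub_pover[OF b] \<psi>(1)] \<psi>(2) b xb by (simp_all add: r_def)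
  have "\<exists>!\<psi>. ?C \<psi>"
  proof (rule ex1I[of _ r])
    fix \<phi> assume \<phi>: "?C \<phi>"
    show "\<phi> = r"
    proof (rule PiE_ext[OF _ r(2)])
      show "\<phi> \<in> (\<Pi>\<^sub>E a\<in>carrier A. extensional (pset (Ub b) a))" using \<phi> by simp
      fix a assume a: "a \<in> carrier A"
      show "\<phi> a = r a"
      proof (rule extensionalityI[of _ "pset (Ub b) a"])
        show "\<phi> a \<in> extensional (pset (Ub b) a)" using \<phi> a by (simp add: PiE_iff)
        show "r a \<in> extensional (pset (Ub b) a)" using r(2) a by (simp add: PiE_iff)
        fix u assume "u \<in> pset (Ub b) a"
        then have "u \<in> carrier U" "at u b = a" by (simp_all add: Ub_simps)
        then show "\<phi> a u = r a u"
          using Ub_hom_unique[OF P V b _ r(1), of \<phi> u] \<phi> r(3) by simp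
      qed
    qed
  qed (use r in simp)
  from theI'[OF this] show ?thesis by (simp add: pol_psi_def)
qed

section \<open>The modules \<open>ZM b\<close> and their freeness on the class of
  \<open>x\<close>\<close>

lemma Zmod_in: "c \<in> carrier A \<Longrightarrow> module_in Om E A (ZM c)"
  unfolding Zmod_def by (intro modulize_in_variety I A Ub_pover Ub_total)

lemma module_inD:
  assumes "module_in Om E A M"
  shows "is_module Om A M" "is_pover Om A (forget M)" "in_variety Om E (total_alg A (forget M))"
  using assms forget_pover alg(1) by (auto simp: module_in_def)

lemma cls_hom:
  assumes b: "b \<in> carrier A"
  shows "modulize_unit Om A (Ub b) \<in> pover_hom Om A (Ub b) (forget (ZM b))"
  unfolding Zmod_def by (rule modulize_unit_hom[OF Ub_pover[OF b] alg(1)])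

lemma cls_closed: "b \<in> carrier A \<Longrightarrow> u \<in> carrier U \<Longrightarrow> cls b u \<in> carrier (mgrp (ZM b) (at u b))"
  unfolding Zcls_def Zmod_def
  by (rule modulize_unit_closed) (auto simp: Ub_pover alg at_closed Ub_simps)

lemma cls_x: "b \<in> carrier A \<Longrightarrow> cls b x \<in> carrier (mgrp (ZM b) b)"
  using cls_closed[of b x] x_closed at_hom(3) by simp

text \<open>Two reductions: the classes of polynomials generate each group, and on these classes the
  maps are homomorphisms from the free overalgebra \<open>Ub b\<close>, determined by their value at
  \<open>x\<close>.\<close>

lemma Zmod_hom_unique:
  assumes b: "b \<in> carrier A" and M: "module_in Om E A M"
    and \<theta>: "\<theta> \<in> module_hom Om A (ZM b) M" and \<theta>': "\<theta>' \<in> module_hom Om A (ZM b) M"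
    and eq: "\<theta> b (cls b x) = \<theta>' b (cls b x)"
    and a: "a \<in> carrier A" and z: "z \<in> carrier (mgrp (ZM b) a)"
  shows "\<theta> a z = \<theta>' a z"
proof (rule modulize_hom_unique[OF Ub_pover[OF b] alg(1) module_inD(1)[OF M]])
  show "\<theta> \<in> module_hom Om A (modulize Om A (Ub b)) M" "\<theta>' \<in> module_hom Om A (modulize Om A (Ub b)) M"
    using \<theta> \<theta>' by (simp_all add: Zmod_def)
  show "a \<in> carrier A" "z \<in> carrier (mgrp (modulize Om A (Ub b)) a)" using a z by (simp_all add: Zmod_def)
  fix a u assume a: "a \<in> carrier A" and u: "u \<in> pset (Ub b) a"
  let ?\<eta> = "modulize_unit Om A (Ub b)"
  have Z: "is_module Om A (ZM b)" by (rule module_inD(1)[OF Zmod_in[OF b]])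
  note c = pover_hom_comp[OF cls_hom[OF b] module_hom_forget[OF Z module_inD(1)[OF M]]]
  have "\<theta> b (?\<eta> b x) = \<theta>' b (?\<eta> b x)" using eq at_hom(3)[OF b] by (simp add: Zcls_def)
  then have "\<theta> (at u b) (?\<eta> (at u b) u) = \<theta>' (at u b) (?\<eta> (at u b) u)"
    using Ub_hom_unique[OF module_inD(2,3)[OF M] b c[OF \<theta>] c[OF \<theta>'], of u] u by (simp add: Ub_simps)
  then show "\<theta> a (?\<eta> a u) = \<theta>' a (?\<eta> a u)" using u by (simp add: Ub_simps)
qed

text \<open>Freeness of \<open>Ub b\<close> turns \<open>m\<close> into a homomorphism of
  overalgebras, which extends along the unit; restriction to the carriers makes it the one that the
  definite description picks.\<close>

lemma Ztheta:
  assumes b: "b \<in> carrier A" and M: "module_in Om E A M" and m: "m \<in> carrier (mgrp M b)"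
  shows "Ztheta Om E A M b m \<in> module_hom Om A (ZM b) M" "Ztheta Om E A M b m b (cls b x) = m"
proof -
  let ?C = "\<lambda>\<theta>. \<theta> \<in> module_hom Om A (ZM b) M \<and>
     \<theta> \<in> (\<Pi>\<^sub>E a\<in>carrier A. extensional (carrier (mgrp (ZM b) a))) \<and> \<theta> b (cls b x) = m"
  have "m \<in> pset (forget M) b" using m by (simp add: forget_def)
  then obtain \<psi> where \<psi>: "\<psi> \<in> pover_hom Om A (Ub b) (forget M)" "\<psi> b x = m"
    using Ub_hom_ex[OF module_inD(2,3)[OF M] b] by blast
  obtain \<theta> where \<theta>: "\<theta> \<in> module_hom Om A (ZM b) M"
    "\<And>a u. a \<in> carrier A \<Longrightarrow> u \<in> pset (Ub b) a \<Longrightarrow> \<theta> a (modulize_unit Om A (Ub b) a u) = \<psi> a u"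
    using modulize_universal[OF Ub_pover[OF b] alg(1) module_inD(1)[OF M] \<psi>(1)]
    unfolding Zmod_def by blast
  have xm: "\<theta> b (cls b x) = m"
    using \<theta>(2)[OF b, of x] \<psi>(2) at_hom(3)[OF b] x_closed by (simp add: Zcls_def Ub_simps)
  define r where "r = (\<lambda>a\<in>carrier A. \<lambda>z\<in>carrier (mgrp (ZM b) a). \<theta> a z)"
  have r: "r \<in> module_hom Om A (ZM b) M"
    "r \<in> (\<Pi>\<^sub>E a\<in>carrier A. extensional (carrier (mgrp (ZM b) a)))" "r b (cls b x) = m"
    using module_hom_restrict[OF alg(1) module_inD(1)[OF Zmod_in[OF b]] \<theta>(1)] xm b cls_x[OF b]
    by (simp_all add: r_def)
  have "\<exists>!\<theta>. ?C \<theta>"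
  proof (rule ex1I[of _ r])
    fix \<phi> assume \<phi>: "?C \<phi>"
    show "\<phi> = r"
    proof (rule PiE_ext[OF _ r(2)])
      show "\<phi> \<in> (\<Pi>\<^sub>E a\<in>carrier A. extensional (carrier (mgrp (ZM b) a)))" using \<phi> by simp
      fix a assume a: "a \<in> carrier A"
      show "\<phi> a = r a"
      proof (rule extensionalityI[of _ "carrier (mgrp (ZM b) a)"])
        show "\<phi> a \<in> extensional (carrier (mgrp (ZM b) a))" using \<phi> a by (simp add: PiE_iff)
        show "r a \<in> extensional (carrier (mgrp (ZM b) a))" using r(2) a by (simp add: PiE_iff)
        show "\<phi> a z = r a z" if "z \<in> carrier (mgrp (ZM b) a)" for z
          using Zmod_hom_unique[OF b M _ r(1) _ a that, of \<phi>] \<phi> r(3) by simp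
      qed
    qed
  qed (use r in simp)
  from theI'[OF this]
  show "Ztheta Om E A M b m \<in> module_hom Om A (ZM b) M" "Ztheta Om E A M b m b (cls b x) = m"
    by (simp_all add: Ztheta_def Z_def)
qed

section \<open>The action of \<open>Z\<close> and the multiplication in \<open>Z\<close>\<close>

text \<open>The computation rule for the action: any homomorphism that sends the class of
  \<open>x\<close> to \<open>m\<close> may replace \<open>Ztheta\<close> in the evaluation of
  \<open>zm\<close>. Applying it comes down to naming that homomorphism.\<close>

lemma Zact_eqI:
  assumes "b \<in> carrier A" "module_in Om E A M" "\<theta> \<in> module_hom Om A (ZM b) M"
    and "a \<in> carrier A" "z \<in> carrier (Z Om E A a b)"
  shows "Zact Om E A M a b z (\<theta> b (cls b x)) = \<theta> a z"
proof -
  have m: "\<theta> b (cls b x) \<in> carrier (mgrp M b)"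
    using hom_in_carrier[OF module_hom_hom[OF assms(3,1)] cls_x[OF assms(1)]] .
  show ?thesis unfolding Zact_def
    by (rule Zmod_hom_unique[OF assms(1,2) Ztheta(1)[OF assms(1,2) m] assms(3) Ztheta(2)[OF assms(1,2) m] assms(4)])
      (use assms(5) in \<open>simp add: Z_def\<close>)
qed

lemma Zact_x:
  assumes "b \<in> carrier A" "module_in Om E A M" "m \<in> carrier (mgrp M b)"
  shows "Zact Om E A M b b (cls b x) m = m"
  unfolding Zact_def by (rule Ztheta(2)[OF assms])

lemma Zact_natural:
  assumes M: "module_in Om E A M" and M': "module_in Om E A M'" and \<phi>: "\<phi> \<in> module_hom Om A M M'"
    and a: "a \<in> carrier A" and b: "b \<in> carrier A" and z: "z \<in> carrier (Z Om E A a b)"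
    and m: "m \<in> carrier (mgrp M b)"
  shows "Zact Om E A M' a b z (\<phi> b m) = \<phi> a (Zact Om E A M a b z m)"
  using Zact_eqI[OF b M' module_hom_comp[OF Ztheta(1)[OF b M m] \<phi>] a z] Ztheta(2)[OF b M m]
  by (simp add: Zact_def)

lemma Zact_bilinear:
  assumes M: "module_in Om E A M" and a: "a \<in> carrier A" and b: "b \<in> carrier A"
  shows "bilinear_map (Z Om E A a b) (mgrp M b) (mgrp M a) (Zact Om E A M a b)"
  unfolding bilinear_map_def
proof (intro conjI ballI)
  show l: "(\<lambda>z. Zact Om E A M a b z m) \<in> hom (Z Om E A a b) (mgrp M a)" if "m \<in> carrier (mgrp M b)" for m
    using module_hom_hom[OF Ztheta(1)[OF b M that] a] by (simp add: Zact_def Z_def)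
  fix z assume z: "z \<in> carrier (Z Om E A a b)"
  show "Zact Om E A M a b z \<in> hom (mgrp M b) (mgrp M a)"
  proof (rule homI)
    show "Zact Om E A M a b z m \<in> carrier (mgrp M a)" if "m \<in> carrier (mgrp M b)" for m
      using hom_in_carrier[OF l[OF that] z] .
    fix m n assume m: "m \<in> carrier (mgrp M b)" and n: "n \<in> carrier (mgrp M b)"
    show "Zact Om E A M a b z (m \<otimes>\<^bsub>mgrp M b\<^esub> n)
        = Zact Om E A M a b z m \<otimes>\<^bsub>mgrp M a\<^esub> Zact Om E A M a b z n"
      \<comment> \<open>The pointwise sum of the homomorphisms belonging to \<open>m\<close> and to
        \<open>n\<close> sends the class of \<open>x\<close> to the sum of \<open>m\<close> and
        \<open>n\<close>.\<close>
      using Zact_eqI[OF b M module_hom_mult[OF module_inD(1)[OF M] alg(1)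
            Ztheta(1)[OF b M m] Ztheta(1)[OF b M n]] a z] Ztheta(2)[OF b M m] Ztheta(2)[OF b M n]
      by (simp add: Zact_def)
  qed
qed

lemma Zact_assoc:
  assumes M: "module_in Om E A M" and abc: "a \<in> carrier A" "b \<in> carrier A" "c \<in> carrier A"
    and z': "z' \<in> carrier (Z Om E A a b)" and z: "z \<in> carrier (Z Om E A b c)"
    and m: "m \<in> carrier (mgrp M c)"
  shows "Zact Om E A M a c (Zmult Om E A a b c z' z) m = Zact Om E A M a b z' (Zact Om E A M b c z m)"
  using Zact_natural[OF Zmod_in[OF abc(3)] M Ztheta(1)[OF abc(3) M m] abc(1,2) z', of z] z
  by (simp add: Zmult_def Zact_def Z_def)

lemma Zmult_x:
  assumes a: "a \<in> carrier A" and b: "b \<in> carrier A" and z: "z \<in> carrier (Z Om E A a b)"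
  shows "Zmult Om E A a b b z (cls b x) = z" "Zmult Om E A a a b (cls a x) z = z"
proof -
  \<comment> \<open>The homomorphism that belongs to the generator itself is the identity; this
    gives the right unit law. The left one is \<open>Zact_x\<close> for the module
    \<open>ZM b\<close>.\<close>
  have "(\<lambda>a z. z) \<in> module_hom Om A (ZM b) (ZM b)"
  proof (rule module_homI)
    fix as :: "'a list" and ms :: "('f, 'a) zel list" and f
    assume "length ms = length as"
    then have "map2 (\<lambda>a z. z) as ms = ms" by (intro nth_equalityI) auto
    then show "mop (ZM b) f as ms = mop (ZM b) f as (map2 (\<lambda>a z. z) as ms)" by simp
  qed (simp add: hom_def)
  from Zact_eqI[OF b Zmod_in[OF b] this a z]
  show "Zmult Om E A a b b z (cls b x) = z" by (simp add: Zmult_def)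
  show "Zmult Om E A a a b (cls a x) z = z"
    using Zact_x[OF a Zmod_in[OF b]] z by (simp add: Zmult_def Z_def)
qed

text \<open>Both sides evaluate at \<open>u\<close> a homomorphism from \<open>Ub b\<close> to
  \<open>forget M\<close> that sends \<open>x\<close> to \<open>m\<close>. The map \<psi> is left
  arbitrary: (5) needs it to be \<open>pol_psi\<close>, and (6) needs it to come from
  substitution.\<close>

lemma Zact_cls:
  assumes M: "module_in Om E A M" and b: "b \<in> carrier A" and m: "m \<in> carrier (mgrp M b)"
    and \<psi>: "\<psi> \<in> pover_hom Om A (Ub b) (forget M)" "\<psi> b x = m" and u: "u \<in> carrier U"
  shows "Zact Om E A M (at u b) b (cls b u) m = \<psi> (at u b) u"
proof -
  have Z: "is_module Om A (ZM b)" by (rule module_inD(1)[OF Zmod_in[OF b]])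
  note c = pover_hom_comp[OF cls_hom[OF b] module_hom_forget[OF Z module_inD(1)[OF M] Ztheta(1)[OF b M m]]]
  show ?thesis
    using Ub_hom_unique[OF module_inD(2,3)[OF M] b c \<psi>(1) _ u] Ztheta(2)[OF b M m] \<psi>(2) at_hom(3)[OF b]
    by (simp add: Zact_def Zcls_def)
qed

text \<open>Substituting \<open>u\<close> for \<open>x\<close> is a homomorphism from
  \<open>Ub ?c\<close> to \<open>Ub b\<close>, where \<open>at_comp\<close> says that it respects
  the fibres. Followed by the unit of \<open>Ub b\<close> it sends \<open>x\<close> to the class of
  \<open>u\<close>, so \<open>Zact_cls\<close> applies to it with the module
  \<open>ZM b\<close>.\<close>

lemma Zmult_cls:
  assumes b: "b \<in> carrier A" and u: "u \<in> carrier U" and v: "v \<in> carrier U"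
  shows "Zmult Om E A (at v (at u b)) (at u b) b (cls (at u b) v) (cls b u) = cls b (pol_comp Om E A v u)"
proof -
  let ?c = "at u b" let ?vu = "\<lambda>v. pol_comp Om E A v u"
  have c: "?c \<in> carrier A" by (rule at_closed[OF b u])
  have "(\<lambda>a. ?vu) \<in> pover_hom Om A (Ub ?c) (Ub b)"
  proof (rule pover_homI)
    fix f as vs
    assume f: "f \<in> Om (length as)" and l: "length vs = length as"
      and "\<And>i. i < length as \<Longrightarrow> vs ! i \<in> pset (Ub ?c) (as ! i)"
    with Ub_tuple[OF l] have vs: "set vs \<subseteq> carrier U" by blast
    have "map2 (\<lambda>a. ?vu) as vs = map ?vu vs" using l by (intro nth_equalityI) auto
    then show "?vu (pop (Ub ?c) f as vs) = pop (Ub b) f as (map2 (\<lambda>a. ?vu) as vs)"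
      using comp_hom(1)[OF u] f l vs by (simp add: Ub_simps alg_hom_def)
  qed (use comp_closed[OF u] at_comp[OF b u] comp_hom(2)[OF u] in \<open>auto simp: Ub_simps\<close>)
  from pover_hom_comp[OF this cls_hom[OF b]]
  show ?thesis
    using Zact_cls[OF Zmod_in[OF b] c cls_closed[OF b u] _ _ v, of "\<lambda>a v. modulize_unit Om A (Ub b) a (?vu v)"]
      comp_hom(3)[OF u] at_comp[OF b u v]
    by (simp add: Zmult_def Zcls_def)
qed

text \<open>The unit of the modulization preserves basepoints, and the basepoints of
  \<open>Ub b\<close> are the constants.\<close>

lemma Z_one:
  assumes a: "a \<in> carrier A" and b: "b \<in> carrier A"
  shows "\<one>\<^bsub>Z Om E A a b\<^esub> = cls b (const a)"
  using pover_hom_closed(2)[OF cls_hom[OF b] a] at_hom(2)[OF b a]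
  by (simp add: Z_def Zcls_def Ub_simps forget_def)

lemma Zmult_bilinear:
  assumes "a \<in> carrier A" "b \<in> carrier A" "c \<in> carrier A"
  shows "bilinear_map (Z Om E A a b) (Z Om E A b c) (Z Om E A a c) (Zmult Om E A a b c)"
  using Zact_bilinear[OF Zmod_in[OF assms(3)] assms(1,2)] by (simp add: Zmult_def[abs_def] Z_def)

lemma Zmult_assoc:
  assumes "a \<in> carrier A" "b \<in> carrier A" "c \<in> carrier A" and d: "d \<in> carrier A"
    and "z \<in> carrier (Z Om E A a b)" "z' \<in> carrier (Z Om E A b c)" "z'' \<in> carrier (Z Om E A c d)"
  shows "Zmult Om E A a c d (Zmult Om E A a b c z z') z'' = Zmult Om E A a b d z (Zmult Om E A b c d z' z'')"
  using Zact_assoc[OF Zmod_in[OF d] assms(1-3,5,6), of z''] assms(7) by (simp add: Zmult_def Z_def)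

lemma Zringoid_is_ringoid: "is_ringoid (Zringoid Om E A)"
  unfolding is_ringoid_def Zringoid_def
  using is_module_group(1)[OF module_inD(1)[OF Zmod_in]] Zmult_bilinear cls_x Zmult_x Zmult_assoc
  by (simp add: Z_def)

lemma Zringoid_module:
  assumes M: "module_in Om E A M"
  shows "is_left_module (Zringoid Om E A) (mgrp M) (Zact Om E A M)"
  unfolding is_left_module_def Zringoid_def
  using is_module_group(1)[OF module_inD(1)[OF M]] Zact_bilinear[OF M] Zact_x[OF _ M] Zact_assoc[OF M]
  by simp

end

theorem theorem8p1:
  fixes Om :: "nat \<Rightarrow> 'f set"
    and E :: "(('f, nat) trm \<times> ('f, nat) trm) set"
    and A :: "('f, 'a) alg"
    and M :: "('f, 'a, 'm) amod"
  assumes V: "is_identities Om E"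
    and A: "in_variety Om E A"
    and M: "module_in Om E A M"
  shows
    \<comment> \<open>(1)\<close>
    "(\<forall>b\<in>carrier A. \<forall>m\<in>carrier (mgrp M b).
        Zact Om E A M b b (Zcls Om E A b (pol_x Om E A)) m = m)
     \<and> \<comment> \<open>(2)\<close>
     (\<forall>a\<in>carrier A. \<forall>b\<in>carrier A. \<forall>z\<in>carrier (Z Om E A a b).
        Zmult Om E A a b b z (Zcls Om E A b (pol_x Om E A)) = z \<and>
        Zmult Om E A a a b (Zcls Om E A a (pol_x Om E A)) z = z)
     \<and> \<comment> \<open>(3)\<close>
     (\<forall>a\<in>carrier A. \<forall>b\<in>carrier A.
        bilinear_map (Z Om E A a b) (mgrp M b) (mgrp M a) (Zact Om E A M a b))
     \<and> \<comment> \<open>(4)\<close>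
     (\<forall>a\<in>carrier A. \<forall>b\<in>carrier A. \<forall>c\<in>carrier A.
        bilinear_map (Z Om E A a b) (Z Om E A b c) (Z Om E A a c) (Zmult Om E A a b c))
     \<and> \<comment> \<open>(5)\<close>
     (\<forall>b\<in>carrier A. \<forall>u\<in>carrier (Pol1 Om E A). \<forall>m\<in>carrier (mgrp M b).
        Zact Om E A M (pol_at Om E A u b) b (Zcls Om E A b u) m
          = pol_act Om E A (forget M) b u m)
     \<and> \<comment> \<open>(6)\<close>
     (\<forall>b\<in>carrier A. \<forall>u\<in>carrier (Pol1 Om E A). \<forall>v\<in>carrier (Pol1 Om E A).
        Zmult Om E A (pol_at Om E A v (pol_at Om E A u b)) (pol_at Om E A u b) b
            (Zcls Om E A (pol_at Om E A u b) v) (Zcls Om E A b u)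
          = Zcls Om E A b (pol_comp Om E A v u))
     \<and> \<comment> \<open>(7)\<close>
     (\<forall>a\<in>carrier A. \<forall>b\<in>carrier A. \<forall>c\<in>carrier A.
        \<forall>z'\<in>carrier (Z Om E A a b). \<forall>z\<in>carrier (Z Om E A b c). \<forall>m\<in>carrier (mgrp M c).
          Zact Om E A M a c (Zmult Om E A a b c z' z) m
            = Zact Om E A M a b z' (Zact Om E A M b c z m))
     \<and> \<comment> \<open>(8)\<close>
     (\<forall>a\<in>carrier A. \<forall>b\<in>carrier A. \<forall>c\<in>carrier A. \<forall>d\<in>carrier A.
        \<forall>z\<in>carrier (Z Om E A a b). \<forall>z'\<in>carrier (Z Om E A b c). \<forall>z''\<in>carrier (Z Om E A c d).
          Zmult Om E A a c d (Zmult Om E A a b c z z') z''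
            = Zmult Om E A a b d z (Zmult Om E A b c d z' z''))
     \<and> \<comment> \<open>(9)\<close>
     (is_ringoid (Zringoid Om E A) \<and>
        (\<forall>a\<in>carrier A. \<forall>b\<in>carrier A.
           \<one>\<^bsub>Z Om E A a b\<^esub> = Zcls Om E A b (pol_const Om E A a)))
     \<and> \<comment> \<open>(10)\<close>
     is_left_module (Zringoid Om E A) (mgrp M) (Zact Om E A M)
     \<and> \<comment> \<open>(11)\<close>
     (\<forall>(M' :: ('f, 'a, 'n) amod) \<phi>.
        module_in Om E A M' \<longrightarrow> \<phi> \<in> module_hom Om A M M' \<longrightarrow>
        (\<forall>a\<in>carrier A. \<forall>b\<in>carrier A. \<forall>z\<in>carrier (Z Om E A a b). \<forall>m\<in>carrier (mgrp M b).
           Zact Om E A M' a b z (\<phi> b m) = \<phi> a (Zact Om E A M a b z m)))"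
proof -
  interpret pol_algebra Om E A by unfold_locales (rule V, rule A)
  have 5: "Zact Om E A M (pol_at Om E A u b) b (Zcls Om E A b u) m = pol_act Om E A (forget M) b u m"
    if "b \<in> carrier A" "u \<in> carrier (Pol1 Om E A)" "m \<in> carrier (mgrp M b)" for b u m
    using Zact_cls[OF M that(1,3) _ _ that(2)] pol_psi[OF module_inD(2,3)[OF M] that(1), of m] that(3)
    by (simp add: pol_act_def forget_def)
  show ?thesis
    by (intro conjI ballI allI impI)
      (simp_all add: Zact_x[OF _ M] Zmult_x Zact_bilinear[OF M] Zmult_bilinear 5 Zmult_cls
        Zact_assoc[OF M] Zmult_assoc Zringoid_is_ringoid Z_one Zringoid_module[OF M] Zact_natural[OF M])
qed

end
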